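(* For integers $m\ge2$ and $n\ge1$ write $V_{\mathcal{P}}:=\operatorname{Vol}(\mathcal{P}_{m,n}\cap \mathcal{D}_{m,n})$, $V_{\mathcal{Q}}:=\operatorname{Vol}(\mathcal{Q}_{m,n}\cap \mathcal{D}_{m,n})$, $R:=V_{\mathcal{Q}}/V_{\mathcal{P}}$, and $$\psi(n,m):=\int_0^1\bigl(1-t^{m-1}\bigr)^n\,dt=\frac{\Gamma(1+k)\,\Gamma(n+1)}{\Gamma(n+1+k)},\qquad k:=\frac1{m-1}.$$ As $m+n\to\infty$, in any manner (that is, with no restriction on the relative growth of $m$ and $n$), $$V_{\mathcal{Q}} \sim ((m-1)!)^{-n}\Bigl(1-\frac1m\Bigr)^{m},\qquad V_{\mathcal{P}} \sim ((m-1)!)^{-n}\,\psi(n,m)^{m},\qquad R \sim \prod_{j=2}^{n}\Bigl(1+\frac{1}{(m-1)j}\Bigr)^{m}.$$ Moreover, for all $m\ge2$ and $n\ge1$, $$\Bigl(1-\frac{12}{n+1}\Bigr)\psi(n,m)^m\le ((m-1)!)^nV_{\mathcal{P}}\le \psi(n,m)^m,\qquad \Bigl(1-\frac{10}{m}\Bigr)e^{-1}\le ((m-1)!)^nV_{\mathcal{Q}}\le e^{-1},$$ and $$\ln\prod_{j=2}^{n}\Bigl(1+\frac{1}{(m-1)j}\Bigr)^{m}=\frac{m}{m-1}\,(H_n-1)-\theta\quad\text{with}\quad 0\le\theta\le\frac{1}{m-1}.$$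
   Context: Let $m\ge2$, $n\ge1$ be integers, $M=\{1,\dots,m\}$, $N=\{1,\dots,n\}$. The set $\mathcal{P}_{m,n}$ (strong relaxation) consists of all $(x,y)\in\mathbb{R}^{m\times n}\times\mathbb{R}^m$ with $0\le x_{ij}\le y_i$ for all $(i,j)\in M\times N$ and $y_i\le 1$ for all $i\in M$. The set $\mathcal{Q}_{m,n}$ (weak relaxation) consists of all $(x,y)\in\mathbb{R}^{m\times n}\times\mathbb{R}^m$ with $\sum_{j\in N}x_{ij}\le n y_i$ for all $i\in M$, $0\le x_{ij}\le 1$ for all $(i,j)\in M\times N$, and $y_i\le1$ for all $i\in M$. The demand constraints define $\mathcal{D}_{m,n}=\{(x,y)\in\mathbb{R}^{m\times n}\times\mathbb{R}^m:\ \sum_{i\in M}x_{ij}=1\ \ \forall j\in N\}$, an affine subspace of dimension $d=(m-1)n+m$. For $K\subset\mathcal{D}_{m,n}$, $\operatorname{Vol}(K)$ denotes the $d$-dimensional Lebesgue measure of the image of $K$ under the coordinate projection $\mathcal{D}_{m,n}\to\mathbb{R}^d$ that deletes the variables $x_{mj}$, $j\in N$ (an affine bijection). $H_n=\sum_{j=1}^n1/j$, $\ln$ is the natural logarithm, and for positive quantities $a,b$ depending on $m$ and $n$, $a\sim b$ means $a/b\to1$ (here: along every sequence of pairs $(m,n)$ with $m+n\to\infty$). Empty products equal $1$. *)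

theory Defs
  imports "HOL-Analysis.Analysis"
begin

text \<open>
  A point \<open>(x, y)\<close> of \<open>\<real>\<^sup>m\<^sup>\<times>\<^sup>n \<times> \<real>\<^sup>m\<close> is a pair of extensional functions (value \<open>undefined\<close> off the
  index sets), so that every point has exactly one representative; this is also the carrier
  convention of the product measures \<open>Pi\<^sub>M\<close> used for the volume.
\<close>

type_synonym point = "(nat \<times> nat \<Rightarrow> real) \<times> (nat \<Rightarrow> real)"

definition ambient :: "nat \<Rightarrow> nat \<Rightarrow> point set" where
  "ambient m n = (({1..m} \<times> {1..n}) \<rightarrow>\<^sub>E UNIV) \<times> ({1..m} \<rightarrow>\<^sub>E UNIV)"

definition strong_relaxation :: "nat \<Rightarrow> nat \<Rightarrow> point set" where
  "strong_relaxation m n = {(x, y) \<in> ambient m n.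
     (\<forall>i\<in>{1..m}. \<forall>j\<in>{1..n}. 0 \<le> x (i, j) \<and> x (i, j) \<le> y i) \<and>
     (\<forall>i\<in>{1..m}. y i \<le> 1)}"

definition weak_relaxation :: "nat \<Rightarrow> nat \<Rightarrow> point set" where
  "weak_relaxation m n = {(x, y) \<in> ambient m n.
     (\<forall>i\<in>{1..m}. (\<Sum>j\<in>{1..n}. x (i, j)) \<le> real n * y i) \<and>
     (\<forall>i\<in>{1..m}. \<forall>j\<in>{1..n}. 0 \<le> x (i, j) \<and> x (i, j) \<le> 1) \<and>
     (\<forall>i\<in>{1..m}. y i \<le> 1)}"

definition demand :: "nat \<Rightarrow> nat \<Rightarrow> point set" where
  "demand m n = {(x, y) \<in> ambient m n. \<forall>j\<in>{1..n}. (\<Sum>i\<in>{1..m}. x (i, j)) = 1}"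

definition drop_last :: "nat \<Rightarrow> nat \<Rightarrow> point \<Rightarrow> point" where
  "drop_last m n = (\<lambda>(x, y). (restrict x ({1..<m} \<times> {1..n}), y))"

text \<open>
  The completion of the product of \<open>(m - 1) n + m\<close> copies of one-dimensional Borel-Lebesgue
  measure is Lebesgue measure in that dimension.
\<close>

definition reduced_lebesgue :: "nat \<Rightarrow> nat \<Rightarrow> point measure" where
  "reduced_lebesgue m n =
     completion (Pi\<^sub>M ({1..<m} \<times> {1..n}) (\<lambda>_. lborel) \<Otimes>\<^sub>M Pi\<^sub>M {1..m} (\<lambda>_. lborel))"

definition Vol :: "nat \<Rightarrow> nat \<Rightarrow> point set \<Rightarrow> real" where
  "Vol m n K = measure (reduced_lebesgue m n) (drop_last m n ` K)"

definition V_P :: "nat \<Rightarrow> nat \<Rightarrow> real" where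
  "V_P m n = Vol m n (strong_relaxation m n \<inter> demand m n)"

definition V_Q :: "nat \<Rightarrow> nat \<Rightarrow> real" where
  "V_Q m n = Vol m n (weak_relaxation m n \<inter> demand m n)"

definition vol_ratio :: "nat \<Rightarrow> nat \<Rightarrow> real" where
  "vol_ratio m n = V_Q m n / V_P m n"

definition psi :: "nat \<Rightarrow> nat \<Rightarrow> real" where
  "psi n m = integral {0..1} (\<lambda>t. (1 - t ^ (m - 1)) ^ n)"

text \<open>
  \<open>a \<sim> b\<close> as \<open>m + n \<rightarrow> \<infinity>\<close> in any manner. Since \<open>u / 0 = 0\<close>, the limit forces both quantities to be
  eventually nonzero along the sequence.
\<close>

definition asymp_mn :: "(nat \<Rightarrow> nat \<Rightarrow> real) \<Rightarrow> (nat \<Rightarrow> nat \<Rightarrow> real) \<Rightarrow> bool" where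
  "asymp_mn a b \<longleftrightarrow>
     (\<forall>\<mu> \<nu> :: nat \<Rightarrow> nat.
        (\<forall>k. 2 \<le> \<mu> k \<and> 1 \<le> \<nu> k) \<longrightarrow>
        filterlim (\<lambda>k. \<mu> k + \<nu> k) at_top sequentially \<longrightarrow>
        (\<lambda>k. a (\<mu> k) (\<nu> k) / b (\<mu> k) (\<nu> k)) \<longlonglongrightarrow> 1)"

end

theory Submission
  imports Defs
begin

text \<open>
  After rescaling by \<open>((m - 1)!)\<^sup>n\<close> the columns of \<open>x\<close> become independent uniform points of the
  standard simplex with entries \<open>X\<^sub>i\<^sub>j\<close>, and integrating out \<open>y\<close> leaves \<open>E (\<Prod>i. 1 - max\<^sub>j X\<^sub>i\<^sub>j)\<close> for the
  strong and \<open>E (\<Prod>i. 1 - (\<Sum>j. X\<^sub>i\<^sub>j) / n)\<close> for the weak relaxation.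

  Strong relaxation. Integrating out \<open>x\<close> first gives the integral over \<open>y \<in> [0,1]\<^sup>m\<close> of \<open>G(y)\<^sup>n\<close>, where
  \<open>G(y)\<close> is the probability that a uniform point of the simplex is bounded by \<open>y\<close>. Negative dependence of
  the coordinates yields \<open>G(y) \<le> (\<Prod>i. 1 - (1 - y\<^sub>i)\<^sup>m\<^sup>-\<^sup>1)\<close>, hence the upper bound \<open>\<psi>\<^sup>m\<close>. The union bound
  \<open>G(y) \<ge> 1 - (\<Sum>i. (1 - y\<^sub>i)\<^sup>m\<^sup>-\<^sup>1)\<close> differs from this product only in second order, which costs a
  factor \<open>1 - O(1/n)\<close>. For large \<open>m\<close> use Jensen's inequality instead: since \<open>- ln (1 - max\<^sub>j X\<^sub>i\<^sub>j)\<close> has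
  mean \<open>H\<^sub>n / (m - 1)\<close>, the expectation is at least \<open>exp (- m H\<^sub>n / (m - 1))\<close>, which is \<open>\<psi>\<^sup>m\<close> up to a factor
  \<open>1 - O(1/m)\<close> uniformly in \<open>n\<close>.

  Weak relaxation. The numbers \<open>a\<^sub>i = (\<Sum>j. X\<^sub>i\<^sub>j) / n\<close> sum to 1, so \<open>(\<Prod>i. 1 - a\<^sub>i) \<le> (1 - 1/m)\<^sup>m\<close>, and the
  relative defect is bounded by a multiple of \<open>\<Sum>i. (a\<^sub>i - 1/m)\<^sup>2\<close>, whose mean is a variance.
\<close>

section \<open>Slices of boxes\<close>

text \<open>Each of the two lower bounds for the strong relaxation fails in one regime: the error
  12/(n+1) does not vanish while n stays bounded, nor the Jensen error 4/m while m stays bounded.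
  Splitting at n <= m always leaves one of order 1/(m+n). Jensen loses only O(1/m), uniformly in n,
  because the sum of 1/j^2 converges: with k = 1/(m-1), \<open>psi\<close> is the product of
  1/(1+k/j), and m ln(1+k/j) differs from mk/j by at most m k^2/(2 j^2). Negative dependence rests
  on one fact: given X_1 = x, the other coordinates are uniform on a simplex of size 1-x, and the
  smaller that simplex, the likelier they respect fixed caps. So lowering one cap from 1 to a
  multiplies the probability by at most P(X_1 <= a). In the ratio the factor j = 1 of 1/psi cancels
  against 1-1/m, hence the product from j = 2. In the strong part everything is an extended
  nonnegative integral: -ln(1-max) may then be infinite, and inequalities are arranged as sums to
  avoid subtraction.\<close>

lemma nn_set_integral_cmult:
  assumes "f \<in> borel_measurable M" "A \<in> sets M"
  shows "(\<integral>\<^sup>+x\<in>A. c * f x \<partial>M) = c * (\<integral>\<^sup>+x\<in>A. f x \<partial>M)"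
  using assms by (subst nn_integral_cmult[symmetric]) (auto simp: mult_ac)

lemma nn_set_integral_multc:
  assumes "f \<in> borel_measurable M" "A \<in> sets M"
  shows "(\<integral>\<^sup>+x\<in>A. f x * c \<partial>M) = (\<integral>\<^sup>+x\<in>A. f x \<partial>M) * c"
  using assms by (subst nn_integral_multc[symmetric]) (auto simp: mult_ac)

text \<open>The density at \<open>s\<close> of the image of Lebesgue measure on the box of all
  [0, a_i] under the coordinate sum, that is, the convolution of the indicators. The value at the
  empty list is a default: the empty convolution is a point mass without density, so the recursion
  stops at one cap and later lemmas ask for a nonempty list.\<close>

fun slice :: "real list \<Rightarrow> real \<Rightarrow> ennreal" where
  "slice [] s = 0"
| "slice [a] s = indicator {0..a} s"
| "slice (a # b # bs) s = (\<integral>\<^sup>+x\<in>{0..a}. slice (b # bs) (s - x) \<partial>lborel)"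

declare slice.simps(3)[simp del]

lemma measurable_slice[measurable]: "slice as \<in> borel_measurable borel"
proof (induction as rule: induct_list012)
  case 1 then show ?case by simp
next
  case (2 a) then show ?case by simp
next
  case (3 a b bs)
  note [measurable] = 3(2)
  show ?case unfolding slice.simps(3)[abs_def] by measurable
qed

lemma slice_Cons:
  "as \<noteq> [] \<Longrightarrow> slice (a # as) s = (\<integral>\<^sup>+x\<in>{0..a}. slice as (s - x) \<partial>lborel)"
  by (cases as) (auto simp: slice.simps(3))

lemma slice_Cons_cmult:
  assumes "as \<noteq> []"
  shows "(\<integral>\<^sup>+x\<in>{0..a}. c * slice as (s - x) \<partial>lborel) = c * slice (a # as) s"
proof -
  have "(\<integral>\<^sup>+x\<in>{0..a}. c * slice as (s - x) \<partial>lborel) = c * (\<integral>\<^sup>+x\<in>{0..a}. slice as (s - x) \<partial>lborel)"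
    by (rule nn_set_integral_cmult) auto
  then show ?thesis using slice_Cons[OF assms] by simp
qed

text \<open>Commutativity of convolution: the reflection x -> s - x for two caps, Fubini for more.
  It yields the rotations that bring a chosen cap to the head, where the recursion acts.\<close>

lemma slice_Cons_Cons_commute: "slice (a # b # bs) s = slice (b # a # bs) s"
proof (cases bs)
  case Nil
  have "slice [a, b] s = (\<integral>\<^sup>+x. indicator {0..a} x * indicator {0..b} (s - x) \<partial>lborel)"
    by (simp add: slice.simps(3) mult.commute)
  also have "\<dots> = (\<integral>\<^sup>+x. indicator {0..a} (s - x) * indicator {0..b} x \<partial>lborel)"
    by (subst nn_integral_real_affine[where c = "-1" and t = s]) auto
  also have "\<dots> = slice [b, a] s" by (simp add: slice.simps(3))
  finally show ?thesis using Nil by simp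
next
  case (Cons c cs)
  then have ne: "bs \<noteq> []" by simp
  have "slice (a # b # bs) s =
      (\<integral>\<^sup>+x. \<integral>\<^sup>+u. indicator {0..a} x * indicator {0..b} u * slice bs (s - x - u) \<partial>lborel \<partial>lborel)"
    using ne by (auto simp: slice_Cons nn_integral_cmult[symmetric] mult_ac intro!: nn_integral_cong)
  also have "\<dots> =
      (\<integral>\<^sup>+u. \<integral>\<^sup>+x. indicator {0..a} x * indicator {0..b} u * slice bs (s - x - u) \<partial>lborel \<partial>lborel)"
    by (rule lborel_pair.Fubini') simp
  also have "\<dots> = slice (b # a # bs) s"
    using ne by (auto simp: slice_Cons nn_integral_cmult[symmetric] mult_ac diff_diff_eq add.commute
        intro!: nn_integral_cong)
  finally show ?thesis .
qed

lemma slice_Cons_cong: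
  assumes "slice as = slice bs" "as \<noteq> []" "bs \<noteq> []"
  shows "slice (a # as) = slice (a # bs)"
  using assms by (simp add: fun_eq_iff slice_Cons)

lemma slice_rotate1: "slice (as @ [a]) = slice (a # as)"
proof (induction as)
  case (Cons b bs)
  have "slice (b # (bs @ [a])) = slice (b # a # bs)"
    by (rule slice_Cons_cong[OF Cons]) auto
  also have "\<dots> = slice (a # b # bs)" by (simp add: fun_eq_iff slice_Cons_Cons_commute)
  finally show ?case by simp
qed simp

lemma slice_append_commute: "slice (as @ bs) = slice (bs @ as)"
proof (induction bs arbitrary: as)
  case (Cons b bs)
  have "slice (as @ b # bs) = slice (bs @ as @ [b])" using Cons[of "as @ [b]"] by simp
  also have "\<dots> = slice (b # bs @ as)" using slice_rotate1[of "bs @ as" b] by simp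
  finally show ?case by simp
qed simp

lemma slice_neg: "s < 0 \<Longrightarrow> slice as s = 0"
proof (induction as arbitrary: s rule: induct_list012)
  case (3 a b bs)
  have "slice (a # b # bs) s = (\<integral>\<^sup>+x. 0 \<partial>(lborel :: real measure))"
    unfolding slice.simps(3) using 3 by (intro nn_integral_cong) (auto simp: indicator_def)
  then show ?case by simp
qed auto

text \<open>Up to a constant, \<^term>\<open>slice as s\<close> is \<open>s ^ (length as - 1)\<close> times the probability that a
  uniform point of the simplex scaled by \<open>s\<close> respects the upper bounds \<open>as\<close>.\<close>

lemma slice_scale:
  assumes "0 < t" "t \<le> s" "\<forall>a\<in>set as. 0 \<le> a"
  shows "ennreal (t ^ (length as - 1)) * slice as s \<le> ennreal (s ^ (length as - 1)) * slice as t"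
  using assms
proof (induction as arbitrary: s t rule: induct_list012)
  case (2 a) then show ?case by (auto simp: indicator_def)
next
  case (3 a b bs)
  let ?as = "b # bs" and ?p = "length bs"
  have s: "0 < s" using 3 by simp
  define r where "r = s / t"
  have r: "r \<ge> 1" "s = r * t" using 3 by (auto simp: r_def field_simps)
  have "ennreal (t ^ Suc ?p) * slice (a # ?as) s =
      ennreal t * (\<integral>\<^sup>+x\<in>{0..a}. ennreal (t ^ ?p) * slice ?as (s - x) \<partial>lborel)"
    using 3(3) by (subst slice_Cons_cmult) (auto simp: ennreal_mult mult_ac)
  \<comment> \<open>Rescaling x by r = s/t turns the section at s into one at t. The first cap
    becomes a/r, which is at most a because r >= 1.\<close>
  also have "\<dots> = ennreal t * (ennreal r *
      (\<integral>\<^sup>+x. ennreal (t ^ ?p) * slice ?as (r * (t - x)) * indicator {0..a} (r * x) \<partial>lborel))"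
    using r by (subst nn_integral_real_affine[where c = r and t = 0])
      (auto simp: algebra_simps)
  also have "\<dots> \<le> ennreal t * (ennreal r *
      (\<integral>\<^sup>+x. ennreal (s ^ ?p) * slice ?as (t - x) * indicator {0..a} x \<partial>lborel))"
  proof (intro mult_left_mono nn_integral_mono)
    fix x :: real
    consider "0 \<le> r * x \<and> r * x \<le> a \<and> x < t" | "0 \<le> r * x \<and> r * x \<le> a \<and> t \<le> x" | "\<not> (0 \<le> r * x \<and> r * x \<le> a)"
      by linarith
    then show "ennreal (t ^ ?p) * slice ?as (r * (t - x)) * indicator {0..a} (r * x)
        \<le> ennreal (s ^ ?p) * slice ?as (t - x) * indicator {0..a} x"
    proof cases
      case 1
      have "ennreal ((t - x) ^ ?p) * (ennreal (t ^ ?p) * slice ?as (r * (t - x))) =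
          ennreal (t ^ ?p) * (ennreal ((t - x) ^ ?p) * slice ?as (r * (t - x)))"
        by (simp add: mult_ac)
      also have "\<dots> \<le> ennreal (t ^ ?p) * (ennreal ((r * (t - x)) ^ ?p) * slice ?as (t - x))"
        using 3(2)[of "t - x" "r * (t - x)"] 3(5) 1 r mult_right_mono[of 1 r "t - x"]
        by (intro mult_left_mono) auto
      also have "\<dots> = ennreal ((t - x) ^ ?p) * (ennreal (s ^ ?p) * slice ?as (t - x))"
        using r(1) 3(3) 1 unfolding r(2) by (simp add: power_mult_distrib ennreal_mult mult_ac)
      finally have "ennreal (t ^ ?p) * slice ?as (r * (t - x)) \<le> ennreal (s ^ ?p) * slice ?as (t - x)"
        using 1 by (subst (asm) ennreal_mult_le_mult_iff) auto
      moreover have "0 \<le> x" "x \<le> a"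
        using 1 r(1) mult_right_mono[of 1 r x] by (auto simp: zero_le_mult_iff)
      ultimately show ?thesis by (auto simp: indicator_def)
    next
      \<comment> \<open>The induction hypothesis needs t - x > 0. Beyond t the left slice has a
        negative argument and vanishes; at x = t both arguments are 0 and t <= s suffices.\<close>
      case 2
      show ?thesis
      proof (cases "x = t")
        case True
        have "x \<le> r * x" using mult_right_mono[of 1 r x] 2 3(3) r(1) by auto
        then have "x \<le> a" using 2 by linarith
        moreover have "t ^ ?p \<le> s ^ ?p" using 3(3,4) by (simp add: power_mono)
        ultimately show ?thesis using True 3(3)
          by (auto simp: indicator_def intro!: mult_right_mono ennreal_leI)
      next
        case False
        then have "r * (t - x) < 0" using 2 r by (simp add: mult_less_0_iff)
        then show ?thesis by (simp add: slice_neg)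
      qed
    qed (auto simp: indicator_def)
  qed simp_all
  also have "\<dots> = ennreal (s ^ Suc ?p) * slice (a # ?as) t"
    using s 3(3) r(1) unfolding r(2) by (subst slice_Cons_cmult) (auto simp: ennreal_mult mult_ac)
  finally show ?case by simp
qed simp

section \<open>Association inequality and product bound for slices\<close>

lemma nn_integral_one_minus_power:
  assumes "0 \<le> a" "a \<le> b" "b \<le> (1::real)"
  shows "(\<integral>\<^sup>+x\<in>{a..b}. ennreal ((1 - x) ^ p) \<partial>lborel) =
    ennreal (((1 - a) ^ Suc p - (1 - b) ^ Suc p) / real (Suc p))"
proof -
  have "(\<integral>\<^sup>+x\<in>{a..b}. ennreal ((1 - x) ^ p) \<partial>lborel) =
      ennreal (- ((1 - b) ^ Suc p / real (Suc p)) - - ((1 - a) ^ Suc p / real (Suc p)))"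
  proof (rule nn_integral_FTC_Icc)
    fix x assume "x \<in> {a..b}"
    show "((\<lambda>x. - ((1 - x) ^ Suc p / real (Suc p))) has_real_derivative (1 - x) ^ p) (at x)"
      by (rule derivative_eq_intros refl | simp)+
  qed (use assms in auto)
  then show ?thesis by (simp add: diff_divide_distrib)
qed

text \<open>Chebyshev's association inequality: after normalization the integrand of \<^term>\<open>slice (1 # as) 1\<close>
  is nondecreasing.\<close>

lemma slice_Cons_le:
  assumes "as \<noteq> []" "\<forall>a\<in>set as. 0 \<le> a" "0 \<le> a" "a \<le> 1"
  shows "slice (a # as) 1 \<le> ennreal (1 - (1 - a) ^ length as) * slice (1 # as) 1"
proof (cases "a = 1")
  case True
  then show ?thesis using assms(1) by (simp add: zero_power)
next
  case False
  with assms have a: "0 \<le> a" "a < 1" by auto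
  define p where "p = length as - 1"
  have p: "length as = Suc p" using assms(1) by (cases as) (auto simp: p_def)
  \<comment> \<open>\<open>th\<close> is the mass of [a, 1] under the density (p+1)(1-x)^p of a free
    coordinate. The quotient of \<open>w\<close> by \<open>d\<close> is the normalized integrand at
    the cut x = a: it dominates the values on [0, a] and is dominated by those on [a, 1], so
    comparing both parts with it gives the inequality.\<close>
  define th where "th = (1 - a) ^ Suc p"
  have th: "0 < th" "th \<le> 1" using a by (auto simp: th_def intro!: power_le_one simp del: power_Suc)
  define w where "w = slice as (1 - a)"
  define d where "d = (1 - a) ^ p"
  have d: "d > 0" using a by (simp add: d_def)
  define A where "A = slice (a # as) 1"
  define B where "B = (\<integral>\<^sup>+x\<in>{a..1}. slice as (1 - x) \<partial>lborel)"
  have A: "ennreal d * A \<le> ennreal ((1 - th) / Suc p) * w"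
  proof -
    have "ennreal d * A = (\<integral>\<^sup>+x\<in>{0..a}. ennreal d * slice as (1 - x) \<partial>lborel)"
      using assms(1) by (simp add: A_def slice_Cons_cmult)
    also have "\<dots> \<le> (\<integral>\<^sup>+x\<in>{0..a}. ennreal ((1 - x) ^ p) * w \<partial>lborel)"
      using slice_scale[of "1 - a" "1 - x" as for x] assms(2) a
      by (intro nn_integral_mono) (auto simp: indicator_def d_def w_def p_def)
    also have "\<dots> = (\<integral>\<^sup>+x\<in>{0..a}. ennreal ((1 - x) ^ p) \<partial>lborel) * w"
      by (rule nn_set_integral_multc) auto
    finally show ?thesis using a by (simp add: nn_integral_one_minus_power th_def)
  qed
  have B: "ennreal (th / Suc p) * w \<le> ennreal d * B"
  proof -
    have "ennreal (th / Suc p) * w = (\<integral>\<^sup>+x\<in>{a..1}. ennreal ((1 - x) ^ p) \<partial>lborel) * w"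
      using a by (simp add: nn_integral_one_minus_power th_def)
    also have "\<dots> = (\<integral>\<^sup>+x\<in>{a..1}. ennreal ((1 - x) ^ p) * w \<partial>lborel)"
      by (rule nn_set_integral_multc[symmetric]) auto
    \<comment> \<open>The null point x = 1 is removed because \<open>slice_scale\<close> needs a
      positive smaller argument, here 1 - x.\<close>
    also have "\<dots> = (\<integral>\<^sup>+x\<in>{a..<1}. ennreal ((1 - x) ^ p) * w \<partial>lborel)"
      using AE_lborel_singleton[of "1 :: real"]
      by (intro nn_integral_cong_AE) (auto elim!: eventually_mono simp: indicator_def)
    also have "\<dots> \<le> (\<integral>\<^sup>+x\<in>{a..1}. ennreal d * slice as (1 - x) \<partial>lborel)"
      using slice_scale[of "1 - x" "1 - a" as for x] assms(2) a
      by (intro nn_integral_mono) (auto simp: indicator_def d_def w_def p_def)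
    also have "\<dots> = ennreal d * B"
      unfolding B_def by (rule nn_set_integral_cmult) auto
    finally show ?thesis .
  qed
  have AB: "slice (1 # as) 1 = A + B"
  proof -
    have "slice (1 # as) 1 = (\<integral>\<^sup>+x\<in>{0..a} \<union> {a..1}. slice as (1 - x) \<partial>lborel)"
      using assms(1) a by (simp add: slice_Cons ivl_disj_un)
    also have "\<dots> = (\<integral>\<^sup>+x. slice as (1 - x) * indicator {0..a} x + slice as (1 - x) * indicator {a..1} x \<partial>lborel)"
      using AE_lborel_singleton[of "a"]
      by (intro nn_integral_cong_AE) (auto elim!: eventually_mono simp: indicator_def)
    also have "\<dots> = A + B" using assms(1) by (subst nn_integral_add) (auto simp: A_def B_def slice_Cons)
    finally show ?thesis .
  qed
  have "ennreal d * (ennreal th * A) = ennreal th * (ennreal d * A)" by (simp add: mult_ac)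
  also have "\<dots> \<le> ennreal th * (ennreal ((1 - th) / Suc p) * w)" by (intro mult_left_mono A) simp
  also have "\<dots> = ennreal (1 - th) * (ennreal (th / Suc p) * w)"
    using th by (simp add: ennreal_mult[symmetric] mult.assoc[symmetric] mult_ac)
  also have "\<dots> \<le> ennreal (1 - th) * (ennreal d * B)" by (intro mult_left_mono B) simp
  also have "\<dots> = ennreal d * (ennreal (1 - th) * B)" by (simp add: mult_ac)
  finally have *: "ennreal th * A \<le> ennreal (1 - th) * B"
    using d by (subst (asm) ennreal_mult_le_mult_iff) auto
  have "A = ennreal (th + (1 - th)) * A" by simp
  also have "\<dots> = ennreal th * A + ennreal (1 - th) * A"
    using th by (subst ennreal_plus) (auto simp: distrib_right)
  also have "\<dots> \<le> ennreal (1 - th) * B + ennreal (1 - th) * A" by (intro add_right_mono *)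
  also have "\<dots> = ennreal (1 - th) * slice (1 # as) 1" by (simp add: AB distrib_left add.commute)
  finally show ?thesis by (simp add: A_def th_def p)
qed

lemma slice_ones:
  assumes "0 \<le> s" "s \<le> 1"
  shows "slice (replicate (Suc p) 1) s = ennreal (s ^ p / fact p)"
  using assms
proof (induction p arbitrary: s)
  case 0
  then show ?case by simp
next
  case (Suc p)
  have "slice (replicate (Suc (Suc p)) 1) s =
      (\<integral>\<^sup>+x\<in>{0..1}. slice (replicate (Suc p) 1) (s - x) \<partial>lborel)"
    by (simp add: slice_Cons del: slice.simps)
  also have "\<dots> = (\<integral>\<^sup>+x\<in>{0..s}. ennreal ((s - x) ^ p / fact p) \<partial>lborel)"
    using Suc by (intro nn_integral_cong)
      (auto simp: indicator_def slice_neg simp del: replicate.simps)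
  also have "\<dots> = ennreal (- ((s - s) ^ Suc p / fact (Suc p)) - - ((s - 0) ^ Suc p / fact (Suc p)))"
  proof (rule nn_integral_FTC_Icc)
    fix x assume "x \<in> {0..s}"
    show "((\<lambda>x. - ((s - x) ^ Suc p / fact (Suc p))) has_real_derivative (s - x) ^ p / fact p) (at x)"
    proof -
      have "((\<lambda>x. (s - x) ^ Suc p) has_real_derivative - (real (Suc p) * (s - x) ^ p)) (at x)"
        by (auto intro!: derivative_eq_intros simp del: power_Suc)
      note DERIV_cmult[OF this, of "- (1 / fact (Suc p))"]
      then show ?thesis by (simp add: fact_Suc divide_simps)
    qed
  qed (use Suc.prems in auto)
  also have "\<dots> = ennreal (s ^ Suc p / fact (Suc p))" by simp
  finally show ?case .
qed

text \<open>The caps are replaced by 1 one at a time, each at the price of its marginal factor. A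
  cap of 1 never binds at s = 1, so \<open>replicate q 1\<close> is a pool of free coordinates that
  grows while the total stays at p + 1. With \<open>1 \<le> p\<close> a list remains after a cap is
  split off, as \<open>slice_Cons_le\<close> requires.\<close>

lemma slice_le_prod:
  assumes "\<forall>a\<in>set as. 0 \<le> a \<and> a \<le> 1" "length as + q = Suc p" "1 \<le> p"
  shows "slice (as @ replicate q 1) 1 \<le> ennreal ((\<Prod>a\<leftarrow>as. 1 - (1 - a) ^ p) / fact p)"
  using assms
proof (induction as arbitrary: q)
  case Nil
  then show ?case by (simp add: slice_ones del: replicate.simps)
next
  case (Cons a as)
  have a: "0 \<le> a" "a \<le> 1" using Cons.prems by auto
  have ne: "as @ replicate q 1 \<noteq> []" using Cons.prems by auto
  have "slice (a # as @ replicate q 1) 1 \<le> ennreal (1 - (1 - a) ^ p) * slice (1 # as @ replicate q 1) 1"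
    using slice_Cons_le[OF ne _ a] Cons.prems by (simp add: ball_Un)
  also have "slice (1 # as @ replicate q 1) = slice (as @ replicate (Suc q) 1)"
    using slice_rotate1[of "as @ replicate q 1" 1] by (simp add: replicate_append_same)
  also have "ennreal (1 - (1 - a) ^ p) * slice (as @ replicate (Suc q) 1) 1 \<le>
      ennreal (1 - (1 - a) ^ p) * ennreal ((\<Prod>a\<leftarrow>as. 1 - (1 - a) ^ p) / fact p)"
    using Cons.prems by (intro mult_left_mono Cons.IH) auto
  also have "\<dots> = ennreal ((\<Prod>a\<leftarrow>a # as. 1 - (1 - a) ^ p) / fact p)"
    using a by (subst ennreal_mult'[symmetric]) (auto intro!: power_le_one)
  finally show ?case by simp
qed

lemma slice_single_cap:
  assumes "0 \<le> a" "a \<le> 1" "q + r = Suc p"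
  shows "slice (replicate q 1 @ a # replicate r 1) 1 = ennreal ((1 - (1 - a) ^ Suc p) / fact (Suc p))"
proof -
  have "slice (replicate q 1 @ a # replicate r 1) 1 = slice (a # replicate (Suc p) 1) 1"
    using slice_append_commute[of "replicate q 1" "a # replicate r 1"] assms(3)
    by (simp add: replicate_add[symmetric] add.commute)
  also have "\<dots> = (\<integral>\<^sup>+x\<in>{0..a}. slice (replicate (Suc p) 1) (1 - x) \<partial>lborel)"
    by (subst slice_Cons) auto
  also have "\<dots> = (\<integral>\<^sup>+x\<in>{0..a}. ennreal ((1 - x) ^ p) * ennreal (1 / fact p) \<partial>lborel)"
    using assms by (intro nn_integral_cong)
      (auto simp: indicator_def slice_ones ennreal_mult[symmetric] simp del: replicate.simps)
  also have "\<dots> = (\<integral>\<^sup>+x\<in>{0..a}. ennreal ((1 - x) ^ p) \<partial>lborel) * ennreal (1 / fact p)"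
    by (simp add: nn_set_integral_multc)
  also have "\<dots> = ennreal ((1 - (1 - a) ^ Suc p) / fact (Suc p))"
    using assms by (subst nn_integral_one_minus_power)
      (auto simp: ennreal_mult''[symmetric] ennreal_mult'[symmetric] mult.commute)
  finally show ?thesis .
qed

section \<open>Uniform points of the simplex\<close>

declare One_nat_def[simp del]

text \<open>Barycentric coordinates, the last of which is eliminated as in \<^const>\<open>drop_last\<close>.\<close>

definition coord :: "nat \<Rightarrow> (nat \<Rightarrow> real) \<Rightarrow> nat \<Rightarrow> real" where
  "coord m x i = (if i = m then 1 - (\<Sum>l\<in>{1..<m}. x l) else x i)"

abbreviation column_space :: "nat \<Rightarrow> (nat \<Rightarrow> real) measure" where
  "column_space m \<equiv> Pi\<^sub>M {1..<m} (\<lambda>_. lborel)"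

definition std_simplex :: "nat \<Rightarrow> (nat \<Rightarrow> real) set" where
  "std_simplex m = {x \<in> space (column_space m). \<forall>i\<in>{1..m}. 0 \<le> coord m x i}"

definition unif_simplex :: "nat \<Rightarrow> (nat \<Rightarrow> real) measure" where
  "unif_simplex m = density (column_space m) (\<lambda>x. ennreal (fact (m - 1)) * indicator (std_simplex m) x)"

lemma measurable_coord[measurable]:
  assumes "i \<in> {1..m}"
  shows "(\<lambda>x. coord m x i) \<in> borel_measurable (column_space m)"
proof (cases "i = m")
  case False
  with assms have "i \<in> {1..<m}" by auto
  then show ?thesis using False unfolding coord_def by simp
qed (simp add: coord_def)

lemma sets_std_simplex[measurable]: "std_simplex m \<in> sets (column_space m)"
proof -
  have "std_simplex m = (\<Inter>i\<in>{1..m}. {x \<in> space (column_space m). 0 \<le> coord m x i}) \<inter> space (column_space m)"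
    by (auto simp: std_simplex_def)
  also have "\<dots> \<in> sets (column_space m)"
  proof (cases "m = 0")
    case False
    then show ?thesis by (intro sets.Int sets.finite_INT) (auto intro!: borel_measurable_le)
  qed auto
  finally show ?thesis .
qed

lemma sets_unif_simplex[measurable_cong, simp]: "sets (unif_simplex m) = sets (column_space m)"
  by (simp add: unif_simplex_def)

lemma space_unif_simplex[simp]: "space (unif_simplex m) = space (column_space m)"
  by (simp add: unif_simplex_def)

lemma sum_coord: "1 \<le> m \<Longrightarrow> (\<Sum>i\<in>{1..m}. coord m x i) = 1"
proof -
  assume "1 \<le> m"
  then have "{1..m} = insert m {1..<m}" by auto
  then have "(\<Sum>i\<in>{1..m}. coord m x i) = coord m x m + (\<Sum>i\<in>{1..<m}. coord m x i)" by simp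
  also have "(\<Sum>i\<in>{1..<m}. coord m x i) = (\<Sum>i\<in>{1..<m}. x i)" by (intro sum.cong) (auto simp: coord_def)
  finally show ?thesis by (simp add: coord_def)
qed

lemma std_simplex_coord_le_1:
  assumes "x \<in> std_simplex m" "i \<in> {1..m}"
  shows "coord m x i \<le> 1"
proof -
  have "coord m x i \<le> (\<Sum>i\<in>{1..m}. coord m x i)"
    using assms by (intro member_le_sum) (auto simp: std_simplex_def)
  moreover have "1 \<le> m" using assms by auto
  ultimately show ?thesis by (simp add: sum_coord)
qed

text \<open>\<open>b\<close> caps the eliminated coordinate, the remainder of s, and sits last
  because it is the base case of \<open>slice\<close>. The list is reversed because the induction
  splits off the largest index, which must be the head.\<close>

lemma nn_integral_box_slice:
  "(\<integral>\<^sup>+x. indicator {0..b} (s - (\<Sum>i\<in>{1..p}. x i)) * (\<Prod>i\<in>{1..p}. indicator {0..y i} (x i))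
      \<partial>Pi\<^sub>M {1..p} (\<lambda>_. lborel)) = slice (map y (rev [1..<Suc p]) @ [b]) s"
proof (induction p arbitrary: s)
  case 0
  interpret product_sigma_finite "\<lambda>_::nat. lborel :: real measure" by standard
  show ?case by (simp add: nn_integral_empty del: nn_integral_const)
next
  case (Suc p)
  interpret product_sigma_finite "\<lambda>_::nat. lborel :: real measure" by standard
  have ins: "{1..Suc p} = insert (Suc p) {1..p}" by auto
  let ?F = "\<lambda>s x. indicator {0..b} (s - (\<Sum>i\<in>{1..p}. x i)) * (\<Prod>i\<in>{1..p}. indicator {0..y i} (x i :: real)) :: ennreal"
  have "(\<integral>\<^sup>+x. indicator {0..b} (s - (\<Sum>i\<in>{1..Suc p}. x i)) * (\<Prod>i\<in>{1..Suc p}. indicator {0..y i} (x i))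
      \<partial>Pi\<^sub>M {1..Suc p} (\<lambda>_. lborel)) =
     (\<integral>\<^sup>+u. \<integral>\<^sup>+x. indicator {0..b} (s - (\<Sum>i\<in>{1..Suc p}. (x(Suc p := u)) i)) *
        (\<Prod>i\<in>{1..Suc p}. indicator {0..y i} ((x(Suc p := u)) i)) \<partial>Pi\<^sub>M {1..p} (\<lambda>_. lborel) \<partial>lborel)"
    unfolding ins by (intro product_nn_integral_insert_rev) auto
  also have "\<dots> = (\<integral>\<^sup>+u. \<integral>\<^sup>+x. indicator {0..y (Suc p)} u * ?F (s - u) x \<partial>Pi\<^sub>M {1..p} (\<lambda>_. lborel) \<partial>lborel)"
  proof (intro nn_integral_cong)
    fix u :: real and x :: "nat \<Rightarrow> real"
    have "(\<Sum>i\<in>{1..Suc p}. (x(Suc p := u)) i) = u + (\<Sum>i\<in>{1..p}. x i)"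
      unfolding ins by (subst sum.insert) (auto intro!: sum.cong)
    moreover have "(\<Prod>i\<in>{1..Suc p}. indicator {0..y i} ((x(Suc p := u)) i)) =
        (indicator {0..y (Suc p)} u * (\<Prod>i\<in>{1..p}. indicator {0..y i} (x i)) :: ennreal)"
      unfolding ins by (subst prod.insert) (auto intro!: prod.cong)
    ultimately show "indicator {0..b} (s - (\<Sum>i\<in>{1..Suc p}. (x(Suc p := u)) i)) *
        (\<Prod>i\<in>{1..Suc p}. indicator {0..y i} ((x(Suc p := u)) i)) = indicator {0..y (Suc p)} u * ?F (s - u) x"
      by (simp only: mult_ac diff_diff_eq)
  qed
  also have "\<dots> = (\<integral>\<^sup>+u. indicator {0..y (Suc p)} u * slice (map y (rev [1..<Suc p]) @ [b]) (s - u) \<partial>lborel)"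
    by (intro nn_integral_cong, subst nn_integral_cmult) (auto simp: Suc.IH)
  also have "\<dots> = slice (map y (rev [1..<Suc (Suc p)]) @ [b]) s"
    by (simp add: slice_Cons mult.commute)
  finally show ?case .
qed

section \<open>Joint and marginal distribution of the coordinates\<close>

lemma emeasure_unif_simplex:
  assumes "A \<in> sets (column_space m)"
  shows "emeasure (unif_simplex m) A = ennreal (fact (m - 1)) * emeasure (column_space m) (std_simplex m \<inter> A)"
  using assms unfolding unif_simplex_def
  by (subst emeasure_density) (auto simp: nn_integral_cmult indicator_inter_arith[symmetric] mult.assoc)

lemma sets_coord_le[measurable]:
  "1 \<le> m \<Longrightarrow> {x \<in> space (column_space m). \<forall>i\<in>{1..m}. coord m x i \<le> y i} \<in> sets (column_space m)"
proof -
  assume m: "1 \<le> m"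
  have "{x \<in> space (column_space m). \<forall>i\<in>{1..m}. coord m x i \<le> y i} =
     (\<Inter>i\<in>{1..m}. {x \<in> space (column_space m). coord m x i \<le> y i})"
    using m by auto
  also have "\<dots> \<in> sets (column_space m)"
    using m by (intro sets.finite_INT) (auto intro!: borel_measurable_le)
  finally show ?thesis .
qed

lemma unif_simplex_coord_le_eq_slice:
  assumes "1 \<le> m"
  shows "emeasure (unif_simplex m) {x \<in> space (column_space m). \<forall>i\<in>{1..m}. coord m x i \<le> y i} =
    ennreal (fact (m - 1)) * slice (map y (rev [1..<m] @ [m])) 1"
proof -
  let ?A = "{x \<in> space (column_space m). \<forall>i\<in>{1..m}. coord m x i \<le> y i}"
  obtain p where p: "m = Suc p" using assms by (cases m) auto
  have I: "{1..<m} = {1..p}" by (auto simp: p)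
  have "emeasure (column_space m) (std_simplex m \<inter> ?A) = (\<integral>\<^sup>+x. indicator (std_simplex m \<inter> ?A) x \<partial>column_space m)"
    using assms by (subst nn_integral_indicator) auto
  also have "\<dots> = (\<integral>\<^sup>+x. indicator {0..y m} (1 - (\<Sum>i\<in>{1..p}. x i)) * (\<Prod>i\<in>{1..p}. indicator {0..y i} (x i)) \<partial>column_space m)"
  proof (intro nn_integral_cong)
    fix x assume x: "x \<in> space (column_space m)"
    have M: "{1..m} = insert m {1..p}" by (auto simp: p)
    have pr: "(\<Prod>i\<in>{1..p}. indicator {0..y i} (x i) :: ennreal) = (if \<forall>i\<in>{1..p}. 0 \<le> x i \<and> x i \<le> y i then 1 else 0)"
      by (auto simp: indicator_def intro!: prod_zero bexI)
    show "(indicator (std_simplex m \<inter> ?A) x :: ennreal) =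
        indicator {0..y m} (1 - (\<Sum>i\<in>{1..p}. x i)) * (\<Prod>i\<in>{1..p}. indicator {0..y i} (x i))"
    proof -
      have c: "coord m x m = 1 - (\<Sum>i\<in>{1..p}. x i)" "\<forall>i\<in>{1..p}. coord m x i = x i"
        by (auto simp: coord_def I) (auto simp: p)
      have P: "(\<forall>i\<in>{1..m}. 0 \<le> coord m x i) \<and> (\<forall>i\<in>{1..m}. coord m x i \<le> y i) \<longleftrightarrow>
          1 - (\<Sum>i\<in>{1..p}. x i) \<in> {0..y m} \<and> (\<forall>i\<in>{1..p}. 0 \<le> x i \<and> x i \<le> y i)"
        unfolding M using c by auto
      show ?thesis unfolding pr using x P by (auto simp: std_simplex_def indicator_def)
    qed
  qed
  also have "\<dots> = slice (map y (rev [1..<Suc p]) @ [y m]) 1"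
    unfolding I by (rule nn_integral_box_slice)
  finally show ?thesis using assms by (subst emeasure_unif_simplex) (auto simp: p)
qed

lemma set_rev_upt: "1 \<le> m \<Longrightarrow> set (rev [1..<m] @ [m]) = {1..m}" "distinct (rev [1..<m] @ [m])"
  by auto

text \<open>The negative dependence: each factor on the right is the marginal probability computed
  in \<open>unif_simplex_coord_single_le\<close>.\<close>

lemma unif_simplex_coord_le_le_prod:
  assumes "2 \<le> m" "\<And>i. i \<in> {1..m} \<Longrightarrow> 0 \<le> y i \<and> y i \<le> 1"
  shows "emeasure (unif_simplex m) {x \<in> space (column_space m). \<forall>i\<in>{1..m}. coord m x i \<le> y i}
    \<le> ennreal (\<Prod>i\<in>{1..m}. 1 - (1 - y i) ^ (m - 1))"
proof -
  let ?L = "rev [1..<m] @ [m]"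
  have "slice (map y ?L @ replicate 0 1) 1 \<le> ennreal ((\<Prod>a\<leftarrow>map y ?L. 1 - (1 - a) ^ (m - 1)) / fact (m - 1))"
  proof (rule slice_le_prod)
    show "\<forall>a\<in>set (map y ?L). 0 \<le> a \<and> a \<le> 1"
      using assms unfolding set_map by (subst set_rev_upt(1)) auto
  qed (use assms in auto)
  also have "(\<Prod>a\<leftarrow>map y ?L. 1 - (1 - a) ^ (m - 1)) = (\<Prod>i\<in>{1..m}. 1 - (1 - y i) ^ (m - 1))"
    using prod.distinct_set_conv_list[OF set_rev_upt(2), of "\<lambda>i. 1 - (1 - y i) ^ (m - 1)" m] assms(1)
    by (subst (asm) set_rev_upt) (auto simp: o_def)
  finally have "ennreal (fact (m - 1)) * slice (map y ?L) 1 \<le>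
      ennreal (fact (m - 1)) * ennreal ((\<Prod>i\<in>{1..m}. 1 - (1 - y i) ^ (m - 1)) / fact (m - 1))"
    by (intro mult_left_mono) auto
  also have "\<dots> = ennreal (\<Prod>i\<in>{1..m}. 1 - (1 - y i) ^ (m - 1))"
    by (subst ennreal_mult'[symmetric]) auto
  finally show ?thesis using assms by (subst unif_simplex_coord_le_eq_slice) auto
qed

lemma emeasure_unif_simplex_space:
  assumes "1 \<le> m"
  shows "emeasure (unif_simplex m) (space (unif_simplex m)) = 1"
proof -
  have "emeasure (unif_simplex m) (space (unif_simplex m)) =
      emeasure (unif_simplex m) {x \<in> space (column_space m). \<forall>i\<in>{1..m}. coord m x i \<le> 1}"
    using assms by (subst (1 2) emeasure_unif_simplex)
      (auto intro!: arg_cong[where f = "\<lambda>A. _ * emeasure _ A"] std_simplex_coord_le_1 simp: std_simplex_def)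
  also have "\<dots> = ennreal (fact (m - 1)) * slice (replicate (Suc (m - 1)) 1) 1"
    using assms by (subst unif_simplex_coord_le_eq_slice) (auto simp: map_replicate_const replicate_append_same simp del: replicate.simps)
  also have "\<dots> = 1"
    by (subst slice_ones) (auto simp: ennreal_mult'[symmetric])
  finally show ?thesis .
qed

lemma finite_measure_unif_simplex: "1 \<le> m \<Longrightarrow> finite_measure (unif_simplex m)"
  by (intro finite_measureI) (auto simp: emeasure_unif_simplex_space[simplified])

lemma AE_unif_simplex: "AE x in unif_simplex m. x \<in> std_simplex m"
  unfolding unif_simplex_def by (subst AE_density) (auto simp: indicator_def)

lemma sets_coord_single[measurable]:
  assumes "i \<in> {1..m}"
  shows "{x \<in> space (column_space m). coord m x i \<le> t} \<in> sets (column_space m)"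
    "{x \<in> space (column_space m). t < coord m x i} \<in> sets (column_space m)"
  using measurable_coord[OF assms] by measurable

lemma unif_simplex_coord_single_le:
  assumes "2 \<le> m" "i \<in> {1..m}" "0 \<le> t" "t \<le> 1"
  shows "emeasure (unif_simplex m) {x \<in> space (column_space m). coord m x i \<le> t} = ennreal (1 - (1 - t) ^ (m - 1))"
proof -
  define y where "y j = (if j = i then t else 1)" for j
  have "emeasure (unif_simplex m) {x \<in> space (column_space m). coord m x i \<le> t} =
     emeasure (unif_simplex m) {x \<in> space (column_space m). \<forall>i\<in>{1..m}. coord m x i \<le> y i}"
    using assms by (subst (1 2) emeasure_unif_simplex)
      (auto intro!: arg_cong[where f = "\<lambda>A. _ * emeasure _ A"] std_simplex_coord_le_1 simp: y_def split: if_splits)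
  also have "\<dots> = ennreal (fact (m - 1)) * slice (map y (rev [1..<m] @ [m])) 1"
    using assms by (intro unif_simplex_coord_le_eq_slice) auto
  also have "slice (map y (rev [1..<m] @ [m])) 1 = ennreal ((1 - (1 - t) ^ (m - 1)) / fact (m - 1))"
  proof -
    obtain us vs where L: "rev [1..<m] @ [m] = us @ i # vs"
      using assms set_rev_upt(1)[of m] split_list[of i "rev [1..<m] @ [m]"] by fastforce
    have "distinct (us @ i # vs)" using set_rev_upt(2)[of m] unfolding L .
    then have "map y us = replicate (length us) 1" "map y vs = replicate (length vs) 1"
      by (auto simp: y_def map_replicate_const[symmetric] intro!: map_cong)
    moreover have "length us + length vs = Suc (m - 2)"
      using arg_cong[OF L, of length] assms by auto
    moreover have "Suc (m - 2) = m - 1" using assms by auto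
    ultimately show ?thesis unfolding L
      using slice_single_cap[of t "length us" "length vs" "m - 2"] assms(3,4) by (simp add: y_def)
  qed
  also have "ennreal (fact (m - 1)) * ennreal ((1 - (1 - t) ^ (m - 1)) / fact (m - 1)) = ennreal (1 - (1 - t) ^ (m - 1))"
    by (subst ennreal_mult'[symmetric]) auto
  finally show ?thesis .
qed

lemma unif_simplex_coord_single_gt:
  assumes "2 \<le> m" "i \<in> {1..m}" "0 \<le> t" "t \<le> 1"
  shows "emeasure (unif_simplex m) {x \<in> space (column_space m). t < coord m x i} = ennreal ((1 - t) ^ (m - 1))"
proof -
  interpret finite_measure "unif_simplex m" using assms by (intro finite_measure_unif_simplex) auto
  let ?A = "{x \<in> space (column_space m). coord m x i \<le> t}"
  have "{x \<in> space (column_space m). t < coord m x i} = space (unif_simplex m) - ?A" by auto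
  also have "emeasure (unif_simplex m) \<dots> = 1 - emeasure (unif_simplex m) ?A"
    using assms by (subst emeasure_compl) (auto simp: emeasure_unif_simplex_space[simplified])
  also have "\<dots> = ennreal 1 - ennreal (1 - (1 - t) ^ (m - 1))"
    using assms by (simp add: unif_simplex_coord_single_le)
  also have "\<dots> = ennreal ((1 - t) ^ (m - 1))"
    using assms by (subst ennreal_minus) (auto intro!: power_le_one)
  finally show ?thesis .
qed

lemma unif_simplex_coord_le_ge:
  assumes "2 \<le> m" "\<And>i. i \<in> {1..m} \<Longrightarrow> 0 \<le> y i \<and> y i \<le> 1"
  shows "ennreal (1 - (\<Sum>i\<in>{1..m}. (1 - y i) ^ (m - 1)))
    \<le> emeasure (unif_simplex m) {x \<in> space (column_space m). \<forall>i\<in>{1..m}. coord m x i \<le> y i}"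
proof -
  interpret finite_measure "unif_simplex m" using assms by (intro finite_measure_unif_simplex) auto
  let ?A = "{x \<in> space (column_space m). \<forall>i\<in>{1..m}. coord m x i \<le> y i}"
  let ?B = "\<Union>i\<in>{1..m}. {x \<in> space (column_space m). y i < coord m x i}"
  have B: "?B \<in> sets (unif_simplex m)" by auto
  have "emeasure (unif_simplex m) ?B \<le> (\<Sum>i\<in>{1..m}. emeasure (unif_simplex m) {x \<in> space (column_space m). y i < coord m x i})"
    by (intro emeasure_subadditive_finite) auto
  also have "\<dots> = (\<Sum>i\<in>{1..m}. ennreal ((1 - y i) ^ (m - 1)))"
    using assms by (intro sum.cong unif_simplex_coord_single_gt) auto
  also have "\<dots> = ennreal (\<Sum>i\<in>{1..m}. (1 - y i) ^ (m - 1))"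
    using assms(2) by (intro sum_ennreal) auto
  finally have *: "emeasure (unif_simplex m) ?B \<le> ennreal (\<Sum>i\<in>{1..m}. (1 - y i) ^ (m - 1))" .
  have "ennreal (1 - (\<Sum>i\<in>{1..m}. (1 - y i) ^ (m - 1))) = 1 - ennreal (\<Sum>i\<in>{1..m}. (1 - y i) ^ (m - 1))"
    using assms(2) by (subst ennreal_minus[symmetric]) (auto intro!: sum_nonneg)
  also have "\<dots> \<le> 1 - emeasure (unif_simplex m) ?B" by (intro ennreal_minus_mono *) simp
  also have "\<dots> = emeasure (unif_simplex m) (space (unif_simplex m) - ?B)"
    using assms B by (subst emeasure_compl) (auto simp: emeasure_unif_simplex_space[simplified])
  also have "space (unif_simplex m) - ?B = ?A" by (auto simp: not_less)
  finally show ?thesis .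
qed

section \<open>Reduction to independent columns\<close>

text \<open>Regroups the entries of a matrix by columns, so that the demand constraints, one per
  column, become constraints on separate factors. A product measure is determined by its values on
  boxes, and those agree.\<close>

lemma PiM_Times_eq_distr:
  assumes "finite I" "finite J"
  shows "Pi\<^sub>M (I \<times> J) (\<lambda>_. lborel :: real measure) =
    distr (Pi\<^sub>M J (\<lambda>_. Pi\<^sub>M I (\<lambda>_. lborel))) (Pi\<^sub>M (I \<times> J) (\<lambda>_. lborel)) (\<lambda>\<omega>. \<lambda>(i, j)\<in>I \<times> J. \<omega> j i)"
    (is "_ = distr ?N ?P ?u")
proof -
  interpret L: product_sigma_finite "\<lambda>_. lborel :: real measure" by standard
  interpret C: product_sigma_finite "\<lambda>_. Pi\<^sub>M I (\<lambda>_. lborel :: real measure)"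
    using L.sigma_finite[OF assms(1)] by (intro product_sigma_finite.intro)
  have meas[measurable]: "?u \<in> measurable ?N ?P"
  proof (rule measurable_restrict)
    fix p assume "p \<in> I \<times> J"
    then obtain i j where p: "p = (i, j)" "i \<in> I" "j \<in> J" by auto
    have "(\<lambda>\<omega>. \<omega> j i) \<in> measurable ?N lborel"
      using p(2,3) by (intro measurable_compose[OF measurable_component_singleton[OF p(3)]]) auto
    then show "(\<lambda>\<omega>. case p of (i, j) \<Rightarrow> \<omega> j i) \<in> measurable ?N lborel" by (simp add: p)
  qed
  have "distr ?N ?P ?u = ?P"
  proof (rule L.PiM_eqI)
    fix A :: "'a \<times> 'b \<Rightarrow> real set" assume A: "\<And>i. i \<in> I \<times> J \<Longrightarrow> A i \<in> sets lborel"
    have "emeasure (distr ?N ?P ?u) (Pi\<^sub>E (I \<times> J) A) = emeasure ?N (?u -` Pi\<^sub>E (I \<times> J) A \<inter> space ?N)"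
      using A assms by (intro emeasure_distr meas sets_PiM_I_finite) auto
    also have "?u -` Pi\<^sub>E (I \<times> J) A \<inter> space ?N = Pi\<^sub>E J (\<lambda>j. Pi\<^sub>E I (\<lambda>i. A (i, j)))"
      by (auto simp: space_PiM PiE_iff extensional_def split: if_splits)
    also have "emeasure ?N \<dots> = (\<Prod>j\<in>J. \<Prod>i\<in>I. emeasure lborel (A (i, j)))"
      using assms A by (subst C.emeasure_PiM) (auto intro!: prod.cong L.emeasure_PiM sets_PiM_I_finite)
    also have "\<dots> = (\<Prod>p\<in>I \<times> J. emeasure lborel (A p))"
      by (subst prod.swap) (simp add: prod.cartesian_product)
    finally show "emeasure (distr ?N ?P ?u) (Pi\<^sub>E (I \<times> J) A) = (\<Prod>p\<in>I \<times> J. emeasure lborel (A p))" .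
  qed (use assms in auto)
  then show ?thesis by simp
qed

text \<open>Again it suffices to compare boxes: there the density and the indicator both factor over
  the indices.\<close>

lemma PiM_density:
  assumes "finite J" "sigma_finite_measure N" "sigma_finite_measure (density N f)"
    and [measurable]: "f \<in> borel_measurable N"
  shows "Pi\<^sub>M J (\<lambda>_. density N f) = density (Pi\<^sub>M J (\<lambda>_. N)) (\<lambda>\<omega>. \<Prod>j\<in>J. f (\<omega> j))"
proof -
  interpret N: product_sigma_finite "\<lambda>_. N" using assms by (intro product_sigma_finite.intro)
  interpret D: product_sigma_finite "\<lambda>_. density N f" using assms by (intro product_sigma_finite.intro)
  have "density (Pi\<^sub>M J (\<lambda>_. N)) (\<lambda>\<omega>. \<Prod>j\<in>J. f (\<omega> j)) = Pi\<^sub>M J (\<lambda>_. density N f)"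
  proof (rule D.PiM_eqI)
    show "sets (density (Pi\<^sub>M J (\<lambda>_. N)) (\<lambda>\<omega>. \<Prod>j\<in>J. f (\<omega> j))) = sets (Pi\<^sub>M J (\<lambda>_. density N f))"
      by (auto intro!: sets_PiM_cong)
    fix A assume A: "\<And>j. j \<in> J \<Longrightarrow> A j \<in> sets (density N f)"
    have "emeasure (density (Pi\<^sub>M J (\<lambda>_. N)) (\<lambda>\<omega>. \<Prod>j\<in>J. f (\<omega> j))) (Pi\<^sub>E J A) =
        (\<integral>\<^sup>+\<omega>. (\<Prod>j\<in>J. f (\<omega> j)) * indicator (Pi\<^sub>E J A) \<omega> \<partial>Pi\<^sub>M J (\<lambda>_. N))"
      using A assms by (intro emeasure_density) (auto intro!: sets_PiM_I_finite)
    also have "\<dots> = (\<integral>\<^sup>+\<omega>. (\<Prod>j\<in>J. f (\<omega> j) * indicator (A j) (\<omega> j)) \<partial>Pi\<^sub>M J (\<lambda>_. N))"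
    proof (intro nn_integral_cong)
      fix \<omega> assume \<omega>: "\<omega> \<in> space (Pi\<^sub>M J (\<lambda>_. N))"
      have "(indicator (Pi\<^sub>E J A) \<omega> :: ennreal) = (\<Prod>j\<in>J. indicator (A j) (\<omega> j))"
      proof (cases "\<forall>j\<in>J. \<omega> j \<in> A j")
        case True
        then show ?thesis using \<omega> by (auto simp: space_PiM PiE_iff)
      next
        case False
        then have "(\<Prod>j\<in>J. indicator (A j) (\<omega> j) :: ennreal) = 0"
          using assms(1) by (auto intro!: prod_zero simp: indicator_def)
        then show ?thesis using False by (auto simp: PiE_iff)
      qed
      then show "(\<Prod>j\<in>J. f (\<omega> j)) * indicator (Pi\<^sub>E J A) \<omega> = (\<Prod>j\<in>J. f (\<omega> j) * indicator (A j) (\<omega> j))"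
        by (simp add: prod.distrib)
    qed
    also have "\<dots> = (\<Prod>j\<in>J. \<integral>\<^sup>+x. f x * indicator (A j) x \<partial>N)"
      using A assms(1) by (intro N.product_nn_integral_prod) auto
    also have "\<dots> = (\<Prod>j\<in>J. emeasure (density N f) (A j))"
      using A by (intro prod.cong) (auto simp: emeasure_density)
    finally show "emeasure (density (Pi\<^sub>M J (\<lambda>_. N)) (\<lambda>\<omega>. \<Prod>j\<in>J. f (\<omega> j))) (Pi\<^sub>E J A) =
        (\<Prod>j\<in>J. emeasure (density N f) (A j))" .
  qed fact
  then show ?thesis by simp
qed

section \<open>Columns as independent uniform points of the simplex\<close>

definition iid_columns :: "nat \<Rightarrow> nat \<Rightarrow> (nat \<Rightarrow> nat \<Rightarrow> real) measure" where
  "iid_columns m n = Pi\<^sub>M {1..n} (\<lambda>_. unif_simplex m)"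

abbreviation caps :: "nat \<Rightarrow> (nat \<Rightarrow> real) measure" where
  "caps m \<equiv> Pi\<^sub>M {1..m} (\<lambda>_. lborel)"

abbreviation raw_columns :: "nat \<Rightarrow> nat \<Rightarrow> (nat \<Rightarrow> nat \<Rightarrow> real) measure" where
  "raw_columns m n \<equiv> Pi\<^sub>M {1..n} (\<lambda>_. column_space m)"

abbreviation uncurry_columns :: "nat \<Rightarrow> nat \<Rightarrow> (nat \<Rightarrow> nat \<Rightarrow> real) \<Rightarrow> (nat \<times> nat \<Rightarrow> real)" where
  "uncurry_columns m n \<omega> \<equiv> (\<lambda>(i, j)\<in>{1..<m} \<times> {1..n}. \<omega> j i)"

lemma sets_columns[measurable_cong, simp]: "sets (iid_columns m n) = sets (raw_columns m n)"
  unfolding iid_columns_def by (auto intro!: sets_PiM_cong)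

lemma space_columns[simp]: "space (iid_columns m n) = space (raw_columns m n)"
  by (simp add: iid_columns_def space_PiM)

lemma sigma_finite_column_space: "sigma_finite_measure (column_space m)"
proof -
  interpret L: product_sigma_finite "\<lambda>_. lborel :: real measure" by standard
  show ?thesis by (rule L.sigma_finite) simp
qed

lemma sigma_finite_caps: "sigma_finite_measure (caps m)"
proof -
  interpret L: product_sigma_finite "\<lambda>_. lborel :: real measure" by standard
  show ?thesis by (rule L.sigma_finite) simp
qed

lemma product_sigma_finite_unif_simplex: "1 \<le> m \<Longrightarrow> product_sigma_finite (\<lambda>_. unif_simplex m)"
  using finite_measure_unif_simplex finite_measure.axioms(1) by (intro product_sigma_finite.intro) blast

lemma columns_eq_density:
  assumes "1 \<le> m"
  shows "iid_columns m n = density (raw_columns m n)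
    (\<lambda>\<omega>. \<Prod>j\<in>{1..n}. ennreal (fact (m - 1)) * indicator (std_simplex m) (\<omega> j))"
  using assms finite_measure_unif_simplex[of m] unfolding iid_columns_def unif_simplex_def
  by (intro PiM_density sigma_finite_column_space finite_measure.axioms(1)) auto

lemma AE_columns:
  assumes "1 \<le> m"
  shows "AE \<omega> in iid_columns m n. \<forall>j\<in>{1..n}. \<omega> j \<in> std_simplex m"
  unfolding columns_eq_density[OF assms]
  by (subst AE_density) (auto intro!: AE_I2 simp: indicator_def zero_less_iff_neq_zero split: if_splits)

lemma emeasure_columns_PiE:
  assumes "1 \<le> m" "\<And>j. j \<in> {1..n} \<Longrightarrow> A j \<in> sets (column_space m)"
  shows "emeasure (iid_columns m n) (Pi\<^sub>E {1..n} A) = (\<Prod>j\<in>{1..n}. emeasure (unif_simplex m) (A j))"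
proof -
  interpret product_sigma_finite "\<lambda>_. unif_simplex m"
    by (rule product_sigma_finite_unif_simplex) fact
  show ?thesis using assms unfolding iid_columns_def by (intro emeasure_PiM) auto
qed

lemma emeasure_columns_space:
  assumes "1 \<le> m"
  shows "emeasure (iid_columns m n) (space (iid_columns m n)) = 1"
  using emeasure_columns_PiE[of m n "\<lambda>_. space (column_space m)"] assms
    emeasure_unif_simplex_space[OF assms]
  by (simp add: space_PiM[of "{1..n}"])

lemma finite_measure_columns: "1 \<le> m \<Longrightarrow> finite_measure (iid_columns m n)"
  by (intro finite_measureI) (simp add: emeasure_columns_space del: space_columns)

text \<open>The nonnegativity constraints move from the set into the measure: on the right they are
  carried by the simplex indicators in the density of the columns, and each column contributes the
  normalizing factor (m-1)!.\<close>

lemma emeasure_reduce_to_columns: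
  assumes m: "1 \<le> m"
    and S: "S \<in> sets (Pi\<^sub>M ({1..<m} \<times> {1..n}) (\<lambda>_. lborel) \<Otimes>\<^sub>M caps m)"
    and B: "B \<in> sets (iid_columns m n \<Otimes>\<^sub>M caps m)"
    and SB: "\<And>\<omega> y. \<omega> \<in> space (raw_columns m n) \<Longrightarrow> y \<in> space (caps m) \<Longrightarrow>
      (uncurry_columns m n \<omega>, y) \<in> S \<longleftrightarrow> (\<forall>j\<in>{1..n}. \<omega> j \<in> std_simplex m) \<and> (\<omega>, y) \<in> B"
  shows "ennreal (fact (m - 1)) ^ n *
      emeasure (Pi\<^sub>M ({1..<m} \<times> {1..n}) (\<lambda>_. lborel) \<Otimes>\<^sub>M caps m) S = emeasure (iid_columns m n \<Otimes>\<^sub>M caps m) B"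
proof -
  interpret Y: sigma_finite_measure "caps m" by (rule sigma_finite_caps)
  let ?X = "Pi\<^sub>M ({1..<m} \<times> {1..n}) (\<lambda>_. lborel :: real measure)"
  let ?u = "uncurry_columns m n" and ?c = "ennreal (fact (m - 1))"
  have u[measurable]: "?u \<in> measurable (raw_columns m n) ?X"
  proof (rule measurable_restrict)
    fix p assume "p \<in> {1..<m} \<times> {1..n}"
    then obtain i j where p: "p = (i, j)" "i \<in> {1..<m}" "j \<in> {1..n}" by auto
    have "(\<lambda>\<omega>. \<omega> j i) \<in> measurable (raw_columns m n) lborel"
      by (intro measurable_compose[OF measurable_component_singleton[OF p(3)]] measurable_component_singleton[OF p(2)])
    then show "(\<lambda>\<omega>. case p of (i, j) \<Rightarrow> \<omega> j i) \<in> measurable (raw_columns m n) lborel" by (simp add: p)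
  qed
  have B': "B \<in> sets (raw_columns m n \<Otimes>\<^sub>M caps m)"
    using B sets_pair_measure_cong[OF sets_columns refl] by blast
  have [measurable]: "(\<lambda>x. emeasure (caps m) (Pair x -` S)) \<in> borel_measurable ?X"
    "(\<lambda>x. emeasure (caps m) (Pair x -` B)) \<in> borel_measurable (raw_columns m n)"
    using Y.measurable_emeasure_Pair[OF S] Y.measurable_emeasure_Pair[OF B'] by auto
  have "?c ^ n * emeasure (?X \<Otimes>\<^sub>M caps m) S = ?c ^ n * (\<integral>\<^sup>+x. emeasure (caps m) (Pair x -` S) \<partial>?X)"
    using Y.emeasure_pair_measure_alt[OF S] by simp
  also have "\<dots> = ?c ^ n * (\<integral>\<^sup>+\<omega>. emeasure (caps m) (Pair (?u \<omega>) -` S) \<partial>raw_columns m n)"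
    using arg_cong[OF PiM_Times_eq_distr[of "{1..<m}" "{1..n}"],
        of "\<lambda>M. nn_integral M (\<lambda>x. emeasure (caps m) (Pair x -` S))"]
    by (simp only: finite_atLeastLessThan finite_atLeastAtMost simp_thms) (subst nn_integral_distr, auto)
  also have "\<dots> = (\<integral>\<^sup>+\<omega>. ?c ^ n * emeasure (caps m) (Pair (?u \<omega>) -` S) \<partial>raw_columns m n)"
    by (intro nn_integral_cmult[symmetric]) auto
  also have "\<dots> = (\<integral>\<^sup>+\<omega>. (\<Prod>j\<in>{1..n}. ?c * indicator (std_simplex m) (\<omega> j)) *
      emeasure (caps m) (Pair \<omega> -` B) \<partial>raw_columns m n)"
  proof (intro nn_integral_cong)
    fix \<omega> assume \<omega>: "\<omega> \<in> space (raw_columns m n)"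
    show "?c ^ n * emeasure (caps m) (Pair (?u \<omega>) -` S) =
      (\<Prod>j\<in>{1..n}. ?c * indicator (std_simplex m) (\<omega> j)) * emeasure (caps m) (Pair \<omega> -` B)"
    proof (cases "\<forall>j\<in>{1..n}. \<omega> j \<in> std_simplex m")
      case True
      have "Pair (?u \<omega>) -` S = Pair \<omega> -` B"
        using SB[OF \<omega>] True sets.sets_into_space[OF S] sets.sets_into_space[OF B]
        by (fastforce simp: space_pair_measure)
      then show ?thesis using True by simp
    next
      case False
      have "Pair (?u \<omega>) -` S = {}"
        using SB[OF \<omega>] False sets.sets_into_space[OF S] by (fastforce simp: space_pair_measure)
      moreover have "(\<Prod>j\<in>{1..n}. ?c * indicator (std_simplex m) (\<omega> j)) = 0"
        using False by (auto intro!: prod_zero simp: indicator_def)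
      ultimately show ?thesis by simp
    qed
  qed
  also have "\<dots> = (\<integral>\<^sup>+\<omega>. emeasure (caps m) (Pair \<omega> -` B) \<partial>iid_columns m n)"
    unfolding columns_eq_density[OF m] by (subst nn_integral_density) auto
  also have "\<dots> = emeasure (iid_columns m n \<Otimes>\<^sub>M caps m) B"
    using Y.emeasure_pair_measure_alt[OF B] by simp
  finally show ?thesis .
qed

definition complete_point :: "nat \<Rightarrow> nat \<Rightarrow> (nat \<times> nat \<Rightarrow> real) \<Rightarrow> (nat \<times> nat \<Rightarrow> real)" where
  "complete_point m n x = (\<lambda>(i, j)\<in>{1..m} \<times> {1..n}. coord m (\<lambda>l. x (l, j)) i)"

text \<open>Describes a projection, whose measurability is not evident, as a preimage under the
  completion map, where measurability can be read off from the constraints.\<close>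

lemma drop_last_image:
  assumes "1 \<le> m" "K \<subseteq> ambient m n"
  shows "drop_last m n ` (K \<inter> demand m n) =
    {(x, y) \<in> space (Pi\<^sub>M ({1..<m} \<times> {1..n}) (\<lambda>_. lborel) \<Otimes>\<^sub>M caps m). (complete_point m n x, y) \<in> K}"
    (is "?L = ?R")
proof
  have M: "{1..m} = insert m {1..<m}" using assms by auto
  show "?L \<subseteq> ?R"
  proof
    fix w assume "w \<in> ?L"
    then obtain x y where xy: "(x, y) \<in> K" "(x, y) \<in> demand m n" "w = drop_last m n (x, y)" by auto
    have amb: "(x, y) \<in> ambient m n" using xy assms by auto
    let ?x = "restrict x ({1..<m} \<times> {1..n})"
    have "complete_point m n ?x = x"
    proof
      fix p show "complete_point m n ?x p = x p"
      proof (cases "p \<in> {1..m} \<times> {1..n}")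
        case False
        then have "complete_point m n ?x p = undefined"
          unfolding complete_point_def by (simp only: restrict_apply if_False)
        moreover have "x \<in> extensional ({1..m} \<times> {1..n})" using amb by (auto simp: ambient_def PiE_iff)
        ultimately show ?thesis using extensional_arb[of x] False by metis
      next
        case True
        then obtain i j where p: "p = (i, j)" "i \<in> {1..m}" "j \<in> {1..n}" by auto
        have "x (m, j) + (\<Sum>l\<in>{1..<m}. x (l, j)) = 1"
          using xy(2) p(3) unfolding demand_def M by auto
        then show ?thesis using p by (auto simp: complete_point_def coord_def)
      qed
    qed
    moreover have "y \<in> space (caps m)" using amb by (simp add: ambient_def space_PiM)
    ultimately show "w \<in> ?R" using xy(1,3)
      by (simp add: drop_last_def space_pair_measure space_PiM[of "{1..<m} \<times> {1..n}"])
  qed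
  show "?R \<subseteq> ?L"
  proof
    fix w assume "w \<in> ?R"
    then obtain x y where xy: "w = (x, y)" "x \<in> extensional ({1..<m} \<times> {1..n})" "(complete_point m n x, y) \<in> K"
      by (auto simp: space_pair_measure space_PiM PiE_iff)
    have amb: "(complete_point m n x, y) \<in> ambient m n" using xy assms by auto
    have "(\<Sum>i\<in>{1..m}. complete_point m n x (i, j)) = 1" if "j \<in> {1..n}" for j
      using sum_coord[OF assms(1), of "\<lambda>l. x (l, j)"] that by (simp add: complete_point_def)
    then have "(complete_point m n x, y) \<in> demand m n"
      using amb by (auto simp: demand_def)
    moreover have "drop_last m n (complete_point m n x, y) = w"
    proof -
      have "restrict (complete_point m n x) ({1..<m} \<times> {1..n}) = x"
        using xy(2) by (intro extensionalityI[OF restrict_extensional]) (auto simp: complete_point_def coord_def)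
      then show ?thesis by (simp add: drop_last_def xy(1))
    qed
    ultimately show "w \<in> ?L" using xy(3) by (metis IntI imageI)
  qed
qed

section \<open>Measurability, and the two events in column form\<close>

lemma measurable_coord':
  assumes "i \<in> {1..m}" "\<And>l. l \<in> {1..<m} \<Longrightarrow> (\<lambda>w. f w l) \<in> borel_measurable M"
  shows "(\<lambda>w. coord m (f w) i) \<in> borel_measurable M"
proof (cases "i = m")
  case False
  with assms show ?thesis by (auto simp: coord_def)
next
  case True
  then show ?thesis using assms(2) by (simp add: coord_def)
qed

lemma measurable_coord_columns[measurable]:
  assumes "i \<in> {1..m}" "j \<in> {1..n}"
  shows "(\<lambda>\<omega>. coord m (\<omega> j) i) \<in> borel_measurable (iid_columns m n)"
  using assms by (intro measurable_compose[OF _ measurable_coord[OF assms(1)]])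
    (auto simp: measurable_component_singleton)

lemma complete_point_uncurry:
  assumes "i \<in> {1..m}" "j \<in> {1..n}"
  shows "complete_point m n (uncurry_columns m n \<omega>) (i, j) = coord m (\<omega> j) i"
  using assms by (auto simp: complete_point_def coord_def)

lemma measurable_complete_point[measurable]:
  assumes "i \<in> {1..m}" "j \<in> {1..n}"
  shows "(\<lambda>x. complete_point m n x (i, j)) \<in> borel_measurable (Pi\<^sub>M ({1..<m} \<times> {1..n}) (\<lambda>_. lborel))"
  using assms by (auto simp: complete_point_def intro!: measurable_coord')

lemma pred_le_real:
  fixes f g :: "'a \<Rightarrow> real"
  shows "f \<in> borel_measurable M \<Longrightarrow> g \<in> borel_measurable M \<Longrightarrow> Measurable.pred M (\<lambda>w. f w \<le> g w)"
  unfolding pred_def by (rule borel_measurable_le)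

lemma measurable_snd_component:
  "i \<in> {1..m} \<Longrightarrow> (\<lambda>w. snd w i) \<in> borel_measurable (M \<Otimes>\<^sub>M caps m)"
  by (intro measurable_compose[OF measurable_snd]) auto

lemmas pred_box_intros = pred_intros_logic(3) pred_intros_finite(3) pred_le_real measurable_snd_component
  borel_measurable_const borel_measurable_times borel_measurable_sum
  measurable_compose[OF measurable_fst measurable_complete_point]
  measurable_compose[OF measurable_fst measurable_coord_columns]

text \<open>Nonnegativity of the entries is absent because the column measure is concentrated on the
  simplex.\<close>

definition strong_set :: "nat \<Rightarrow> nat \<Rightarrow> ((nat \<Rightarrow> nat \<Rightarrow> real) \<times> (nat \<Rightarrow> real)) set" where
  "strong_set m n = {(\<omega>, y) \<in> space (iid_columns m n \<Otimes>\<^sub>M caps m).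
     (\<forall>i\<in>{1..m}. \<forall>j\<in>{1..n}. coord m (\<omega> j) i \<le> y i) \<and> (\<forall>i\<in>{1..m}. y i \<le> 1)}"

text \<open>As before without nonnegativity, and also without the bound 1 on the entries, which
  holds on the simplex.\<close>

definition weak_set :: "nat \<Rightarrow> nat \<Rightarrow> ((nat \<Rightarrow> nat \<Rightarrow> real) \<times> (nat \<Rightarrow> real)) set" where
  "weak_set m n = {(\<omega>, y) \<in> space (iid_columns m n \<Otimes>\<^sub>M caps m).
     (\<forall>i\<in>{1..m}. (\<Sum>j\<in>{1..n}. coord m (\<omega> j) i) \<le> real n * y i) \<and> (\<forall>i\<in>{1..m}. y i \<le> 1)}"

lemma sets_strong_set[measurable]: "strong_set m n \<in> sets (iid_columns m n \<Otimes>\<^sub>M caps m)"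
  unfolding strong_set_def case_prod_unfold prod.collapse pred_def[symmetric] by (intro pred_box_intros) auto

lemma sets_weak_set[measurable]: "weak_set m n \<in> sets (iid_columns m n \<Otimes>\<^sub>M caps m)"
  unfolding weak_set_def case_prod_unfold prod.collapse pred_def[symmetric] by (intro pred_box_intros) auto

lemma Vol_eq_columns:
  assumes m: "1 \<le> m" and K: "K \<subseteq> ambient m n"
    and S: "{(x, y) \<in> space (Pi\<^sub>M ({1..<m} \<times> {1..n}) (\<lambda>_. lborel) \<Otimes>\<^sub>M caps m). (complete_point m n x, y) \<in> K}
      \<in> sets (Pi\<^sub>M ({1..<m} \<times> {1..n}) (\<lambda>_. lborel) \<Otimes>\<^sub>M caps m)"
    and B: "B \<in> sets (iid_columns m n \<Otimes>\<^sub>M caps m)"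
    and SB: "\<And>\<omega> y. \<omega> \<in> space (raw_columns m n) \<Longrightarrow> y \<in> space (caps m) \<Longrightarrow>
      (complete_point m n (uncurry_columns m n \<omega>), y) \<in> K \<longleftrightarrow>
      (\<forall>j\<in>{1..n}. \<omega> j \<in> std_simplex m) \<and> (\<omega>, y) \<in> B"
  shows "fact (m - 1) ^ n * Vol m n (K \<inter> demand m n) = measure (iid_columns m n \<Otimes>\<^sub>M caps m) B"
proof -
  let ?S = "{(x, y) \<in> space (Pi\<^sub>M ({1..<m} \<times> {1..n}) (\<lambda>_. lborel) \<Otimes>\<^sub>M caps m). (complete_point m n x, y) \<in> K}"
  let ?M = "Pi\<^sub>M ({1..<m} \<times> {1..n}) (\<lambda>_. lborel) \<Otimes>\<^sub>M caps m"
  have "ennreal (fact (m - 1)) ^ n * emeasure ?M ?S = emeasure (iid_columns m n \<Otimes>\<^sub>M caps m) B"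
  proof (rule emeasure_reduce_to_columns[OF m S B])
    fix \<omega> y assume \<omega>: "\<omega> \<in> space (raw_columns m n)" and y: "y \<in> space (caps m)"
    have "(uncurry_columns m n \<omega>, y) \<in> space ?M"
      using y by (auto simp: space_pair_measure space_PiM)
    then show "(uncurry_columns m n \<omega>, y) \<in> ?S \<longleftrightarrow> (\<forall>j\<in>{1..n}. \<omega> j \<in> std_simplex m) \<and> (\<omega>, y) \<in> B"
      using SB[OF \<omega> y] by simp
  qed
  then have "fact (m - 1) ^ n * measure ?M ?S = measure (iid_columns m n \<Otimes>\<^sub>M caps m) B"
    unfolding measure_def by (simp add: enn2real_mult ennreal_power flip: \<open>_ = emeasure (iid_columns m n \<Otimes>\<^sub>M caps m) B\<close>)
  \<comment> \<open>The projected set is measurable before completion, so the completed measure in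
    \<open>Vol\<close> gives it the same value.\<close>
  then show ?thesis using S
    unfolding Vol_def reduced_lebesgue_def drop_last_image[OF m K] by simp
qed

lemma complete_point_in_ambient:
  "y \<in> space (caps m) \<Longrightarrow> (complete_point m n x, y) \<in> ambient m n"
  by (auto simp: ambient_def complete_point_def space_PiM)

lemma mem_std_simplex_columns:
  assumes "\<omega> \<in> space (raw_columns m n)" "j \<in> {1..n}"
  shows "\<omega> j \<in> std_simplex m \<longleftrightarrow> (\<forall>i\<in>{1..m}. 0 \<le> coord m (\<omega> j) i)"
proof -
  have "\<omega> j \<in> space (column_space m)" using assms unfolding space_PiM[of "{1..n}"] by (rule PiE_mem)
  then show ?thesis by (simp add: std_simplex_def)
qed

lemma V_P_eq_measure:
  assumes "1 \<le> m"
  shows "fact (m - 1) ^ n * V_P m n = measure (iid_columns m n \<Otimes>\<^sub>M caps m) (strong_set m n)"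
  unfolding V_P_def
proof (rule Vol_eq_columns[OF assms])
  let ?M = "Pi\<^sub>M ({1..<m} \<times> {1..n}) (\<lambda>_. lborel) \<Otimes>\<^sub>M caps m"
  have "{(x, y) \<in> space ?M. (complete_point m n x, y) \<in> strong_relaxation m n} =
     {w \<in> space ?M. (\<forall>i\<in>{1..m}. \<forall>j\<in>{1..n}. 0 \<le> complete_point m n (fst w) (i, j) \<and>
         complete_point m n (fst w) (i, j) \<le> snd w i) \<and> (\<forall>i\<in>{1..m}. snd w i \<le> 1)}"
    by (intro Collect_cong) (clarsimp simp: space_pair_measure strong_relaxation_def
      intro!: conj_cong[OF refl] simp: complete_point_in_ambient)
  also have "\<dots> \<in> sets ?M" unfolding pred_def[symmetric] by (intro pred_box_intros) auto
  finally show "{(x, y) \<in> space ?M. (complete_point m n x, y) \<in> strong_relaxation m n} \<in> sets ?M" .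
  fix \<omega> y assume \<omega>: "\<omega> \<in> space (raw_columns m n)" "y \<in> space (caps m)"
  have "(complete_point m n (uncurry_columns m n \<omega>), y) \<in> strong_relaxation m n \<longleftrightarrow>
      (\<forall>i\<in>{1..m}. \<forall>j\<in>{1..n}. 0 \<le> coord m (\<omega> j) i \<and> coord m (\<omega> j) i \<le> y i) \<and> (\<forall>i\<in>{1..m}. y i \<le> 1)"
    using complete_point_uncurry[of _ m _ n \<omega>] complete_point_in_ambient[OF \<omega>(2)]
    by (simp add: strong_relaxation_def)
  then show "(complete_point m n (uncurry_columns m n \<omega>), y) \<in> strong_relaxation m n \<longleftrightarrow>
      (\<forall>j\<in>{1..n}. \<omega> j \<in> std_simplex m) \<and> (\<omega>, y) \<in> strong_set m n"
    using \<omega> mem_std_simplex_columns[OF \<omega>(1)] by (auto simp: strong_set_def space_pair_measure)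
next
  show "strong_relaxation m n \<subseteq> ambient m n" by (auto simp: strong_relaxation_def)
qed (rule sets_strong_set)

lemma V_Q_eq_measure:
  assumes "1 \<le> m"
  shows "fact (m - 1) ^ n * V_Q m n = measure (iid_columns m n \<Otimes>\<^sub>M caps m) (weak_set m n)"
  unfolding V_Q_def
proof (rule Vol_eq_columns[OF assms])
  let ?M = "Pi\<^sub>M ({1..<m} \<times> {1..n}) (\<lambda>_. lborel) \<Otimes>\<^sub>M caps m"
  have "{(x, y) \<in> space ?M. (complete_point m n x, y) \<in> weak_relaxation m n} =
     {w \<in> space ?M. (\<forall>i\<in>{1..m}. (\<Sum>j\<in>{1..n}. complete_point m n (fst w) (i, j)) \<le> real n * snd w i) \<and>
       (\<forall>i\<in>{1..m}. \<forall>j\<in>{1..n}. 0 \<le> complete_point m n (fst w) (i, j) \<and>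
         complete_point m n (fst w) (i, j) \<le> 1) \<and> (\<forall>i\<in>{1..m}. snd w i \<le> 1)}"
    by (intro Collect_cong) (clarsimp simp: space_pair_measure weak_relaxation_def
      intro!: conj_cong[OF refl] simp: complete_point_in_ambient)
  also have "\<dots> \<in> sets ?M" unfolding pred_def[symmetric] by (intro pred_box_intros) auto
  finally show "{(x, y) \<in> space ?M. (complete_point m n x, y) \<in> weak_relaxation m n} \<in> sets ?M" .
  fix \<omega> y assume \<omega>: "\<omega> \<in> space (raw_columns m n)" "y \<in> space (caps m)"
  have "(complete_point m n (uncurry_columns m n \<omega>), y) \<in> weak_relaxation m n \<longleftrightarrow>
      (\<forall>i\<in>{1..m}. (\<Sum>j\<in>{1..n}. coord m (\<omega> j) i) \<le> real n * y i) \<and>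
      (\<forall>i\<in>{1..m}. \<forall>j\<in>{1..n}. 0 \<le> coord m (\<omega> j) i \<and> coord m (\<omega> j) i \<le> 1) \<and> (\<forall>i\<in>{1..m}. y i \<le> 1)"
    using complete_point_uncurry[of _ m _ n \<omega>] complete_point_in_ambient[OF \<omega>(2)]
    by (simp add: weak_relaxation_def)
  then show "(complete_point m n (uncurry_columns m n \<omega>), y) \<in> weak_relaxation m n \<longleftrightarrow>
      (\<forall>j\<in>{1..n}. \<omega> j \<in> std_simplex m) \<and> (\<omega>, y) \<in> weak_set m n"
    using \<omega> mem_std_simplex_columns[OF \<omega>(1)] std_simplex_coord_le_1
    by (auto simp: weak_set_def space_pair_measure)
next
  show "weak_relaxation m n \<subseteq> ambient m n" by (auto simp: weak_relaxation_def)
qed (rule sets_weak_set)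

section \<open>The function psi\<close>

lemma psi_0[simp]: "psi 0 m = 1"
  by (simp add: psi_def)

lemma psi_integrable:
  "(\<lambda>t. (1 - t ^ (m - 1)) ^ n) integrable_on {0..1::real}"
  by (intro integrable_continuous_interval continuous_intros)

text \<open>The function t (1 - t^q)^(n+1) vanishes at 0 and 1, so its derivative has integral 0.
  Writing t^q as 1 - (1 - t^q) in that derivative leaves a combination of the integrands for n + 1
  and n.\<close>

lemma psi_Suc_mult:
  assumes "2 \<le> m"
  shows "psi (Suc n) m * (1 + real (Suc n) * (real m - 1)) = psi n m * (real (Suc n) * (real m - 1))"
proof -
  define q where "q = m - 1"
  have q: "1 \<le> q" "real m - 1 = real q" using assms by (auto simp: q_def)
  let ?f = "\<lambda>n t. (1 - t ^ q) ^ n :: real" and ?a = "real (Suc n) * real q"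
  have "((\<lambda>t. (1 + ?a) * ?f (Suc n) t - ?a * ?f n t) has_integral
      1 * ?f (Suc n) 1 - 0 * ?f (Suc n) 0) {0..1}"
  proof (rule fundamental_theorem_of_calculus)
    fix t :: real
    have tq: "t * t ^ (q - 1) = t ^ q" using q by (cases q) auto
    have "?f (Suc n) t + t * (real (Suc n) * ?f n t * - (real q * t ^ (q - 1))) =
        ?f (Suc n) t - ?a * ?f n t * (t * t ^ (q - 1))"
      by (simp only: mult_minus_right mult_ac diff_conv_add_uminus)
    also have "\<dots> = (1 + ?a) * ?f (Suc n) t - ?a * ?f n t"
      unfolding tq by (simp add: algebra_simps)
    finally have "?f (Suc n) t + t * (real (Suc n) * ?f n t * - (real q * t ^ (q - 1)))
        = (1 + ?a) * ?f (Suc n) t - ?a * ?f n t" .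
    moreover have "((\<lambda>t. t * ?f (Suc n) t) has_real_derivative
        (?f (Suc n) t + t * (real (Suc n) * ?f n t * - (real q * t ^ (q - 1))))) (at t within {0..1})"
      by (auto intro!: derivative_eq_intros simp: One_nat_def simp del: power_Suc)
    ultimately show "((\<lambda>t. t * ?f (Suc n) t) has_vector_derivative
        (1 + ?a) * ?f (Suc n) t - ?a * ?f n t) (at t within {0..1})"
      by (simp add: has_real_derivative_iff_has_vector_derivative)
  qed simp
  moreover have "((\<lambda>t. (1 + ?a) * ?f (Suc n) t - ?a * ?f n t) has_integral
      (1 + ?a) * psi (Suc n) m - ?a * psi n m) {0..1}"
    unfolding psi_def q_def
    by (intro has_integral_diff has_integral_mult_right integrable_integral psi_integrable)
  ultimately have "(1 + ?a) * psi (Suc n) m - ?a * psi n m = 0"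
    using q by (auto dest: has_integral_unique)
  then show ?thesis by (simp add: q mult.commute)
qed

lemma psi_Suc:
  assumes "2 \<le> m"
  shows "psi (Suc n) m = psi n m / (1 + 1 / ((real m - 1) * real (Suc n)))"
proof -
  define a where "a = (real m - 1) * real (Suc n)"
  have a: "0 < a" using assms by (simp add: a_def)
  have "psi (Suc n) m * (1 + a) = psi n m * a"
    using psi_Suc_mult[OF assms, of n] by (simp only: a_def mult.commute)
  then have "psi (Suc n) m = psi n m / (1 + 1 / a)" using a by (simp add: divide_simps add.commute)
  then show ?thesis by (simp add: a_def)
qed

lemma psi_eq_prod:
  assumes "2 \<le> m"
  shows "psi n m = (\<Prod>j\<in>{1..n}. inverse (1 + 1 / ((real m - 1) * real j)))"
proof (induction n)
  case (Suc n)
  have "{1..Suc n} = insert (Suc n) {1..n}" by auto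
  then show ?case unfolding psi_Suc[OF assms] Suc.IH by (simp add: divide_inverse mult.commute)
qed simp

lemma psi_pos: "2 \<le> m \<Longrightarrow> 0 < psi n m"
  unfolding psi_eq_prod by (intro prod_pos) (auto intro!: add_pos_nonneg)

lemma psi_Gamma:
  assumes "2 \<le> m"
  shows "psi n m = Gamma (1 + 1 / (real m - 1)) * Gamma (real n + 1) / Gamma (real n + 1 + 1 / (real m - 1))"
proof -
  define k where "k = 1 / (real m - 1)"
  have k: "0 < k" using assms by (simp add: k_def)
  have "psi n m = Gamma (1 + k) * Gamma (real n + 1) / Gamma (real n + 1 + k)"
  proof (induction n)
    case 0
    have "Gamma (1 + k) > 0" using k by (intro Gamma_real_pos) auto
    then show ?case by simp
  next
    case (Suc n)
    have "Gamma (real (Suc n) + 1) = real (Suc n) * Gamma (real n + 1)"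
      using Gamma_plus1[of "real n + 1"] nonpos_Ints_nonpos[of "real n + 1"] by (auto simp: add_ac)
    moreover have "Gamma (real (Suc n) + 1 + k) = (real (Suc n) + k) * Gamma (real n + 1 + k)"
      using Gamma_plus1[of "real n + 1 + k"] nonpos_Ints_nonpos[of "real n + 1 + k"] k by (auto simp: add_ac)
    moreover have "psi (Suc n) m = psi n m * (real (Suc n) / (real (Suc n) + k))"
      using assms k unfolding psi_Suc[OF assms] by (simp add: k_def divide_simps) (simp add: algebra_simps)
    ultimately show ?case by (simp add: Suc.IH mult_ac)
  qed
  then show ?thesis by (simp add: k_def)
qed

lemma nn_integral_psi:
  "(\<integral>\<^sup>+y\<in>{0..1}. ennreal ((1 - (1 - y) ^ (m - 1)) ^ n) \<partial>lborel) = ennreal (psi n m)"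
proof -
  have "(\<integral>\<^sup>+y\<in>{0..1}. ennreal ((1 - (1 - y) ^ (m - 1)) ^ n) \<partial>lborel) =
      (\<integral>\<^sup>+t. ennreal (indicator {0..1} t * (1 - t ^ (m - 1)) ^ n) \<partial>lborel)"
    by (subst nn_integral_real_affine[where c = "-1" and t = 1])
      (auto simp: indicator_def intro!: nn_integral_cong)
  \<comment> \<open>The absolute value changes nothing on [0, 1] and makes the function nonnegative
    on the whole line, where 1 - t^(m-1) can be negative.\<close>
  also have "\<dots> = (\<integral>\<^sup>+t. ennreal (indicator {0..1} t * \<bar>1 - t ^ (m - 1)\<bar> ^ n) \<partial>lborel)"
    by (intro nn_integral_cong) (auto simp: indicator_def power_le_one)
  also have "\<dots> = ennreal (psi n m)"
  proof (rule nn_integral_has_integral_lebesgue)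
    have "((\<lambda>t. (1 - t ^ (m - 1)) ^ n) has_integral psi n m) {0..1}"
      unfolding psi_def by (intro integrable_integral psi_integrable)
    then show "((\<lambda>t. \<bar>1 - t ^ (m - 1)\<bar> ^ n) has_integral psi n m) {0..1}"
      by (rule has_integral_eq[rotated]) (auto simp: power_le_one)
  qed auto
  finally show ?thesis .
qed

text \<open>With T = (1-y)^(m-1), the identity T (1-T)^n = (1-T)^n - (1-T)^(n+1). These are the
  one-dimensional integrals that arise from the second-order terms of the union bound.\<close>

lemma nn_integral_psi_diff:
  assumes "2 \<le> m"
  shows "(\<integral>\<^sup>+y\<in>{0..1}. ennreal ((1 - y) ^ (m - 1) * (1 - (1 - y) ^ (m - 1)) ^ n) \<partial>lborel) =
    ennreal (psi n m - psi (Suc n) m)"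
proof -
  let ?g = "\<lambda>y. 1 - (1 - y) ^ (m - 1) :: real"
  have "(\<integral>\<^sup>+y\<in>{0..1}. ennreal ((1 - y) ^ (m - 1) * (1 - (1 - y) ^ (m - 1)) ^ n) \<partial>lborel) + ennreal (psi (Suc n) m) =
     (\<integral>\<^sup>+y. ennreal ((1 - y) ^ (m - 1) * (1 - (1 - y) ^ (m - 1)) ^ n) * indicator {0..1} y +
       ennreal ((1 - (1 - y) ^ (m - 1)) ^ Suc n) * indicator {0..1} y \<partial>lborel)"
    by (subst nn_integral_add) (simp_all add: nn_integral_psi del: power_Suc)
  also have "\<dots> = (\<integral>\<^sup>+y\<in>{0..1}. ennreal ((1 - (1 - y) ^ (m - 1)) ^ n) \<partial>lborel)"
  proof (intro nn_integral_cong)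
    fix y :: real
    show "ennreal ((1 - y) ^ (m - 1) * ?g y ^ n) * indicator {0..1} y +
        ennreal (?g y ^ Suc n) * indicator {0..1} y = ennreal (?g y ^ n) * indicator {0..1} y"
    proof (cases "y \<in> {0..1}")
      case True
      then have "0 \<le> ?g y" by (auto simp: power_le_one)
      then have "ennreal ((1 - y) ^ (m - 1) * ?g y ^ n) + ennreal (?g y ^ Suc n) =
          ennreal ((1 - y) ^ (m - 1) * ?g y ^ n + ?g y ^ Suc n)"
        using True by (intro ennreal_plus[symmetric]) auto
      also have "(1 - y) ^ (m - 1) * ?g y ^ n + ?g y ^ Suc n = ?g y ^ n" by (simp add: algebra_simps)
      finally show ?thesis using True by simp
    qed simp
  qed
  also have "\<dots> = ennreal (psi n m)" by (rule nn_integral_psi)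
  finally have "ennreal (psi n m) - ennreal (psi (Suc n) m) =
      (\<integral>\<^sup>+y\<in>{0..1}. ennreal ((1 - y) ^ (m - 1) * (1 - (1 - y) ^ (m - 1)) ^ n) \<partial>lborel)"
    using ennreal_add_diff_cancel_right[of "ennreal (psi (Suc n) m)"
        "\<integral>\<^sup>+y\<in>{0..1}. ennreal ((1 - y) ^ (m - 1) * ?g y ^ n) \<partial>lborel"] by simp
  then show ?thesis using psi_pos[OF assms, of "Suc n"] by (simp add: ennreal_minus)
qed

section \<open>Logarithmic estimates: products against harmonic numbers\<close>

lemma ln_one_plus_ge:
  assumes "0 \<le> (x::real)"
  shows "x - x\<^sup>2 / 2 \<le> ln (1 + x)"
proof -
  have "ln (1 + 0) - (0 - 0\<^sup>2 / 2) \<le> ln (1 + x) - (x - x\<^sup>2 / 2)"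
  proof (rule DERIV_nonneg_imp_nondecreasing[OF assms])
    fix t :: real assume t: "0 \<le> t" "t \<le> x"
    have "((\<lambda>x. ln (1 + x) - (x - x\<^sup>2 / 2)) has_real_derivative (1 / (1 + t) - (1 - t))) (at t)"
      using t by (auto intro!: derivative_eq_intros)
    moreover have "1 / (1 + t) - (1 - t) = t\<^sup>2 / (1 + t)"
      using t by (simp add: field_simps power2_eq_square)
    ultimately show "\<exists>y. ((\<lambda>x. ln (1 + x) - (x - x\<^sup>2 / 2)) has_real_derivative y) (at t) \<and> 0 \<le> y"
      using t by (intro exI[of _ "1 / (1 + t) - (1 - t)"]) auto
  qed
  then show ?thesis by simp
qed

lemma sum_inverse_squares_le:
  assumes "1 \<le> n"
  shows "(\<Sum>j\<in>{2..n}. 1 / (real j)\<^sup>2) \<le> 1 - 1 / real n"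
  using assms
proof (induction n rule: dec_induct)
  case (step n)
  have "{2..Suc n} = insert (Suc n) {2..n}" using step by auto
  then have "(\<Sum>j\<in>{2..Suc n}. 1 / (real j)\<^sup>2) \<le> 1 / (real (Suc n))\<^sup>2 + (1 - 1 / real n)" using step.IH by simp
  also have "1 / (real (Suc n))\<^sup>2 \<le> 1 / real n - 1 / real (Suc n)"
  proof -
    have "1 / (real (Suc n))\<^sup>2 \<le> 1 / (real n * real (Suc n))"
      using step(1) unfolding power2_eq_square by (intro divide_left_mono mult_right_mono) auto
    also have "\<dots> = 1 / real n - 1 / real (Suc n)" using step(1) by (simp add: field_simps)
    finally show ?thesis .
  qed
  finally show ?case by simp
qed simp

text \<open>Termwise x - x^2/2 <= ln(1+x) <= x. The index set is left open because the ratio needs j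
  from 2 and \<open>psi\<close> needs j from 1.\<close>

lemma ln_prod_bounds:
  fixes A :: "nat set"
  assumes "finite A" "\<And>j. j \<in> A \<Longrightarrow> 1 \<le> j" "0 \<le> k"
  shows "ln (\<Prod>j\<in>A. (1 + k / real j) ^ m) \<le> real m * k * (\<Sum>j\<in>A. 1 / real j)"
    "real m * k * (\<Sum>j\<in>A. 1 / real j) - real m * k\<^sup>2 / 2 * (\<Sum>j\<in>A. 1 / (real j)\<^sup>2)
      \<le> ln (\<Prod>j\<in>A. (1 + k / real j) ^ m)"
proof -
  have pos: "0 < 1 + k / real j" if "j \<in> A" for j using assms(2)[OF that] assms(3) by (intro add_pos_nonneg) auto
  have eq: "ln (\<Prod>j\<in>A. (1 + k / real j) ^ m) = (\<Sum>j\<in>A. real m * ln (1 + k / real j))"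
    using pos assms(1) by (subst ln_prod) (auto simp: ln_realpow less_imp_neq[symmetric] intro!: sum.cong)
  have "(\<Sum>j\<in>A. real m * ln (1 + k / real j)) \<le> (\<Sum>j\<in>A. real m * (k / real j))"
    using assms(3) by (intro sum_mono mult_left_mono ln_add_one_self_le_self) auto
  then show "ln (\<Prod>j\<in>A. (1 + k / real j) ^ m) \<le> real m * k * (\<Sum>j\<in>A. 1 / real j)"
    unfolding eq by (simp add: sum_distrib_left)
  have "real m * k * (\<Sum>j\<in>A. 1 / real j) - real m * k\<^sup>2 / 2 * (\<Sum>j\<in>A. 1 / (real j)\<^sup>2) =
      (\<Sum>j\<in>A. real m * (k / real j - (k / real j)\<^sup>2 / 2))"
    by (simp add: sum_distrib_left sum_subtractf right_diff_distrib power_divide mult_ac sum_divide_distrib)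
  also have "\<dots> \<le> ln (\<Prod>j\<in>A. (1 + k / real j) ^ m)"
    unfolding eq using assms(3) by (intro sum_mono mult_left_mono ln_one_plus_ge) auto
  finally show "real m * k * (\<Sum>j\<in>A. 1 / real j) - real m * k\<^sup>2 / 2 * (\<Sum>j\<in>A. 1 / (real j)\<^sup>2)
      \<le> ln (\<Prod>j\<in>A. (1 + k / real j) ^ m)" .
qed

text \<open>The defect is at most m k^2/2 times the sum of 1/j^2 over j >= 2. That sum is below 1,
  and m k = m/(m-1) <= 2 turns m k^2/2 into k = 1/(m-1).\<close>

lemma ln_prod_eq_harm:
  assumes "2 \<le> m" "1 \<le> n"
  shows "\<exists>\<theta>::real. 0 \<le> \<theta> \<and> \<theta> \<le> 1 / (real m - 1) \<and>
         ln (\<Prod>j\<in>{2..n}. (1 + 1 / ((real m - 1) * real j)) ^ m)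
           = real m / (real m - 1) * (harm n - 1) - \<theta>"
proof -
  define k where "k = 1 / (real m - 1)"
  have k: "0 < k" "real m * k \<le> 2" using assms by (auto simp: k_def field_simps)
  have eq: "(\<Prod>j\<in>{2..n}. (1 + 1 / ((real m - 1) * real j)) ^ m) = (\<Prod>j\<in>{2..n}. (1 + k / real j) ^ m)"
    by (simp add: k_def)
  have I: "{1..n} = insert 1 {2..n}" using assms by auto
  have h: "harm n - 1 = (\<Sum>j\<in>{2..n}. 1 / real j)"
    unfolding harm_def I by (simp add: divide_inverse)
  define \<theta> where "\<theta> = real m * k * (harm n - 1) - ln (\<Prod>j\<in>{2..n}. (1 + k / real j) ^ m)"
  have "0 \<le> \<theta>" using ln_prod_bounds(1)[of "{2..n}" k m] k by (simp add: \<theta>_def h)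
  moreover have "\<theta> \<le> k"
  proof -
    have "\<theta> \<le> real m * k\<^sup>2 / 2 * (\<Sum>j\<in>{2..n}. 1 / (real j)\<^sup>2)"
      using ln_prod_bounds(2)[of "{2..n}" k m] k by (simp add: \<theta>_def h)
    also have "\<dots> \<le> real m * k\<^sup>2 / 2 * 1"
      using sum_inverse_squares_le[OF assms(2)] by (intro mult_left_mono) (auto intro: order_trans)
    also have "\<dots> = k * (real m * k) / 2" by (simp add: power2_eq_square)
    also have "\<dots> \<le> k * 2 / 2" using k by (intro divide_right_mono mult_left_mono) auto
    finally show ?thesis by simp
  qed
  ultimately show ?thesis unfolding eq
    by (intro exI[of _ \<theta>]) (auto simp: \<theta>_def k_def)
qed

text \<open>Compares \<open>psi\<close> with the bound that Jensen's inequality delivers. The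
  quadratic error in the exponent is at most m k^2, since the sum of 1/j^2 stays below 2 for every
  n, and m <= 2(m-1) makes this at most 4/m.\<close>

lemma psi_power_le_exp_harm:
  assumes "2 \<le> m" "1 \<le> n"
  shows "psi n m ^ m * (1 - 4 / real m) \<le> exp (- (real m / (real m - 1) * harm n))"
proof -
  define k where "k = 1 / (real m - 1)"
  have k: "0 < k" using assms by (auto simp: k_def)
  have "(real m)\<^sup>2 \<le> (2 * (real m - 1))\<^sup>2" using assms by (intro power_mono) auto
  then have mk: "real m * k\<^sup>2 \<le> 4 / real m"
    using assms by (simp add: k_def field_simps power2_eq_square)
  let ?P = "\<Prod>j\<in>{1..n}. (1 + k / real j) ^ m"
  have P: "0 < ?P" using k by (intro prod_pos) (auto intro!: zero_less_power add_pos_nonneg)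
  have psi: "psi n m ^ m = inverse ?P"
    unfolding psi_eq_prod[OF assms(1)] by (simp add: k_def prod_power_distrib[symmetric] prod_inversef[unfolded o_def] power_inverse)
  have I: "{1..n} = insert 1 {2..n}" using assms by auto
  have "(\<Sum>j\<in>{1..n}. 1 / (real j)\<^sup>2) \<le> 2"
    unfolding I using sum_inverse_squares_le[OF assms(2)] by (auto intro: order_trans)
  moreover have h: "harm n = (\<Sum>j\<in>{1..n}. 1 / real j)" by (simp add: harm_def divide_inverse)
  have bd: "real m * k * harm n - real m * k\<^sup>2 / 2 * (\<Sum>j\<in>{1..n}. 1 / (real j)\<^sup>2) \<le> ln ?P"
    unfolding h by (rule ln_prod_bounds(2)) (use k in auto)
  ultimately have "real m * k\<^sup>2 / 2 * (\<Sum>j\<in>{1..n}. 1 / (real j)\<^sup>2) \<le> real m * k\<^sup>2 / 2 * 2"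
    by (intro mult_left_mono) auto
  also have "\<dots> \<le> 4 / real m" using mk by simp
  finally have "real m * k * harm n - 4 / real m \<le> ln ?P"
    using bd by linarith
  then have "exp (real m * k * harm n - 4 / real m) \<le> ?P"
    using ln_ge_iff[OF P] by blast
  then have "psi n m ^ m \<le> exp (- (real m * k * harm n - 4 / real m))"
    unfolding psi exp_minus using P by (intro le_imp_inverse_le) auto
  also have "\<dots> = exp (- (real m * k * harm n)) * exp (4 / real m)" by (simp add: exp_add[symmetric])
  finally have 1: "psi n m ^ m * exp (- (4 / real m)) \<le> exp (- (real m * k * harm n))"
    by (simp add: exp_minus field_simps)
  have "1 - 4 / real m \<le> exp (- (4 / real m))" using exp_ge_add_one_self[of "- (4 / real m)"] by simp
  then have "psi n m ^ m * (1 - 4 / real m) \<le> psi n m ^ m * exp (- (4 / real m))"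
    using psi_pos[OF assms(1)] by (intro mult_left_mono) (auto intro: less_imp_le)
  also note 1
  also have "real m * k = real m / (real m - 1)" by (simp add: k_def)
  finally show ?thesis .
qed

section \<open>Strong relaxation: dependence and union bounds\<close>

lemma pair_sigma_finite_columns_caps: "1 \<le> m \<Longrightarrow> pair_sigma_finite (iid_columns m n) (caps m)"
  using finite_measure_columns[THEN finite_measure.axioms(1)] sigma_finite_caps
  by (intro pair_sigma_finite.intro)

text \<open>On the unit cube this is G(y)^n in the notation of the overview, and 0 elsewhere; see
  \<open>strong_section_eq\<close>.\<close>

definition strong_section :: "nat \<Rightarrow> nat \<Rightarrow> (nat \<Rightarrow> real) \<Rightarrow> ennreal" where
  "strong_section m n y = emeasure (iid_columns m n) ((\<lambda>\<omega>. (\<omega>, y)) -` strong_set m n)"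

lemma measurable_strong_section[measurable]:
  assumes "1 \<le> m"
  shows "strong_section m n \<in> borel_measurable (caps m)"
proof -
  interpret pair_sigma_finite "iid_columns m n" "caps m" using assms by (rule pair_sigma_finite_columns_caps)
  have "(\<lambda>y. emeasure (iid_columns m n) ((\<lambda>\<omega>. (\<omega>, y)) -` strong_set m n)) \<in> borel_measurable (caps m)"
    by (rule measurable_emeasure_Pair2[OF sets_strong_set])
  then show ?thesis by (simp add: strong_section_def[abs_def])
qed

lemma emeasure_strong_set:
  assumes "1 \<le> m"
  shows "emeasure (iid_columns m n \<Otimes>\<^sub>M caps m) (strong_set m n) = (\<integral>\<^sup>+y. strong_section m n y \<partial>caps m)"
proof -
  interpret pair_sigma_finite "iid_columns m n" "caps m" using assms by (rule pair_sigma_finite_columns_caps)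
  show ?thesis unfolding strong_section_def by (rule emeasure_pair_measure_alt2[OF sets_strong_set])
qed

abbreviation capped :: "nat \<Rightarrow> (nat \<Rightarrow> real) \<Rightarrow> (nat \<Rightarrow> real) set" where
  "capped m y \<equiv> {x \<in> space (column_space m). \<forall>i\<in>{1..m}. coord m x i \<le> y i}"

lemma PiE_Collect_eq:
  "{\<omega> \<in> Pi\<^sub>E J (\<lambda>_. S). \<forall>i\<in>I. \<forall>j\<in>J. P (\<omega> j) i} = Pi\<^sub>E J (\<lambda>_. {x \<in> S. \<forall>i\<in>I. P x i})"
  unfolding set_eq_iff mem_Collect_eq PiE_iff by blast

lemma strong_section_eq:
  assumes "1 \<le> m" "1 \<le> n" "y \<in> space (caps m)"
  shows "strong_section m n y =
    (if \<forall>i\<in>{1..m}. 0 \<le> y i \<and> y i \<le> 1 then emeasure (unif_simplex m) (capped m y) ^ n else 0)"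
proof (cases "\<forall>i\<in>{1..m}. y i \<le> 1")
  case False
  then have "(\<lambda>\<omega>. (\<omega>, y)) -` strong_set m n = {}" by (auto simp: strong_set_def)
  moreover have "\<not> (\<forall>i\<in>{1..m}. 0 \<le> y i \<and> y i \<le> 1)" using False by blast
  ultimately show ?thesis by (simp only: strong_section_def if_False emeasure_empty)
next
  case True
  have "(\<lambda>\<omega>. (\<omega>, y)) -` strong_set m n =
      {\<omega> \<in> space (raw_columns m n). \<forall>i\<in>{1..m}. \<forall>j\<in>{1..n}. coord m (\<omega> j) i \<le> y i}"
    using True assms(3) by (simp add: strong_set_def space_pair_measure vimage_def)
  also have "\<dots> = Pi\<^sub>E {1..n} (\<lambda>_. capped m y)"
    unfolding space_PiM[of "{1..n}"] by (rule PiE_Collect_eq)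
  finally have "(\<lambda>\<omega>. (\<omega>, y)) -` strong_set m n = Pi\<^sub>E {1..n} (\<lambda>_. capped m y)" .
  then have eq: "strong_section m n y = emeasure (unif_simplex m) (capped m y) ^ n"
    using assms by (simp add: strong_section_def emeasure_columns_PiE sets_coord_le)
  \<comment> \<open>A negative cap excludes the whole simplex, so the n-th power has base 0. Here n
    >= 1 matters, because 0^0 = 1.\<close>
  have "strong_section m n y = 0" if "i \<in> {1..m}" "y i < 0" for i
  proof -
    have "std_simplex m \<inter> capped m y = {}" using that by (force simp: std_simplex_def)
    then have "emeasure (unif_simplex m) (capped m y) = 0"
      using assms by (subst emeasure_unif_simplex[OF sets_coord_le]) auto
    then show ?thesis using eq assms(2) by simp
  qed
  then show ?thesis using eq True by (meson linorder_not_le)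
qed

lemma prod_indicator_ennreal:
  assumes "finite A"
  shows "(\<Prod>i\<in>A. ennreal (f i) * indicator {0..1::real} (y i)) =
    (if \<forall>i\<in>A. 0 \<le> y i \<and> y i \<le> 1 then (\<Prod>i\<in>A. ennreal (f i)) else 0)"
proof (cases "\<forall>i\<in>A. 0 \<le> y i \<and> y i \<le> 1")
  case False
  then have "(\<Prod>i\<in>A. ennreal (f i) * indicator {0..1::real} (y i)) = 0"
    using assms by (auto intro!: prod_zero simp: indicator_def)
  with False show ?thesis by simp
qed (auto simp: indicator_def intro!: prod.cong)

lemma nn_integral_caps_prod:
  assumes "\<And>i. i \<in> {1..m} \<Longrightarrow> f i \<in> borel_measurable borel"
  shows "(\<integral>\<^sup>+y. (\<Prod>i\<in>{1..m}. ennreal (f i (y i)) * indicator {0..1} (y i)) \<partial>caps m) =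
    (\<Prod>i\<in>{1..m}. \<integral>\<^sup>+t\<in>{0..1}. ennreal (f i t) \<partial>lborel)"
proof -
  interpret product_sigma_finite "\<lambda>_::nat. lborel :: real measure" by standard
  show ?thesis using assms by (intro product_nn_integral_prod) auto
qed

lemma emeasure_strong_set_le:
  assumes "2 \<le> m" "1 \<le> n"
  shows "emeasure (iid_columns m n \<Otimes>\<^sub>M caps m) (strong_set m n) \<le> ennreal (psi n m ^ m)"
proof -
  have "emeasure (iid_columns m n \<Otimes>\<^sub>M caps m) (strong_set m n) = (\<integral>\<^sup>+y. strong_section m n y \<partial>caps m)"
    using assms by (intro emeasure_strong_set) auto
  also have "\<dots> \<le> (\<integral>\<^sup>+y. (\<Prod>i\<in>{1..m}. ennreal ((1 - (1 - y i) ^ (m - 1)) ^ n) * indicator {0..1} (y i)) \<partial>caps m)"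
  proof (rule nn_integral_mono)
    fix y assume y: "y \<in> space (caps m)"
    have "emeasure (unif_simplex m) (capped m y) ^ n \<le> (\<Prod>i\<in>{1..m}. ennreal ((1 - (1 - y i) ^ (m - 1)) ^ n))"
      if y01: "\<forall>i\<in>{1..m}. 0 \<le> y i \<and> y i \<le> 1"
    proof -
      have nn: "0 \<le> 1 - (1 - y i) ^ (m - 1)" if "i \<in> {1..m}" for i using y01 that by (auto simp: power_le_one)
      have "emeasure (unif_simplex m) (capped m y) ^ n \<le> ennreal (\<Prod>i\<in>{1..m}. 1 - (1 - y i) ^ (m - 1)) ^ n"
        using y01 by (intro power_mono unif_simplex_coord_le_le_prod[OF assms(1)]) auto
      also have "\<dots> = ennreal ((\<Prod>i\<in>{1..m}. 1 - (1 - y i) ^ (m - 1)) ^ n)"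
        using nn by (intro ennreal_power prod_nonneg) auto
      also have "(\<Prod>i\<in>{1..m}. 1 - (1 - y i) ^ (m - 1)) ^ n = (\<Prod>i\<in>{1..m}. (1 - (1 - y i) ^ (m - 1)) ^ n)"
        by (rule prod_power_distrib)
      also have "ennreal \<dots> = (\<Prod>i\<in>{1..m}. ennreal ((1 - (1 - y i) ^ (m - 1)) ^ n))"
        using nn by (intro prod_ennreal[symmetric]) auto
      finally show ?thesis .
    qed
    then show "strong_section m n y \<le>
        (\<Prod>i\<in>{1..m}. ennreal ((1 - (1 - y i) ^ (m - 1)) ^ n) * indicator {0..1} (y i))"
      using assms y by (subst strong_section_eq, simp, simp, simp, subst prod_indicator_ennreal) auto
  qed
  also have "\<dots> = (\<Prod>i\<in>{1..m}. ennreal (psi n m))"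
    by (subst nn_integral_caps_prod[where f = "\<lambda>_ t. (1 - (1 - t) ^ (m - 1)) ^ n"]) (auto simp: nn_integral_psi)
  also have "\<dots> = ennreal (psi n m ^ m)"
    using psi_pos[OF assms(1), of n] by (simp add: ennreal_power)
  finally show ?thesis .
qed

text \<open>A Bonferroni inequality with each pair counted twice. Ordered pairs make the error the
  square of the sum minus the sum of squares, which is easy to update in the induction; there
  Weierstrass' bound 1 - sum <= product controls the new cross term.\<close>

lemma prod_one_minus_le:
  fixes t :: "'a \<Rightarrow> real"
  assumes "finite A" "\<And>i. i \<in> A \<Longrightarrow> 0 \<le> t i \<and> t i \<le> 1"
  shows "(\<Prod>i\<in>A. 1 - t i) \<le> 1 - (\<Sum>i\<in>A. t i) + (\<Sum>i\<in>A. \<Sum>l\<in>A - {i}. t i * t l)"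
proof -
  have "(\<Prod>i\<in>A. 1 - t i) \<le> 1 - (\<Sum>i\<in>A. t i) + ((\<Sum>i\<in>A. t i)\<^sup>2 - (\<Sum>i\<in>A. (t i)\<^sup>2))"
    using assms
  proof (induction A)
    case (insert a A)
    let ?s = "\<Sum>i\<in>A. t i"
    have s: "0 \<le> ?s" "0 \<le> t a" using insert by (auto intro: sum_nonneg)
    have "t a * (1 - ?s) \<le> t a * (\<Prod>i\<in>A. 1 - t i)"
      using insert by (intro mult_left_mono Weierstrass_prod_ineq) auto
    moreover have "(\<Prod>i\<in>A. 1 - t i) \<le> 1 - ?s + (?s\<^sup>2 - (\<Sum>i\<in>A. (t i)\<^sup>2))" using insert by auto
    moreover have "0 \<le> t a * ?s" using s by simp
    ultimately show ?case using insert(1,2) by (simp add: algebra_simps power2_sum)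
  qed simp
  also have "(\<Sum>i\<in>A. t i)\<^sup>2 - (\<Sum>i\<in>A. (t i)\<^sup>2) = (\<Sum>i\<in>A. (\<Sum>l\<in>A. t i * t l) - t i * t i)"
    by (simp add: power2_eq_square sum_product sum_subtractf)
  also have "\<dots> = (\<Sum>i\<in>A. \<Sum>l\<in>A - {i}. t i * t l)"
    using assms(1) by (intro sum.cong) (auto simp: sum_diff1)
  finally show ?thesis .
qed

text \<open>Convexity: the tangent of x^(n+1) at a, evaluated at b, lies below b^(n+1), in whichever
  order a and b stand.\<close>

lemma power_tangent:
  fixes a b :: real
  assumes "0 \<le> a" "0 \<le> b"
  shows "a ^ Suc n \<le> b ^ Suc n + real (Suc n) * (a - b) * a ^ n"
proof (induction n)
  case (Suc n)
  have "0 \<le> (a ^ Suc n - b ^ Suc n) * (a - b)"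
  proof (cases "b \<le> a")
    case True
    then show ?thesis using assms power_mono[of b a "Suc n"] by (intro mult_nonneg_nonneg) auto
  next
    case False
    then show ?thesis using assms power_mono[of a b "Suc n"] by (intro mult_nonpos_nonpos) auto
  qed
  then have "b * a ^ Suc n + a * b ^ Suc n \<le> a ^ Suc (Suc n) + b ^ Suc (Suc n)" by (simp add: algebra_simps)
  moreover have "a * a ^ Suc n \<le> a * (b ^ Suc n + real (Suc n) * (a - b) * a ^ n)"
    by (intro mult_left_mono Suc.IH assms)
  ultimately show ?case by (simp add: algebra_simps)
qed simp

text \<open>The tangent is taken at the product and not at the union bound: the error then keeps the
  factor product^n, so it splits over the coordinates and can be integrated exactly. The union bound
  may be negative, hence \<open>max 0\<close>.\<close>

lemma union_bound_power:
  fixes t :: "'a \<Rightarrow> real"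
  assumes "finite A" "\<And>i. i \<in> A \<Longrightarrow> 0 \<le> t i \<and> t i \<le> 1"
  shows "(\<Prod>i\<in>A. 1 - t i) ^ Suc n \<le> (max 0 (1 - (\<Sum>i\<in>A. t i))) ^ Suc n +
    (\<Sum>i\<in>A. \<Sum>l\<in>A - {i}. real (Suc n) * (t i * t l * (\<Prod>r\<in>A. 1 - t r) ^ n))"
proof -
  let ?a = "\<Prod>i\<in>A. 1 - t i" and ?b = "max 0 (1 - (\<Sum>i\<in>A. t i))"
  have a: "0 \<le> ?a" using assms by (intro prod_nonneg) auto
  have "?a ^ Suc n \<le> ?b ^ Suc n + real (Suc n) * (?a - ?b) * ?a ^ n" using a by (intro power_tangent) auto
  also have "real (Suc n) * (?a - ?b) * ?a ^ n \<le>
      real (Suc n) * (\<Sum>i\<in>A. \<Sum>l\<in>A - {i}. t i * t l) * ?a ^ n"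
  proof (intro mult_right_mono mult_left_mono)
    show "?a - ?b \<le> (\<Sum>i\<in>A. \<Sum>l\<in>A - {i}. t i * t l)" using prod_one_minus_le[of A t] assms by auto
  qed (use a in auto)
  also have "\<dots> = (\<Sum>i\<in>A. \<Sum>l\<in>A - {i}. real (Suc n) * (t i * t l * ?a ^ n))"
    by (simp add: sum_distrib_left sum_distrib_right mult_ac)
  finally show ?thesis by simp
qed

lemma prod_two_special:
  fixes u v :: "'a \<Rightarrow> 'b :: comm_monoid_mult"
  assumes "finite A" "i \<in> A" "l \<in> A" "i \<noteq> l"
  shows "(\<Prod>r\<in>A. if r = i \<or> r = l then u r else v r) = u i * u l * (\<Prod>r\<in>A - {i, l}. v r)"
proof -
  have "A = insert i (insert l (A - {i, l}))" using assms by auto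
  then have "(\<Prod>r\<in>A. if r = i \<or> r = l then u r else v r) =
      (\<Prod>r\<in>insert i (insert l (A - {i, l})). if r = i \<or> r = l then u r else v r)" by simp
  also have "\<dots> = u i * (u l * (\<Prod>r\<in>A - {i, l}. if r = i \<or> r = l then u r else v r))"
    using assms by (subst prod.insert) auto
  also have "(\<Prod>r\<in>A - {i, l}. if r = i \<or> r = l then u r else v r) = (\<Prod>r\<in>A - {i, l}. v r)"
    by (intro prod.cong) auto
  finally show ?thesis by (simp add: mult.assoc)
qed

text \<open>Integrates \<open>union_bound_power\<close> over the cube. Each of the m(m-1) ordered
  pairs contributes n+1 times a product in which the two chosen coordinates give psi n m - psi (Suc
  n) m each and the other m-2 give psi n m.\<close>

lemma psi_power_le_strong:
  assumes "2 \<le> m"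
  shows "ennreal (psi (Suc n) m ^ m) \<le> emeasure (iid_columns m (Suc n) \<Otimes>\<^sub>M caps m) (strong_set m (Suc n)) +
    ennreal (real m * (real m - 1) * (real (Suc n) * ((psi n m - psi (Suc n) m)\<^sup>2 * psi n m ^ (m - 2))))"
proof -
  define D where "D = psi n m - psi (Suc n) m"
  define T where "T y = (1 - y) ^ (m - 1)" for y :: real
  have Tm[measurable]: "T \<in> borel_measurable borel" unfolding T_def[abs_def] by measurable
  have T01: "0 \<le> T y" "T y \<le> 1" if "0 \<le> y \<and> y \<le> 1" for y using that by (auto simp: T_def power_le_one)
  have D: "0 \<le> D"
  proof -
    have "psi (Suc n) m \<le> psi n m / 1" unfolding psi_Suc[OF assms]
      using psi_pos[OF assms, of n] assms by (intro divide_left_mono) (auto intro!: add_pos_nonneg)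
    then show ?thesis by (simp add: D_def)
  qed
  let ?I = "{1..m}"
  define h where "h i l r t = (if r = i \<or> r = l then T t * (1 - T t) ^ n else (1 - T t) ^ n)"
    for i l r :: nat and t
  have hm[measurable]: "h i l r \<in> borel_measurable borel" for i l r unfolding h_def[abs_def] by measurable
  \<comment> \<open>The error term for one ordered pair, with the indicator of the unit cube
    distributed over the factors so that the integral splits by coordinate.\<close>
  define C where "C i l y = ennreal (real (Suc n)) * (\<Prod>r\<in>?I. ennreal (h i l r (y r)) * indicator {0..1} (y r))"
    for i l and y :: "nat \<Rightarrow> real"
  have Cm[measurable]: "C i l \<in> borel_measurable (caps m)" for i l unfolding C_def[abs_def] by measurable
  have intC: "(\<integral>\<^sup>+y. C i l y \<partial>caps m) = ennreal (real (Suc n) * (D\<^sup>2 * psi n m ^ (m - 2)))"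
    if il: "i \<in> ?I" "l \<in> ?I - {i}" for i l
  proof -
    have "(\<integral>\<^sup>+y. C i l y \<partial>caps m) = ennreal (real (Suc n)) *
        (\<integral>\<^sup>+y. (\<Prod>r\<in>?I. ennreal (h i l r (y r)) * indicator {0..1} (y r)) \<partial>caps m)"
      unfolding C_def by (intro nn_integral_cmult) measurable
    also have "\<dots> = ennreal (real (Suc n)) * (\<Prod>r\<in>?I. \<integral>\<^sup>+t\<in>{0..1}. ennreal (h i l r t) \<partial>lborel)"
      by (subst nn_integral_caps_prod) auto
    also have "(\<Prod>r\<in>?I. \<integral>\<^sup>+t\<in>{0..1}. ennreal (h i l r t) \<partial>lborel) =
        (\<Prod>r\<in>?I. if r = i \<or> r = l then ennreal D else ennreal (psi n m))"
      using nn_integral_psi_diff[OF assms, of n] nn_integral_psi[of m n]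
      by (intro prod.cong) (auto simp: h_def T_def D_def)
    also have "\<dots> = ennreal D * ennreal D * ennreal (psi n m) ^ (m - 2)"
      using il by (subst prod_two_special) (auto simp: card_Diff_subset numeral_2_eq_2)
    also have "\<dots> = ennreal (D\<^sup>2 * psi n m ^ (m - 2))"
      using D psi_pos[OF assms, of n] by (simp add: ennreal_mult ennreal_power power2_eq_square)
    finally show ?thesis by (simp add: ennreal_mult' D)
  qed
  have "ennreal (psi (Suc n) m ^ m) = (\<Prod>i\<in>?I. ennreal (psi (Suc n) m))"
    using psi_pos[OF assms, of "Suc n"] by (simp add: ennreal_power)
  also have "\<dots> = (\<integral>\<^sup>+y. (\<Prod>i\<in>?I. ennreal ((1 - T (y i)) ^ Suc n) * indicator {0..1} (y i)) \<partial>caps m)"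
    using nn_integral_psi[of m "Suc n"]
    by (subst nn_integral_caps_prod[where f = "\<lambda>_ t. (1 - T t) ^ Suc n"]) (auto simp: T_def simp del: power_Suc)
  also have "\<dots> \<le> (\<integral>\<^sup>+y. strong_section m (Suc n) y + (\<Sum>i\<in>?I. \<Sum>l\<in>?I - {i}. C i l y) \<partial>caps m)"
  proof (rule nn_integral_mono)
    fix y assume y: "y \<in> space (caps m)"
    show "(\<Prod>i\<in>?I. ennreal ((1 - T (y i)) ^ Suc n) * indicator {0..1} (y i)) \<le>
        strong_section m (Suc n) y + (\<Sum>i\<in>?I. \<Sum>l\<in>?I - {i}. C i l y)"
    proof (cases "\<forall>i\<in>?I. 0 \<le> y i \<and> y i \<le> 1")
      case False
      then show ?thesis by (subst prod_indicator_ennreal) auto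
    next
      case True
      note t01 = T01[OF True[rule_format]]
      let ?P = "\<Prod>r\<in>?I. 1 - T (y r)" and ?b = "max 0 (1 - (\<Sum>i\<in>?I. T (y i)))"
      have C: "C i l y = ennreal (real (Suc n) * (T (y i) * T (y l) * ?P ^ n))"
        if il: "i \<in> ?I" "l \<in> ?I - {i}" for i l
      proof -
        have "C i l y = ennreal (real (Suc n)) * (\<Prod>r\<in>?I. ennreal (h i l r (y r)))"
          unfolding C_def using True by (subst prod_indicator_ennreal) auto
        also have "\<dots> = ennreal (real (Suc n) * (\<Prod>r\<in>?I. h i l r (y r)))"
          using t01 by (subst prod_ennreal) (auto simp: h_def ennreal_mult' intro!: prod_nonneg)
        also have "(\<Prod>r\<in>?I. h i l r (y r)) =
            (\<Prod>r\<in>?I. (if r = i \<or> r = l then T (y r) else 1) * (1 - T (y r)) ^ n)"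
          by (intro prod.cong) (auto simp: h_def)
        also have "\<dots> = T (y i) * T (y l) * ?P ^ n"
          using il unfolding prod.distrib prod_power_distrib[symmetric] by (subst prod_two_special) auto
        finally show ?thesis .
      qed
      have nn: "0 \<le> real (Suc n) * (T (y i) * T (y l) * ?P ^ n)" if "i \<in> ?I" "l \<in> ?I - {i}" for i l
        using t01 that by (intro mult_nonneg_nonneg zero_le_power prod_nonneg) auto
      have "(\<Prod>i\<in>?I. ennreal ((1 - T (y i)) ^ Suc n) * indicator {0..1} (y i)) = ennreal (?P ^ Suc n)"
      proof -
        have "(\<Prod>i\<in>?I. ennreal ((1 - T (y i)) ^ Suc n) * indicator {0..1} (y i)) =
            (\<Prod>i\<in>?I. ennreal ((1 - T (y i)) ^ Suc n))"
          using True by (subst prod_indicator_ennreal) auto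
        also have "\<dots> = ennreal (\<Prod>i\<in>?I. (1 - T (y i)) ^ Suc n)"
          using t01 by (intro prod_ennreal zero_le_power) auto
        finally show ?thesis by (simp only: prod_power_distrib)
      qed
      also have "\<dots> \<le> ennreal (?b ^ Suc n + (\<Sum>i\<in>?I. \<Sum>l\<in>?I - {i}. real (Suc n) * (T (y i) * T (y l) * ?P ^ n)))"
        using t01 by (intro ennreal_leI union_bound_power) auto
      also have "\<dots> = ennreal (?b ^ Suc n) + ennreal (\<Sum>i\<in>?I. \<Sum>l\<in>?I - {i}. real (Suc n) * (T (y i) * T (y l) * ?P ^ n))"
        using nn by (intro ennreal_plus sum_nonneg) auto
      also have "ennreal (\<Sum>i\<in>?I. \<Sum>l\<in>?I - {i}. real (Suc n) * (T (y i) * T (y l) * ?P ^ n)) =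
          (\<Sum>i\<in>?I. \<Sum>l\<in>?I - {i}. C i l y)"
      proof -
        let ?c = "\<lambda>i l. real (Suc n) * (T (y i) * T (y l) * ?P ^ n)"
        have "ennreal (\<Sum>i\<in>?I. \<Sum>l\<in>?I - {i}. ?c i l) = (\<Sum>i\<in>?I. ennreal (\<Sum>l\<in>?I - {i}. ?c i l))"
          by (intro sum_ennreal[symmetric] sum_nonneg nn)
        also have "\<dots> = (\<Sum>i\<in>?I. \<Sum>l\<in>?I - {i}. ennreal (?c i l))"
          by (intro sum.cong refl sum_ennreal[symmetric] nn)
        also have "\<dots> = (\<Sum>i\<in>?I. \<Sum>l\<in>?I - {i}. C i l y)"
          by (intro sum.cong refl C[symmetric])
        finally show ?thesis .
      qed
      also have "ennreal (?b ^ Suc n) \<le> strong_section m (Suc n) y"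
      proof -
        \<comment> \<open>\<open>ennreal\<close> sends negative numbers to 0 and thus performs the
          truncation \<open>max 0\<close>; the union bound stays usable when the sum exceeds
          1.\<close>
        have "ennreal (?b ^ Suc n) = ennreal (1 - (\<Sum>i\<in>?I. T (y i))) ^ Suc n"
          by (subst ennreal_power[symmetric]) (auto simp: ennreal_max_0)
        also have "\<dots> \<le> emeasure (unif_simplex m) (capped m y) ^ Suc n"
          unfolding T_def using True by (intro power_mono unif_simplex_coord_le_ge[OF assms]) auto
        also have "\<dots> = strong_section m (Suc n) y"
          using True assms y by (subst strong_section_eq) auto
        finally show ?thesis .
      qed
      finally show ?thesis by (simp add: add_right_mono)
    qed
  qed
  also have "\<dots> = (\<integral>\<^sup>+y. strong_section m (Suc n) y \<partial>caps m) + (\<integral>\<^sup>+y. (\<Sum>i\<in>?I. \<Sum>l\<in>?I - {i}. C i l y) \<partial>caps m)"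
    using assms by (intro nn_integral_add measurable_strong_section) (auto intro!: borel_measurable_sum)
  also have "(\<integral>\<^sup>+y. (\<Sum>i\<in>?I. \<Sum>l\<in>?I - {i}. C i l y) \<partial>caps m) =
      (\<Sum>i\<in>?I. \<Sum>l\<in>?I - {i}. ennreal (real (Suc n) * (D\<^sup>2 * psi n m ^ (m - 2))))"
    using intC by (subst nn_integral_sum) (auto intro!: sum.cong borel_measurable_sum simp: nn_integral_sum)
  also have "\<dots> = ennreal (real m * (real m - 1) * (real (Suc n) * (D\<^sup>2 * psi n m ^ (m - 2))))"
  proof -
    have "of_nat (m - 1) = ennreal (real m - 1)"
      using assms by (simp add: ennreal_of_nat_eq_real_of_nat of_nat_diff)
    then show ?thesis using assms psi_pos[OF assms, of n]
      by (simp add: ennreal_mult' ennreal_of_nat_eq_real_of_nat[symmetric] mult_ac)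
  qed
  finally show ?thesis using assms by (simp add: D_def emeasure_strong_set)
qed

section \<open>Bounds for the strong volume from the two inequalities\<close>

lemma emeasure_strong_set_eq_ennreal:
  assumes "2 \<le> m" "1 \<le> n"
  shows "emeasure (iid_columns m n \<Otimes>\<^sub>M caps m) (strong_set m n) = ennreal (fact (m - 1) ^ n * V_P m n)"
proof -
  have "emeasure (iid_columns m n \<Otimes>\<^sub>M caps m) (strong_set m n) \<noteq> \<infinity>"
    using emeasure_strong_set_le[OF assms] by (auto simp: top_unique)
  then show ?thesis using assms by (subst V_P_eq_measure) (auto simp: measure_def less_top)
qed

lemma V_P_nonneg: "0 \<le> V_P m n"
  by (simp add: V_P_def Vol_def)

lemma V_P_le:
  assumes "2 \<le> m" "1 \<le> n"
  shows "fact (m - 1) ^ n * V_P m n \<le> psi n m ^ m"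
  using emeasure_strong_set_le[OF assms] psi_pos[OF assms(1), of n]
  unfolding emeasure_strong_set_eq_ennreal[OF assms] by (subst (asm) ennreal_le_iff) auto

text \<open>With psi n' m = p (1 + x), the error relative to p^m is m(m-1) n x^2 (1+x)^(m-2). The
  last factor is at most e <= 3 since (m-2) x <= 1; the rest equals m/((m-1) n) and is at most
  4/(n+1) by m <= 2(m-1) and n+1 <= 2n. Hence 12.\<close>

lemma V_P_ge:
  assumes "2 \<le> m" "1 \<le> n"
  shows "(1 - 12 / (real n + 1)) * psi n m ^ m \<le> fact (m - 1) ^ n * V_P m n"
proof -
  obtain n' where n: "n = Suc n'" using assms by (cases n) auto
  define x where "x = 1 / ((real m - 1) * real n)"
  define p where "p = psi n m"
  have x: "0 \<le> x" using assms by (simp add: x_def)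
  have p: "0 < p" using psi_pos[OF assms(1)] by (simp add: p_def)
  have pn': "psi n' m = p * (1 + x)"
  proof -
    have "p = psi n' m / (1 + x)" unfolding p_def x_def n by (rule psi_Suc[OF assms(1)])
    then show ?thesis using x by (simp add: divide_simps split: if_splits)
  qed
  have R: "real m * (real m - 1) * (real n * ((psi n' m - psi n m)\<^sup>2 * psi n' m ^ (m - 2))) \<le>
      12 / (real n + 1) * p ^ m"
  proof -
    have "(1 + x) ^ (m - 2) \<le> exp x ^ (m - 2)" using x by (intro power_mono) auto
    also have "\<dots> = exp (real (m - 2) * x)" by (simp add: exp_of_nat_mult)
    also have "\<dots> \<le> exp 1"
    proof -
      have "real (m - 2) \<le> (real m - 1) * real n"
      proof -
        have "real (m - 2) \<le> (real m - 1) * 1" using assms by (simp add: of_nat_diff)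
        also have "\<dots> \<le> (real m - 1) * real n" using assms by (intro mult_left_mono) auto
        finally show ?thesis .
      qed
      then show ?thesis using assms by (auto simp: x_def divide_le_eq_1)
    qed
    also have "\<dots> \<le> 3" by (rule exp_le)
    finally have 3: "(1 + x) ^ (m - 2) \<le> 3" .
    have "real m * (real m - 1) * real n * x\<^sup>2 = real m / ((real m - 1) * real n)"
      using assms by (simp add: x_def power2_eq_square divide_simps)
    also have "\<dots> \<le> 4 / (real n + 1)"
    proof -
      have "real m * (real n + 1) \<le> (2 * (real m - 1)) * (2 * real n)"
        using assms by (intro mult_mono) auto
      then show ?thesis using assms by (simp add: divide_simps mult_ac)
    qed
    finally have 4: "real m * (real m - 1) * real n * x\<^sup>2 \<le> 4 / (real n + 1)" .
    have pm: "p ^ m = p\<^sup>2 * p ^ (m - 2)"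
      by (metis assms(1) le_add_diff_inverse power_add)
    have d: "psi n' m - psi n m = p * x" unfolding pn' p_def[symmetric] by (simp add: algebra_simps)
    have "real m * (real m - 1) * (real n * ((psi n' m - psi n m)\<^sup>2 * psi n' m ^ (m - 2))) =
        (real m * (real m - 1) * real n * x\<^sup>2) * (1 + x) ^ (m - 2) * p ^ m"
      unfolding d unfolding pn' pm by (simp only: power_mult_distrib mult_ac)
    also have "\<dots> \<le> 4 / (real n + 1) * 3 * p ^ m"
      using 3 4 p x by (intro mult_right_mono mult_mono) auto
    finally show ?thesis by simp
  qed
  have "ennreal (p ^ m) \<le> ennreal (fact (m - 1) ^ n * V_P m n) +
      ennreal (real m * (real m - 1) * (real n * ((psi n' m - psi n m)\<^sup>2 * psi n' m ^ (m - 2))))"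
    using psi_power_le_strong[OF assms(1), of n'] emeasure_strong_set_eq_ennreal[OF assms]
    by (simp only: n p_def)
  also have "\<dots> \<le> ennreal (fact (m - 1) ^ n * V_P m n) + ennreal (12 / (real n + 1) * p ^ m)"
    by (intro add_left_mono ennreal_leI R)
  also have "\<dots> = ennreal (fact (m - 1) ^ n * V_P m n + 12 / (real n + 1) * p ^ m)"
    using p V_P_nonneg[of m n] by (intro ennreal_plus[symmetric]) auto
  finally have "p ^ m \<le> fact (m - 1) ^ n * V_P m n + 12 / (real n + 1) * p ^ m"
    using p V_P_nonneg[of m n] by (subst (asm) ennreal_le_iff) auto
  then show ?thesis by (simp add: p_def algebra_simps)
qed

section \<open>Strong relaxation: Jensen bound\<close>

lemma emeasure_caps_box:
  "emeasure (caps m) {y \<in> space (caps m). \<forall>i\<in>{1..m}. h i \<le> y i \<and> y i \<le> 1} = (\<Prod>i\<in>{1..m}. ennreal (1 - h i))"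
proof -
  interpret product_sigma_finite "\<lambda>_::nat. lborel :: real measure" by standard
  have "{y \<in> space (caps m). \<forall>i\<in>{1..m}. h i \<le> y i \<and> y i \<le> 1} = Pi\<^sub>E {1..m} (\<lambda>i. {h i..1})"
    unfolding space_PiM set_eq_iff mem_Collect_eq PiE_iff space_lborel space_borel atLeastAtMost_iff
    by blast
  also have "emeasure (caps m) \<dots> = (\<Prod>i\<in>{1..m}. emeasure lborel {h i..1})"
    by (subst emeasure_PiM) auto
  \<comment> \<open>For h i > 1 the interval is empty, and \<open>ennreal\<close> truncates the
    negative length to 0.\<close>
  also have "\<dots> = (\<Prod>i\<in>{1..m}. ennreal (1 - h i))"
    by (intro prod.cong refl) (auto simp: emeasure_lborel_Icc_eq ennreal_neg)
  finally show ?thesis .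
qed

text \<open>If W is the primitive of \<open>w\<close> with W(0) = 0, the left side is the
  expectation of W(f) for f in [0, 1]. Stating it through \<open>w\<close> allows W(1) to be
  infinite, as needed for w(t) = 1/(1-t); the moments of a coordinate use w = 1 and w = 2t.\<close>

lemma nn_integral_layer_cake:
  fixes f :: "'a \<Rightarrow> real"
  assumes "sigma_finite_measure M" and [measurable]: "f \<in> borel_measurable M" "w \<in> borel_measurable borel"
  shows "(\<integral>\<^sup>+x. (\<integral>\<^sup>+t\<in>{0..<1}. (if t < f x then w t else 0) \<partial>lborel) \<partial>M) =
    (\<integral>\<^sup>+t\<in>{0..<1}. w t * emeasure M {x \<in> space M. t < f x} \<partial>lborel)"
proof -
  interpret M: sigma_finite_measure M by fact
  interpret pair_sigma_finite M "lborel :: real measure" ..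
  have "(\<integral>\<^sup>+x. (\<integral>\<^sup>+t\<in>{0..<1}. (if t < f x then w t else 0) \<partial>lborel) \<partial>M) =
      (\<integral>\<^sup>+t. (\<integral>\<^sup>+x. (if t < f x then w t else 0) * indicator {0..<1} t \<partial>M) \<partial>lborel)"
    by (rule Fubini'[symmetric]) measurable
  also have "\<dots> = (\<integral>\<^sup>+t\<in>{0..<1}. w t * emeasure M {x \<in> space M. t < f x} \<partial>lborel)"
  proof (intro nn_integral_cong)
    fix t :: real
    have "(\<integral>\<^sup>+x. (if t < f x then w t else 0) * indicator {0..<1} t \<partial>M) =
        (\<integral>\<^sup>+x. (w t * indicator {0..<1} t) * indicator {x \<in> space M. t < f x} x \<partial>M)"
      by (intro nn_integral_cong) (auto simp: indicator_def)
    also have "\<dots> = (w t * indicator {0..<1} t) * emeasure M {x \<in> space M. t < f x}"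
      by (subst nn_integral_cmult_indicator) auto
    finally show "(\<integral>\<^sup>+x. (if t < f x then w t else 0) * indicator {0..<1} t \<partial>M) =
        w t * emeasure M {x \<in> space M. t < f x} * indicator {0..<1} t" by (simp add: mult_ac)
  qed
  finally show ?thesis .
qed

lemma nn_integral_Ico_eq_Icc:
  "(\<integral>\<^sup>+t\<in>{a..<b::real}. f t \<partial>lborel) = (\<integral>\<^sup>+t\<in>{a..b}. f t \<partial>lborel)"
  using AE_lborel_singleton[of b]
  by (intro nn_integral_cong_AE) (auto elim!: eventually_mono simp: indicator_def)

definition col_max :: "nat \<Rightarrow> nat \<Rightarrow> (nat \<Rightarrow> nat \<Rightarrow> real) \<Rightarrow> nat \<Rightarrow> real" where
  "col_max m n \<omega> i = Max ((\<lambda>j. coord m (\<omega> j) i) ` {1..n})"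

lemma measurable_col_max[measurable]:
  "i \<in> {1..m} \<Longrightarrow> (\<lambda>\<omega>. col_max m n \<omega> i) \<in> borel_measurable (iid_columns m n)"
  unfolding col_max_def by (intro borel_measurable_Max measurable_coord_columns) auto

lemma emeasure_col_max_gt:
  assumes "2 \<le> m" "1 \<le> n" "i \<in> {1..m}" "0 \<le> t" "t \<le> 1"
  shows "emeasure (iid_columns m n) {\<omega> \<in> space (iid_columns m n). t < col_max m n \<omega> i} =
    ennreal (1 - (1 - (1 - t) ^ (m - 1)) ^ n)"
proof -
  interpret finite_measure "iid_columns m n" using assms by (intro finite_measure_columns) auto
  let ?A = "{x \<in> space (column_space m). coord m x i \<le> t}"
  have A: "?A \<in> sets (column_space m)" using assms by (intro sets_coord_single)
  have P: "Pi\<^sub>E {1..n} (\<lambda>_. ?A) \<in> sets (iid_columns m n)"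
    unfolding sets_columns using A by (intro sets_PiM_I_finite) auto
  have "t < col_max m n \<omega> i \<longleftrightarrow> (\<exists>j\<in>{1..n}. t < coord m (\<omega> j) i)" for \<omega>
    using assms(2) unfolding col_max_def by (subst Max_gr_iff) auto
  \<comment> \<open>The quantifier over the singleton gives the set the shape required by
    \<open>PiE_Collect_eq\<close>.\<close>
  then have "{\<omega> \<in> space (iid_columns m n). t < col_max m n \<omega> i} =
      space (iid_columns m n) - {\<omega> \<in> space (raw_columns m n). \<forall>i'\<in>{i}. \<forall>j\<in>{1..n}. coord m (\<omega> j) i' \<le> t}"
    by (auto simp: not_le)
  also have "{\<omega> \<in> space (raw_columns m n). \<forall>i'\<in>{i}. \<forall>j\<in>{1..n}. coord m (\<omega> j) i' \<le> t} = Pi\<^sub>E {1..n} (\<lambda>_. ?A)"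
    unfolding space_PiM[of "{1..n}"] by (subst PiE_Collect_eq) auto
  also have "emeasure (iid_columns m n) (space (iid_columns m n) - Pi\<^sub>E {1..n} (\<lambda>_. ?A)) =
      1 - emeasure (iid_columns m n) (Pi\<^sub>E {1..n} (\<lambda>_. ?A))"
    using P assms by (subst emeasure_compl) (auto simp: emeasure_columns_space simp del: space_columns)
  also have "emeasure (iid_columns m n) (Pi\<^sub>E {1..n} (\<lambda>_. ?A)) = ennreal (1 - (1 - t) ^ (m - 1)) ^ n"
    using assms A by (subst emeasure_columns_PiE) (auto simp: unif_simplex_coord_single_le)
  also have "1 - ennreal (1 - (1 - t) ^ (m - 1)) ^ n = ennreal 1 - ennreal ((1 - (1 - t) ^ (m - 1)) ^ n)"
    using assms by (subst ennreal_power) (auto simp: power_le_one)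
  also have "\<dots> = ennreal (1 - (1 - (1 - t) ^ (m - 1)) ^ n)"
    using assms by (intro ennreal_minus) (auto simp: power_le_one)
  finally show ?thesis .
qed

text \<open>The inner integral is \<open>- ln (1 - col_max)\<close>, read as infinity if \<open>col_max = 1\<close>.\<close>

lemma nn_integral_neg_ln_col_max:
  assumes "2 \<le> m" "1 \<le> n" "i \<in> {1..m}"
  shows "(\<integral>\<^sup>+\<omega>. (\<integral>\<^sup>+t\<in>{0..<1}. (if t < col_max m n \<omega> i then ennreal (1 / (1 - t)) else 0) \<partial>lborel) \<partial>iid_columns m n) =
    ennreal (harm n / (real m - 1))"
proof -
  have "sigma_finite_measure (iid_columns m n)"
    using assms by (intro finite_measure.axioms(1) finite_measure_columns) auto
  then have "(\<integral>\<^sup>+\<omega>. (\<integral>\<^sup>+t\<in>{0..<1}. (if t < col_max m n \<omega> i then ennreal (1 / (1 - t)) else 0) \<partial>lborel) \<partial>iid_columns m n) =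
      (\<integral>\<^sup>+t\<in>{0..<1}. ennreal (1 / (1 - t)) *
        emeasure (iid_columns m n) {\<omega> \<in> space (iid_columns m n). t < col_max m n \<omega> i} \<partial>lborel)"
    using measurable_col_max[OF assms(3)] by (intro nn_integral_layer_cake) auto
  \<comment> \<open>With u = (1-t)^(m-1) the tail 1 - (1-u)^n is u times a geometric sum, so the
    singular weight 1/(1-t) cancels. The r-th term then integrates to 1/((m-1)(r+1)), which produces
    the harmonic number.\<close>
  also have "\<dots> = (\<integral>\<^sup>+t\<in>{0..<1}. ennreal ((1 - t) ^ (m - 2) * (\<Sum>r<n. (1 - (1 - t) ^ (m - 1)) ^ r)) \<partial>lborel)"
  proof (intro nn_integral_cong)
    fix t :: real
    show "ennreal (1 / (1 - t)) * emeasure (iid_columns m n) {\<omega> \<in> space (iid_columns m n). t < col_max m n \<omega> i}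
        * indicator {0..<1} t =
      ennreal ((1 - t) ^ (m - 2) * (\<Sum>r<n. (1 - (1 - t) ^ (m - 1)) ^ r)) * indicator {0..<1} t"
    proof (cases "t \<in> {0..<1}")
      case True
      let ?S = "\<Sum>r<n. (1 - (1 - t) ^ (m - 1)) ^ r"
      have geo: "1 - (1 - (1 - t) ^ (m - 1)) ^ n = (1 - t) ^ (m - 1) * ?S"
        by (subst one_diff_power_eq) simp
      have "m - 1 = Suc (m - 2)" using assms by auto
      then have q: "1 / (1 - t) * (1 - t) ^ (m - 1) = (1 - t) ^ (m - 2)" using True by simp
      have "1 / (1 - t) * (1 - (1 - (1 - t) ^ (m - 1)) ^ n) = (1 - t) ^ (m - 2) * ?S"
        by (simp only: geo mult.assoc[symmetric] q)
      moreover have "emeasure (iid_columns m n) {\<omega> \<in> space (iid_columns m n). t < col_max m n \<omega> i} =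
          ennreal (1 - (1 - (1 - t) ^ (m - 1)) ^ n)"
        using True by (intro emeasure_col_max_gt assms) auto
      ultimately show ?thesis using True by (simp add: ennreal_mult'[symmetric] del: space_columns)
    qed simp
  qed
  also have "\<dots> = (\<integral>\<^sup>+t\<in>{0..1}. ennreal ((1 - t) ^ (m - 2) * (\<Sum>r<n. (1 - (1 - t) ^ (m - 1)) ^ r)) \<partial>lborel)"
    by (rule nn_integral_Ico_eq_Icc)
  also have "\<dots> = ennreal ((\<Sum>r<n. (1 - (1 - 1) ^ (m - 1)) ^ Suc r / ((real m - 1) * real (Suc r))) -
      (\<Sum>r<n. (1 - (1 - 0) ^ (m - 1)) ^ Suc r / ((real m - 1) * real (Suc r))))"
  proof (rule nn_integral_FTC_Icc)
    fix t :: real assume t: "t \<in> {0..1}"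
    have mm: "m - 1 - Suc 0 = m - 2" "real (m - 1) = real m - 1" using assms by auto
    have "((\<lambda>t. (1 - (1 - t) ^ (m - 1)) ^ Suc r / ((real m - 1) * real (Suc r))) has_real_derivative
        (1 - t) ^ (m - 2) * (1 - (1 - t) ^ (m - 1)) ^ r) (at t)" for r
    proof -
      have "((\<lambda>t. (1 - (1 - t) ^ (m - 1)) ^ Suc r) has_real_derivative
          real (Suc r) * (1 - (1 - t) ^ (m - 1)) ^ r * ((real m - 1) * (1 - t) ^ (m - 2))) (at t)"
        by (auto intro!: derivative_eq_intros simp: mm simp del: power_Suc)
      from DERIV_cdivide[OF this, of "(real m - 1) * real (Suc r)"]
      show ?thesis using assms by (simp add: mult_ac del: power_Suc of_nat_Suc)
    qed
    then show "((\<lambda>t. \<Sum>r<n. (1 - (1 - t) ^ (m - 1)) ^ Suc r / ((real m - 1) * real (Suc r))) has_real_derivative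
        (1 - t) ^ (m - 2) * (\<Sum>r<n. (1 - (1 - t) ^ (m - 1)) ^ r)) (at t)"
      unfolding sum_distrib_left by (intro DERIV_sum)
    show "0 \<le> (1 - t) ^ (m - 2) * (\<Sum>r<n. (1 - (1 - t) ^ (m - 1)) ^ r)"
      using t by (intro mult_nonneg_nonneg sum_nonneg zero_le_power) (auto simp: power_le_one)
  qed auto
  also have "(\<Sum>r<n. (1 - (1 - 1) ^ (m - 1)) ^ Suc r / ((real m - 1) * real (Suc r))) -
      (\<Sum>r<n. (1 - (1 - 0) ^ (m - 1)) ^ Suc r / ((real m - 1) * real (Suc r))) =
      (\<Sum>r<n. 1 / ((real m - 1) * real (Suc r)))"
    using assms by (simp add: power_0_left)
  also have "\<dots> = harm n / (real m - 1)"
    unfolding harm_altdef sum_divide_distrib by (intro sum.cong) (auto simp: divide_simps)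
  finally show ?thesis .
qed

text \<open>Separating s from M covers M = 1: the integral then exceeds -ln(1-s) for every s < 1, a
  finite substitute for an infinite logarithm.\<close>

lemma neg_ln_le_nn_integral:
  assumes "0 \<le> s" "s < 1" "s \<le> M"
  shows "ennreal (- ln (1 - s)) \<le> (\<integral>\<^sup>+t\<in>{0..<1}. (if t < M then ennreal (1 / (1 - t)) else 0) \<partial>lborel)"
proof -
  have "ennreal (- ln (1 - s) - - ln (1 - 0)) = (\<integral>\<^sup>+t\<in>{0..s}. ennreal (1 / (1 - t)) \<partial>lborel)"
  proof (rule nn_integral_FTC_Icc[symmetric])
    fix t assume "t \<in> {0..s}"
    then show "((\<lambda>t. - ln (1 - t)) has_real_derivative 1 / (1 - t)) (at t)" "0 \<le> 1 / (1 - t)"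
      using assms by (auto intro!: derivative_eq_intros)
  qed (use assms in auto)
  also have "\<dots> = (\<integral>\<^sup>+t\<in>{0..<s}. ennreal (1 / (1 - t)) \<partial>lborel)"
    by (rule nn_integral_Ico_eq_Icc[symmetric])
  also have "\<dots> \<le> (\<integral>\<^sup>+t\<in>{0..<1}. (if t < M then ennreal (1 / (1 - t)) else 0) \<partial>lborel)"
    using assms by (intro nn_integral_mono) (auto simp: indicator_def)
  finally show ?thesis by simp
qed

text \<open>Tangent line of \<open>exp\<close> at \<open>- c\<close>.\<close>

lemma exp_tangent_prod:
  fixes M :: "'a \<Rightarrow> real" and c :: real
  assumes "finite A" "A \<noteq> {}" "\<And>i. i \<in> A \<Longrightarrow> 0 \<le> M i \<and> M i \<le> 1" "0 \<le> c"
  defines "L \<equiv> (\<lambda>i. \<integral>\<^sup>+t\<in>{0..<1}. (if t < M i then ennreal (1 / (1 - t)) else 0) \<partial>lborel)"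
  shows "ennreal (exp (- c) * (1 + c)) \<le> (\<Prod>i\<in>A. ennreal (1 - M i)) + ennreal (exp (- c)) * (\<Sum>i\<in>A. L i)"
proof (cases "\<exists>i\<in>A. M i = 1")
  case True
  then obtain i where i: "i \<in> A" "M i = 1" by auto
  \<comment> \<open>The product may be 0 here, so one summand must carry the whole left side. The
    point s = 1 - exp(-(1+c)) is chosen to make -ln(1-s) equal to 1 + c.\<close>
  have "ennreal (- ln (1 - (1 - exp (- (1 + c))))) \<le> L i"
    unfolding L_def using i assms(4) by (intro neg_ln_le_nn_integral) auto
  then have "ennreal (1 + c) \<le> L i" by (simp add: add.commute)
  also have "\<dots> \<le> (\<Sum>i\<in>A. L i)" using i assms(1) by (intro member_le_sum) auto
  finally have "ennreal (exp (- c)) * ennreal (1 + c) \<le> ennreal (exp (- c)) * (\<Sum>i\<in>A. L i)"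
    by (intro mult_left_mono) auto
  then have "ennreal (exp (- c) * (1 + c)) \<le> ennreal (exp (- c)) * (\<Sum>i\<in>A. L i)"
    using assms(4) by (subst ennreal_mult) auto
  then show ?thesis by (rule order_trans) simp
next
  case False
  then have M: "0 \<le> M i" "M i < 1" if "i \<in> A" for i using assms(3)[OF that] that by (auto simp: less_le)
  define s where "s = (\<Sum>i\<in>A. - ln (1 - M i))"
  have nn: "0 \<le> - ln (1 - M i)" if "i \<in> A" for i using M[OF that] by simp
  have "(\<Prod>i\<in>A. ennreal (1 - M i)) = ennreal (\<Prod>i\<in>A. 1 - M i)"
    using assms(3) by (intro prod_ennreal) auto
  also have "(\<Prod>i\<in>A. 1 - M i) = exp (- s)"
    using M assms(1) by (simp add: s_def sum_negf exp_sum)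
  finally have P: "(\<Prod>i\<in>A. ennreal (1 - M i)) = ennreal (exp (- s))" .
  have "ennreal s = (\<Sum>i\<in>A. ennreal (- ln (1 - M i)))"
    unfolding s_def using nn by (intro sum_ennreal[symmetric]) auto
  also have "\<dots> \<le> (\<Sum>i\<in>A. L i)" unfolding L_def using M by (intro sum_mono neg_ln_le_nn_integral) auto
  finally have S: "ennreal s \<le> (\<Sum>i\<in>A. L i)" .
  have s: "0 \<le> s" unfolding s_def by (intro sum_nonneg nn)
  have "exp (- c) * (1 + (c - s)) \<le> exp (- c) * exp (c - s)"
    by (intro mult_left_mono exp_ge_add_one_self) auto
  also have "\<dots> = exp (- s)" by (simp add: exp_add[symmetric])
  finally have "exp (- c) * (1 + c) \<le> exp (- s) + exp (- c) * s" by (simp add: algebra_simps)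
  then have "ennreal (exp (- c) * (1 + c)) \<le> ennreal (exp (- s) + exp (- c) * s)" by (rule ennreal_leI)
  also have "\<dots> = ennreal (exp (- s)) + ennreal (exp (- c)) * ennreal s"
    using s by (subst ennreal_plus) (auto simp: ennreal_mult)
  also have "\<dots> \<le> (\<Prod>i\<in>A. ennreal (1 - M i)) + ennreal (exp (- c)) * (\<Sum>i\<in>A. L i)"
    unfolding P by (intro add_left_mono mult_left_mono S) auto
  finally show ?thesis .
qed

lemma AE_columns_coord:
  assumes "1 \<le> m"
  shows "AE \<omega> in iid_columns m n. \<forall>i\<in>{1..m}. \<forall>j\<in>{1..n}. 0 \<le> coord m (\<omega> j) i \<and> coord m (\<omega> j) i \<le> 1"
  using AE_columns[OF assms]
proof (eventually_elim, intro ballI)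
  fix \<omega> i j assume *: "\<forall>j\<in>{1..n}. \<omega> j \<in> std_simplex m" "i \<in> {1..m}" "j \<in> {1..n}"
  then have "\<omega> j \<in> std_simplex m" by blast
  with *(2) show "0 \<le> coord m (\<omega> j) i \<and> coord m (\<omega> j) i \<le> 1"
    using std_simplex_coord_le_1[of "\<omega> j" m i] by (auto simp: std_simplex_def)
qed

text \<open>Jensen's inequality, carried out through the tangent line. The point of tangency c is
  the mean of the sum of the logarithms, so after integration the terms exp(-c) c cancel and exp(-c)
  remains.\<close>

lemma V_P_ge_exp:
  assumes "2 \<le> m" "1 \<le> n"
  shows "exp (- (real m / (real m - 1) * harm n)) \<le> fact (m - 1) ^ n * V_P m n"
proof -
  interpret caps: sigma_finite_measure "caps m" by (rule sigma_finite_caps)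
  interpret Om: finite_measure "iid_columns m n" using assms by (intro finite_measure_columns) auto
  define c where "c = real m / (real m - 1) * harm n"
  have c: "0 \<le> c" using assms harm_nonneg[of n, where 'a = real] by (simp add: c_def)
  define L where "L \<omega> i = (\<integral>\<^sup>+t\<in>{0..<1}. (if t < col_max m n \<omega> i then ennreal (1 / (1 - t)) else 0) \<partial>lborel)" for \<omega> i
  define V where "V = fact (m - 1) ^ n * V_P m n"
  have V: "0 \<le> V" using V_P_nonneg by (simp add: V_def)
  let ?F = "\<lambda>\<omega>. emeasure (caps m) (Pair \<omega> -` strong_set m n)"
  have [measurable]: "?F \<in> borel_measurable (iid_columns m n)"
    by (rule caps.measurable_emeasure_Pair[OF sets_strong_set])
  have Lm: "(\<lambda>\<omega>. L \<omega> i) \<in> borel_measurable (iid_columns m n)" if "i \<in> {1..m}" for i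
  proof -
    note [measurable] = measurable_col_max[OF that]
    show ?thesis unfolding L_def by measurable
  qed
  have F: "?F \<omega> = (\<Prod>i\<in>{1..m}. ennreal (1 - col_max m n \<omega> i))" if \<omega>: "\<omega> \<in> space (iid_columns m n)" for \<omega>
  proof -
    have "col_max m n \<omega> i \<le> u \<longleftrightarrow> (\<forall>j\<in>{1..n}. coord m (\<omega> j) i \<le> u)" for i u
      using assms(2) unfolding col_max_def by (subst Max_le_iff) auto
    then have "Pair \<omega> -` strong_set m n = {y \<in> space (caps m). \<forall>i\<in>{1..m}. col_max m n \<omega> i \<le> y i \<and> y i \<le> 1}"
      using \<omega> by (auto simp: strong_set_def space_pair_measure)
    then show ?thesis by (simp only: emeasure_caps_box)
  qed
  have "ennreal (exp (- c) * (1 + c)) = (\<integral>\<^sup>+\<omega>. ennreal (exp (- c) * (1 + c)) \<partial>iid_columns m n)"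
    using assms emeasure_columns_space[of m n] by simp
  also have "\<dots> \<le> (\<integral>\<^sup>+\<omega>. ?F \<omega> + ennreal (exp (- c)) * (\<Sum>i\<in>{1..m}. L \<omega> i) \<partial>iid_columns m n)"
  proof (rule nn_integral_mono_AE)
    have "AE \<omega> in iid_columns m n. \<forall>i\<in>{1..m}. \<forall>j\<in>{1..n}. 0 \<le> coord m (\<omega> j) i \<and> coord m (\<omega> j) i \<le> 1"
      using assms by (intro AE_columns_coord) auto
    with AE_space show "AE \<omega> in iid_columns m n. ennreal (exp (- c) * (1 + c)) \<le>
        ?F \<omega> + ennreal (exp (- c)) * (\<Sum>i\<in>{1..m}. L \<omega> i)"
    proof eventually_elim
      case (elim \<omega>)
      have "0 \<le> col_max m n \<omega> i \<and> col_max m n \<omega> i \<le> 1" if "i \<in> {1..m}" for i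
      proof -
        have "col_max m n \<omega> i \<in> (\<lambda>j. coord m (\<omega> j) i) ` {1..n}"
          unfolding col_max_def using assms(2) by (intro Max_in) auto
        then show ?thesis using elim(2) that by auto
      qed
      then show ?case unfolding F[OF elim(1)] L_def using assms c by (intro exp_tangent_prod) auto
    qed
  qed
  also have "\<dots> = (\<integral>\<^sup>+\<omega>. ?F \<omega> \<partial>iid_columns m n) +
      ennreal (exp (- c)) * (\<Sum>i\<in>{1..m}. \<integral>\<^sup>+\<omega>. L \<omega> i \<partial>iid_columns m n)"
  proof -
    have "(\<lambda>\<omega>. \<Sum>i\<in>{1..m}. L \<omega> i) \<in> borel_measurable (iid_columns m n)"
      by (intro borel_measurable_sum Lm)
    then show ?thesis
      by (subst nn_integral_add, simp, simp, subst nn_integral_cmult, simp,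
          subst nn_integral_sum[symmetric], use Lm in auto)
  qed
  also have "(\<integral>\<^sup>+\<omega>. ?F \<omega> \<partial>iid_columns m n) = ennreal V"
    unfolding V_def emeasure_strong_set_eq_ennreal[OF assms, symmetric]
    by (rule caps.emeasure_pair_measure_alt[OF sets_strong_set, symmetric])
  also have "(\<Sum>i\<in>{1..m}. \<integral>\<^sup>+\<omega>. L \<omega> i \<partial>iid_columns m n) = (\<Sum>i\<in>{1..m}. ennreal (harm n / (real m - 1)))"
    unfolding L_def by (intro sum.cong refl nn_integral_neg_ln_col_max assms)
  also have "\<dots> = ennreal (\<Sum>i\<in>{1..m}. harm n / (real m - 1))"
    using assms harm_nonneg[of n, where 'a = real] by (intro sum_ennreal) auto
  also have "(\<Sum>i\<in>{1..m}. harm n / (real m - 1)) = c" by (simp add: c_def)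
  also have "ennreal V + ennreal (exp (- c)) * ennreal c = ennreal (V + exp (- c) * c)"
    using c V by (subst ennreal_plus) (auto simp: ennreal_mult)
  finally have "exp (- c) * (1 + c) \<le> V + exp (- c) * c"
    using c V by (subst (asm) ennreal_le_iff) auto
  then show ?thesis by (simp add: V_def c_def algebra_simps)
qed

section \<open>Weak relaxation\<close>

lemma nn_integral_coord_power:
  assumes "2 \<le> m" "i \<in> {1..m}"
  shows "(\<integral>\<^sup>+x. ennreal (coord m x i) \<partial>unif_simplex m) = ennreal (1 / real m)"
    "(\<integral>\<^sup>+x. ennreal ((coord m x i)\<^sup>2) \<partial>unif_simplex m) = ennreal (2 / (real m * (real m + 1)))"
proof -
  have sf: "sigma_finite_measure (unif_simplex m)"
    using assms by (intro finite_measure.axioms(1) finite_measure_unif_simplex) auto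
  have meas: "(\<lambda>x. coord m x i) \<in> borel_measurable (unif_simplex m)"
    using measurable_coord[OF assms(2)] by simp
  have AE01: "AE x in unif_simplex m. 0 \<le> coord m x i \<and> coord m x i \<le> 1"
    using AE_unif_simplex by eventually_elim
      (use assms in \<open>auto simp: std_simplex_def intro: std_simplex_coord_le_1[unfolded std_simplex_def]\<close>)
  \<comment> \<open>The layer-cake formula with the tail (1-t)^(m-1) of one coordinate;
    \<open>W\<close> is the primitive of \<open>w\<close> and is taken to be c, then c^2.\<close>
  have layer: "(\<integral>\<^sup>+x. ennreal (W (coord m x i)) \<partial>unif_simplex m) =
      (\<integral>\<^sup>+t\<in>{0..1}. ennreal (w t * (1 - t) ^ (m - 1)) \<partial>lborel)"
    if w: "w \<in> borel_measurable borel" "\<And>t. 0 \<le> t \<Longrightarrow> 0 \<le> w t"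
      and W: "\<And>c. 0 \<le> c \<Longrightarrow> (\<integral>\<^sup>+t\<in>{0..c}. ennreal (w t) \<partial>lborel) = ennreal (W c)" for w W :: "real \<Rightarrow> real"
  proof -
    have "(\<integral>\<^sup>+x. ennreal (W (coord m x i)) \<partial>unif_simplex m) =
        (\<integral>\<^sup>+x. (\<integral>\<^sup>+t\<in>{0..<1}. (if t < coord m x i then ennreal (w t) else 0) \<partial>lborel) \<partial>unif_simplex m)"
    proof (rule nn_integral_cong_AE, use AE01 in eventually_elim)
      case (elim x)
      have "ennreal (W (coord m x i)) = (\<integral>\<^sup>+t\<in>{0..<coord m x i}. ennreal (w t) \<partial>lborel)"
        using elim by (simp add: W[symmetric] nn_integral_Ico_eq_Icc)
      also have "\<dots> = (\<integral>\<^sup>+t\<in>{0..<1}. (if t < coord m x i then ennreal (w t) else 0) \<partial>lborel)"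
        using elim by (intro nn_integral_cong) (auto simp: indicator_def)
      finally show ?case .
    qed
    also have "\<dots> = (\<integral>\<^sup>+t\<in>{0..<1}. ennreal (w t) * emeasure (unif_simplex m) {x \<in> space (unif_simplex m). t < coord m x i} \<partial>lborel)"
      using w by (intro nn_integral_layer_cake sf meas) auto
    also have "\<dots> = (\<integral>\<^sup>+t\<in>{0..<1}. ennreal (w t * (1 - t) ^ (m - 1)) \<partial>lborel)"
      using w(2) by (intro nn_integral_cong)
        (auto simp: indicator_def unif_simplex_coord_single_gt[OF assms] ennreal_mult)
    finally show ?thesis by (simp add: nn_integral_Ico_eq_Icc)
  qed
  have "(\<integral>\<^sup>+x. ennreal (coord m x i) \<partial>unif_simplex m) = (\<integral>\<^sup>+t\<in>{0..1}. ennreal (1 * (1 - t) ^ (m - 1)) \<partial>lborel)"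
    by (rule layer[where W = "\<lambda>c. c"]) auto
  also have "\<dots> = ennreal (1 / real m)"
    using nn_integral_one_minus_power[of 0 1 "m - 1"] assms by (simp add: power_0_left)
  finally show "(\<integral>\<^sup>+x. ennreal (coord m x i) \<partial>unif_simplex m) = ennreal (1 / real m)" .
  have "(\<integral>\<^sup>+x. ennreal ((coord m x i)\<^sup>2) \<partial>unif_simplex m) = (\<integral>\<^sup>+t\<in>{0..1}. ennreal (2 * t * (1 - t) ^ (m - 1)) \<partial>lborel)"
  proof (rule layer[where W = "\<lambda>c. c\<^sup>2"])
    fix c :: real assume c: "0 \<le> c"
    have "(\<integral>\<^sup>+t\<in>{0..c}. ennreal (2 * t) \<partial>lborel) = ennreal (c\<^sup>2 - 0\<^sup>2)"
      by (rule nn_integral_FTC_Icc) (use c in \<open>auto intro!: derivative_eq_intros\<close>)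
    then show "(\<integral>\<^sup>+t\<in>{0..c}. ennreal (2 * t) \<partial>lborel) = ennreal (c\<^sup>2)" by simp
  qed auto
  also have "\<dots> = ennreal (2 / (real m * (real m + 1)))"
  proof -
    obtain p where p: "m = Suc p" "1 \<le> p" using assms by (cases m) auto
    \<comment> \<open>A primitive read off from 2t(1-t)^p = 2(1-t)^p - 2(1-t)^(p+1).\<close>
    let ?G = "\<lambda>t. 2 * (1 - t) ^ Suc (Suc p) / real (Suc (Suc p)) - 2 * (1 - t) ^ Suc p / real (Suc p)"
    have "(\<integral>\<^sup>+t\<in>{0..1}. ennreal (2 * t * (1 - t) ^ p) \<partial>lborel) = ennreal (?G 1 - ?G 0)"
    proof (rule nn_integral_FTC_Icc)
      fix t :: real assume t: "t \<in> {0..1}"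
      have pw: "((\<lambda>t. (1 - t) ^ Suc q) has_real_derivative - (real (Suc q) * (1 - t) ^ q)) (at t)" for q
        by (auto intro!: derivative_eq_intros simp del: power_Suc)
      have G: "((\<lambda>t. 2 * (1 - t) ^ Suc q / real (Suc q)) has_real_derivative - (2 * (1 - t) ^ q)) (at t)" for q
        using DERIV_cdivide[OF DERIV_cmult[OF pw[of q], of 2], of "real (Suc q)"]
        by (simp add: divide_simps del: power_Suc of_nat_Suc)
      have "(?G has_real_derivative (- (2 * (1 - t) ^ Suc p) - - (2 * (1 - t) ^ p))) (at t)"
        by (intro DERIV_diff G)
      then show "(?G has_real_derivative 2 * t * (1 - t) ^ p) (at t)" by (simp add: algebra_simps)
      show "0 \<le> 2 * t * (1 - t) ^ p" using t by auto
    qed auto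
    also have "?G 1 - ?G 0 = 2 / (real m * (real m + 1))"
      by (simp add: p divide_simps)
    finally show ?thesis by (simp add: p)
  qed
  finally show "(\<integral>\<^sup>+x. ennreal ((coord m x i)\<^sup>2) \<partial>unif_simplex m) = ennreal (2 / (real m * (real m + 1)))" .
qed

section \<open>Moments of one coordinate and the variance of row sums\<close>

lemma coord_moments:
  assumes "2 \<le> m" "i \<in> {1..m}"
  shows "integrable (unif_simplex m) (\<lambda>x. coord m x i)" "integrable (unif_simplex m) (\<lambda>x. (coord m x i)\<^sup>2)"
    "(\<integral>x. coord m x i \<partial>unif_simplex m) = 1 / real m"
    "(\<integral>x. (coord m x i)\<^sup>2 \<partial>unif_simplex m) = 2 / (real m * (real m + 1))"
proof -
  have meas[measurable]: "(\<lambda>x. coord m x i) \<in> borel_measurable (unif_simplex m)"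
    using measurable_coord[OF assms(2)] by simp
  have AE0: "AE x in unif_simplex m. 0 \<le> coord m x i"
    using AE_unif_simplex by eventually_elim (use assms in \<open>auto simp: std_simplex_def\<close>)
  show "integrable (unif_simplex m) (\<lambda>x. coord m x i)"
    using nn_integral_coord_power(1)[OF assms] AE0 by (intro integrableI_nonneg) auto
  show "integrable (unif_simplex m) (\<lambda>x. (coord m x i)\<^sup>2)"
    using nn_integral_coord_power(2)[OF assms] by (intro integrableI_nonneg) auto
  show "(\<integral>x. coord m x i \<partial>unif_simplex m) = 1 / real m"
    using AE0 by (subst integral_eq_nn_integral) (auto simp: nn_integral_coord_power[OF assms])
  show "(\<integral>x. (coord m x i)\<^sup>2 \<partial>unif_simplex m) = 2 / (real m * (real m + 1))"
    by (subst integral_eq_nn_integral) (auto simp: nn_integral_coord_power[OF assms])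
qed

lemma centered_coord_moments:
  assumes "2 \<le> m" "i \<in> {1..m}"
  defines "f \<equiv> (\<lambda>x. coord m x i - 1 / real m)"
  shows "integrable (unif_simplex m) f" "integrable (unif_simplex m) (\<lambda>x. (f x)\<^sup>2)"
    "(\<integral>x. f x \<partial>unif_simplex m) = 0"
    "(\<integral>x. (f x)\<^sup>2 \<partial>unif_simplex m) = (real m - 1) / ((real m)\<^sup>2 * (real m + 1))"
proof -
  interpret finite_measure "unif_simplex m" using assms by (intro finite_measure_unif_simplex) auto
  have one: "measure (unif_simplex m) (space (unif_simplex m)) = 1"
    using assms by (simp add: measure_def emeasure_unif_simplex_space del: space_unif_simplex)
  note I = coord_moments[OF assms(1,2)]
  have sq: "(f x)\<^sup>2 = (coord m x i)\<^sup>2 - 2 / real m * coord m x i + 1 / (real m)\<^sup>2" for x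
    by (simp add: f_def power2_diff power_divide)
  show "integrable (unif_simplex m) f" unfolding f_def using I by simp
  show "integrable (unif_simplex m) (\<lambda>x. (f x)\<^sup>2)" unfolding sq using I by simp
  show "(\<integral>x. f x \<partial>unif_simplex m) = 0"
    unfolding f_def using I one by simp
  have "(\<integral>x. (f x)\<^sup>2 \<partial>unif_simplex m) = 2 / (real m * (real m + 1)) - 2 / real m * (1 / real m) + 1 / (real m)\<^sup>2"
    unfolding sq using I one by simp
  also have "\<dots> = (real m - 1) / ((real m)\<^sup>2 * (real m + 1))"
    using assms(1) by (simp add: divide_simps power2_eq_square)
  finally show "(\<integral>x. (f x)\<^sup>2 \<partial>unif_simplex m) = (real m - 1) / ((real m)\<^sup>2 * (real m + 1))" .
qed

lemma variance_column_sum: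
  fixes f :: "(nat \<Rightarrow> real) \<Rightarrow> real"
  assumes m: "1 \<le> m" and f: "integrable (unif_simplex m) f" "integrable (unif_simplex m) (\<lambda>x. (f x)\<^sup>2)"
    "(\<integral>x. f x \<partial>unif_simplex m) = 0"
  shows "integrable (iid_columns m n) (\<lambda>\<omega>. (\<Sum>j\<in>{1..n}. f (\<omega> j))\<^sup>2)"
    "(\<integral>\<omega>. (\<Sum>j\<in>{1..n}. f (\<omega> j))\<^sup>2 \<partial>iid_columns m n) = real n * (\<integral>x. (f x)\<^sup>2 \<partial>unif_simplex m)"
proof -
  interpret product_sigma_finite "\<lambda>_::nat. unif_simplex m" using m by (rule product_sigma_finite_unif_simplex)
  interpret finite_measure "unif_simplex m" using m by (rule finite_measure_unif_simplex)
  have one: "measure (unif_simplex m) (space (unif_simplex m)) = 1"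
    using m by (simp add: measure_def emeasure_unif_simplex_space del: space_unif_simplex)
  \<comment> \<open>Writes f(\<omega> j) f(\<omega> l) as a product over all columns, with factor 1
    off j and l, so that expectations of products over columns apply. For j = l the factor is f^2;
    for j \<noteq> l the centered factor at j annihilates the term.\<close>
  define g where "g j l r = (\<lambda>x. (if r = j then f x else 1) * (if r = l then f x else 1))" for j l r :: nat
  have g: "integrable (unif_simplex m) (g j l r)" for j l r
    unfolding g_def using f by (cases "r = j"; cases "r = l") (auto simp: power2_eq_square)
  have eq: "(\<Sum>j\<in>{1..n}. f (\<omega> j))\<^sup>2 = (\<Sum>j\<in>{1..n}. \<Sum>l\<in>{1..n}. \<Prod>r\<in>{1..n}. g j l r (\<omega> r))" for \<omega>
    unfolding power2_eq_square sum_product g_def prod.distrib by (intro sum.cong refl) (simp add: prod.delta)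
  have int: "integrable (iid_columns m n) (\<lambda>\<omega>. \<Prod>r\<in>{1..n}. g j l r (\<omega> r))" for j l
    unfolding iid_columns_def by (intro product_integrable_prod g) auto
  have val: "(\<integral>\<omega>. (\<Prod>r\<in>{1..n}. g j l r (\<omega> r)) \<partial>iid_columns m n) =
      (if j = l then \<integral>x. (f x)\<^sup>2 \<partial>unif_simplex m else 0)" if "j \<in> {1..n}" "l \<in> {1..n}" for j l
  proof -
    have "(\<integral>\<omega>. (\<Prod>r\<in>{1..n}. g j l r (\<omega> r)) \<partial>iid_columns m n) = (\<Prod>r\<in>{1..n}. \<integral>x. g j l r x \<partial>unif_simplex m)"
      unfolding iid_columns_def by (intro product_integral_prod g) auto
    also have "\<dots> = (if j = l then \<integral>x. (f x)\<^sup>2 \<partial>unif_simplex m else 0)"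
    proof (cases "j = l")
      case True
      have "(\<Prod>r\<in>{1..n}. \<integral>x. g j l r x \<partial>unif_simplex m) =
          (\<Prod>r\<in>{1..n}. if r = j then \<integral>x. (f x)\<^sup>2 \<partial>unif_simplex m else 1)"
        using one True by (intro prod.cong) (auto simp: g_def power2_eq_square)
      then show ?thesis using True that by simp
    next
      case False
      have "(\<integral>x. g j l j x \<partial>unif_simplex m) = 0" using False f(3) by (simp add: g_def)
      then show ?thesis using False that by (auto intro!: prod_zero)
    qed
    finally show ?thesis .
  qed
  show "integrable (iid_columns m n) (\<lambda>\<omega>. (\<Sum>j\<in>{1..n}. f (\<omega> j))\<^sup>2)"
    unfolding eq by (intro Bochner_Integration.integrable_sum int)
  have "(\<integral>\<omega>. (\<Sum>j\<in>{1..n}. f (\<omega> j))\<^sup>2 \<partial>iid_columns m n) =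
      (\<Sum>j\<in>{1..n}. \<Sum>l\<in>{1..n}. \<integral>\<omega>. (\<Prod>r\<in>{1..n}. g j l r (\<omega> r)) \<partial>iid_columns m n)"
    unfolding eq using int by (simp add: Bochner_Integration.integral_sum)
  also have "\<dots> = (\<Sum>j\<in>{1..n}. \<Sum>l\<in>{1..n}. if j = l then \<integral>x. (f x)\<^sup>2 \<partial>unif_simplex m else 0)"
    by (intro sum.cong refl val)
  also have "\<dots> = real n * (\<integral>x. (f x)\<^sup>2 \<partial>unif_simplex m)" by simp
  finally show "(\<integral>\<omega>. (\<Sum>j\<in>{1..n}. f (\<omega> j))\<^sup>2 \<partial>iid_columns m n) = real n * (\<integral>x. (f x)\<^sup>2 \<partial>unif_simplex m)" .
qed

section \<open>Products of factors with mean 1\<close>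

lemma prod_one_plus_le_1:
  fixes u :: "'a \<Rightarrow> real"
  assumes "finite A" "\<And>i. i \<in> A \<Longrightarrow> - 1 \<le> u i" "(\<Sum>i\<in>A. u i) = 0"
  shows "(\<Prod>i\<in>A. 1 + u i) \<le> 1"
proof -
  have "(\<Prod>i\<in>A. 1 + u i) \<le> (\<Prod>i\<in>A. exp (u i))"
    using assms(2) by (intro prod_mono conjI exp_ge_add_one_self) (use add_mono[of 1 1 "- 1"] in force)
  also have "\<dots> = 1" using assms(1,3) by (simp add: exp_sum[symmetric])
  finally show ?thesis .
qed

text \<open>If all u_i >= -1/2, then ln(1+u) >= u - 2u^2; the linear terms sum to 0, so the product
  is at least exp of -2 times the sum of squares. Otherwise some square exceeds 1/4, and the
  constant 4 makes the left side nonpositive.\<close>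

lemma prod_one_plus_ge:
  fixes u :: "'a \<Rightarrow> real"
  assumes "finite A" "\<And>i. i \<in> A \<Longrightarrow> - 1 \<le> u i" "(\<Sum>i\<in>A. u i) = 0"
  shows "1 - 4 * (\<Sum>i\<in>A. (u i)\<^sup>2) \<le> (\<Prod>i\<in>A. 1 + u i)"
proof (cases "\<forall>i\<in>A. - (1/2) \<le> u i")
  case True
  have "1 - 4 * (\<Sum>i\<in>A. (u i)\<^sup>2) \<le> 1 + - 2 * (\<Sum>i\<in>A. (u i)\<^sup>2)" by (simp add: sum_nonneg)
  also have "\<dots> \<le> exp (- 2 * (\<Sum>i\<in>A. (u i)\<^sup>2))" by (rule exp_ge_add_one_self)
  also have "- 2 * (\<Sum>i\<in>A. (u i)\<^sup>2) = (\<Sum>i\<in>A. u i - 2 * (u i)\<^sup>2)"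
    using assms(3) by (simp add: sum_subtractf sum_distrib_left sum_negf)
  also have "exp (\<Sum>i\<in>A. u i - 2 * (u i)\<^sup>2) = (\<Prod>i\<in>A. exp (u i - 2 * (u i)\<^sup>2))"
    using assms(1) by (rule exp_sum)
  also have "\<dots> \<le> (\<Prod>i\<in>A. 1 + u i)"
  proof (intro prod_mono conjI)
    fix i assume i: "i \<in> A"
    have h: "- (1/2) \<le> u i" using True i by auto
    have "u i - 2 * (u i)\<^sup>2 \<le> ln (1 + u i)"
    proof (cases "0 \<le> u i")
      case True
      have "u i - 2 * (u i)\<^sup>2 \<le> u i - (u i)\<^sup>2 / 2" by simp
      then show ?thesis using ln_one_plus_ge[OF True] by linarith
    next
      case False
      then show ?thesis using ln_one_minus_pos_lower_bound[of "- u i"] h by simp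
    qed
    then show "exp (u i - 2 * (u i)\<^sup>2) \<le> 1 + u i"
      using h by (subst (asm) ln_ge_iff) auto
  qed simp
  finally show ?thesis .
next
  case False
  then obtain i where i: "i \<in> A" "u i < - (1/2)" by (auto simp: not_le)
  have "(1/2)\<^sup>2 \<le> (- u i)\<^sup>2" using i by (intro power_mono) auto
  also have "(- u i)\<^sup>2 \<le> (\<Sum>i\<in>A. (u i)\<^sup>2)" using member_le_sum[OF i(1), of "\<lambda>i. (u i)\<^sup>2"] assms(1) by simp
  finally have "1 - 4 * (\<Sum>i\<in>A. (u i)\<^sup>2) \<le> 0" by (simp add: power2_eq_square)
  also have "0 \<le> (\<Prod>i\<in>A. 1 + u i)" using assms(2) by (intro prod_nonneg) (use add_mono[of 1 1 "- 1"] in force)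
  finally show ?thesis .
qed

lemma emeasure_weak_set:
  assumes "1 \<le> m" "1 \<le> n"
  shows "emeasure (iid_columns m n \<Otimes>\<^sub>M caps m) (weak_set m n) =
    (\<integral>\<^sup>+\<omega>. (\<Prod>i\<in>{1..m}. ennreal (1 - (\<Sum>j\<in>{1..n}. coord m (\<omega> j) i) / real n)) \<partial>iid_columns m n)"
proof -
  interpret caps: sigma_finite_measure "caps m" by (rule sigma_finite_caps)
  have "emeasure (iid_columns m n \<Otimes>\<^sub>M caps m) (weak_set m n) =
      (\<integral>\<^sup>+\<omega>. emeasure (caps m) (Pair \<omega> -` weak_set m n) \<partial>iid_columns m n)"
    by (rule caps.emeasure_pair_measure_alt[OF sets_weak_set])
  also have "\<dots> = (\<integral>\<^sup>+\<omega>. (\<Prod>i\<in>{1..m}. ennreal (1 - (\<Sum>j\<in>{1..n}. coord m (\<omega> j) i) / real n)) \<partial>iid_columns m n)"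
  proof (intro nn_integral_cong)
    fix \<omega> assume \<omega>: "\<omega> \<in> space (iid_columns m n)"
    have "Pair \<omega> -` weak_set m n = {y \<in> space (caps m). \<forall>i\<in>{1..m}.
        (\<Sum>j\<in>{1..n}. coord m (\<omega> j) i) / real n \<le> y i \<and> y i \<le> 1}"
      using \<omega> assms by (auto simp: weak_set_def space_pair_measure divide_le_eq mult.commute)
    then show "emeasure (caps m) (Pair \<omega> -` weak_set m n) =
        (\<Prod>i\<in>{1..m}. ennreal (1 - (\<Sum>j\<in>{1..n}. coord m (\<omega> j) i) / real n))"
      by (simp only: emeasure_caps_box)
  qed
  finally show ?thesis .
qed

text \<open>The upper bound is AM-GM. In the lower one, the mean of the sum of squared relative
  deviations is m/((m^2-1) n), since the variance of a row sum is n times that of one coordinate;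
  the factor 4 comes from \<open>prod_one_plus_ge\<close>.\<close>

lemma V_Q_bounds:
  assumes "2 \<le> m" "1 \<le> n"
  shows "fact (m - 1) ^ n * V_Q m n \<le> (1 - 1 / real m) ^ m"
    "(1 - 1 / real m) ^ m * (1 - 4 * real m / (((real m)\<^sup>2 - 1) * real n)) \<le> fact (m - 1) ^ n * V_Q m n"
proof -
  interpret Om: finite_measure "iid_columns m n" using assms by (intro finite_measure_columns) auto
  define q where "q = 1 - 1 / real m"
  have q: "0 < q" "q * real m = real m - 1" using assms by (auto simp: q_def field_simps)
  define f where "f i x = coord m x i - 1 / real m" for i x
  define s where "s i \<omega> = (\<Sum>j\<in>{1..n}. f i (\<omega> j))" for i \<omega>
  define F where "F \<omega> = (\<Prod>i\<in>{1..m}. ennreal (1 - (\<Sum>j\<in>{1..n}. coord m (\<omega> j) i) / real n))" for \<omega>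
  define W where "W = fact (m - 1) ^ n * V_Q m n"
  \<comment> \<open>The relative deviation: with a_i the row mean, 1 - a_i = q (1 + u_i), and the
    u_i sum to 0 because the a_i sum to 1.\<close>
  define u where "u \<omega> i = - (s i \<omega> / (real n * q))" for \<omega> i
  have total: "emeasure (iid_columns m n) (space (iid_columns m n)) = 1"
    using assms by (intro emeasure_columns_space) auto
  have Fm[measurable]: "F \<in> borel_measurable (iid_columns m n)"
    unfolding F_def[abs_def] by (intro borel_measurable_prod_ennreal measurable_compose[OF _ measurable_ennreal]
      borel_measurable_diff borel_measurable_divide borel_measurable_sum measurable_coord_columns) auto
  have sc: "1 - (\<Sum>j\<in>{1..n}. coord m (\<omega> j) i) / real n = q * (1 + u \<omega> i)" for \<omega> i
  proof -
    have "s i \<omega> = (\<Sum>j\<in>{1..n}. coord m (\<omega> j) i) - real n / real m"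
      by (simp add: s_def f_def sum_subtractf)
    moreover have "q * u \<omega> i = - (s i \<omega> / real n)" using q by (simp add: u_def)
    ultimately show ?thesis using assms by (simp add: distrib_left q_def diff_divide_distrib)
  qed
  have key: "AE \<omega> in iid_columns m n. F \<omega> = ennreal (q ^ m * (\<Prod>i\<in>{1..m}. 1 + u \<omega> i)) \<and>
      (\<forall>i\<in>{1..m}. - 1 \<le> u \<omega> i) \<and> (\<Sum>i\<in>{1..m}. u \<omega> i) = 0"
    using AE_columns_coord[OF order_trans[OF one_le_numeral assms(1)], of n]
  proof eventually_elim
    case (elim \<omega>)
    have "(\<Sum>i\<in>{1..m}. s i \<omega>) = (\<Sum>j\<in>{1..n}. \<Sum>i\<in>{1..m}. f i (\<omega> j))"
      unfolding s_def by (rule sum.swap)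
    also have "\<dots> = 0" using assms by (simp add: f_def sum_subtractf sum_coord)
    finally have sum0: "(\<Sum>i\<in>{1..m}. u \<omega> i) = 0"
      by (simp add: u_def sum_negf sum_divide_distrib[symmetric])
    have ge: "0 \<le> q * (1 + u \<omega> i)" if "i \<in> {1..m}" for i
    proof -
      have "(\<Sum>j\<in>{1..n}. coord m (\<omega> j) i) \<le> (\<Sum>j\<in>{1..n}. 1)" using elim that by (intro sum_mono) auto
      then show ?thesis unfolding sc[symmetric] using assms by (simp add: divide_le_eq)
    qed
    have "F \<omega> = ennreal (\<Prod>i\<in>{1..m}. q * (1 + u \<omega> i))"
      unfolding F_def sc using ge by (intro prod_ennreal) auto
    then have "F \<omega> = ennreal (q ^ m * (\<Prod>i\<in>{1..m}. 1 + u \<omega> i))" by (simp add: prod.distrib)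
    moreover have "- 1 \<le> u \<omega> i" if "i \<in> {1..m}" for i
      using ge[OF that] q(1) by (simp add: zero_le_mult_iff)
    ultimately show ?case using sum0 by blast
  qed
  have eF: "emeasure (iid_columns m n \<Otimes>\<^sub>M caps m) (weak_set m n) = (\<integral>\<^sup>+\<omega>. F \<omega> \<partial>iid_columns m n)"
    using assms by (simp add: emeasure_weak_set F_def)
  also have "\<dots> \<le> (\<integral>\<^sup>+\<omega>. ennreal (q ^ m) \<partial>iid_columns m n)"
  proof (rule nn_integral_mono_AE, use key in eventually_elim)
    case (elim \<omega>)
    have "(\<Prod>i\<in>{1..m}. 1 + u \<omega> i) \<le> 1" using elim by (intro prod_one_plus_le_1) auto
    then have "q ^ m * (\<Prod>i\<in>{1..m}. 1 + u \<omega> i) \<le> q ^ m" using q by (simp add: mult_left_le)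
    then show ?case using elim by (auto intro: ennreal_leI)
  qed
  also have "\<dots> = ennreal (q ^ m)" using total by simp
  finally have le: "emeasure (iid_columns m n \<Otimes>\<^sub>M caps m) (weak_set m n) \<le> ennreal (q ^ m)" .
  then have "emeasure (iid_columns m n \<Otimes>\<^sub>M caps m) (weak_set m n) \<noteq> \<infinity>" by (auto simp: top_unique)
  then have eW: "emeasure (iid_columns m n \<Otimes>\<^sub>M caps m) (weak_set m n) = ennreal W"
    unfolding W_def using assms by (subst V_Q_eq_measure) (auto simp: measure_def less_top)
  have W0: "0 \<le> W" by (simp add: W_def V_Q_def Vol_def)
  have "W \<le> q ^ m" using le q unfolding eW by (subst (asm) ennreal_le_iff) auto
  then show "fact (m - 1) ^ n * V_Q m n \<le> (1 - 1 / real m) ^ m" by (simp add: W_def q_def)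
  define v where "v = (real m - 1) / ((real m)\<^sup>2 * (real m + 1))"
  have s_int: "integrable (iid_columns m n) (\<lambda>\<omega>. (s i \<omega>)\<^sup>2)" "(\<integral>\<omega>. (s i \<omega>)\<^sup>2 \<partial>iid_columns m n) = real n * v"
    if "i \<in> {1..m}" for i
    using variance_column_sum[of m "f i" n] centered_coord_moments[OF assms(1) that] assms
    unfolding s_def f_def v_def by auto
  define U where "U \<omega> = (\<Sum>i\<in>{1..m}. (u \<omega> i)\<^sup>2)" for \<omega>
  have U_eq: "U \<omega> = (\<Sum>i\<in>{1..m}. (s i \<omega>)\<^sup>2) / (real n * q)\<^sup>2" for \<omega>
    by (simp add: U_def u_def power_divide sum_divide_distrib)
  have U_int: "integrable (iid_columns m n) U"
    unfolding U_eq[abs_def] using s_int(1) by (intro integrable_divide Bochner_Integration.integrable_sum) auto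
  have U_val: "(\<integral>\<omega>. U \<omega> \<partial>iid_columns m n) = real m / (((real m)\<^sup>2 - 1) * real n)"
  proof -
    have "(\<integral>\<omega>. U \<omega> \<partial>iid_columns m n) = (\<Sum>i\<in>{1..m}. \<integral>\<omega>. (s i \<omega>)\<^sup>2 \<partial>iid_columns m n) / (real n * q)\<^sup>2"
      unfolding U_eq using s_int(1) by (simp add: Bochner_Integration.integral_sum)
    also have "\<dots> = real m * (real n * v) / (real n * q)\<^sup>2" using s_int(2) by simp
    also have "\<dots> = real m * (real n * (real m - 1)) / ((real m + 1) * (real n)\<^sup>2 * (q * real m)\<^sup>2)"
      by (simp add: v_def power_mult_distrib mult_ac)
    also have "\<dots> = real m / (((real m)\<^sup>2 - 1) * real n)"
    proof -
      have "(real m)\<^sup>2 - 1 = (real m - 1) * (real m + 1)" by (simp add: power2_eq_square algebra_simps)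
      then show ?thesis unfolding q(2) using assms by (simp add: power2_eq_square)
    qed
    finally show ?thesis .
  qed
  have U0: "0 \<le> U \<omega>" for \<omega> by (simp add: U_def sum_nonneg)
  have "ennreal (q ^ m) = (\<integral>\<^sup>+\<omega>. ennreal (q ^ m) \<partial>iid_columns m n)" using total by simp
  \<comment> \<open>The defect is moved to the side of F, since 1 - 4 U can be negative and has no
    faithful extended nonnegative version.\<close>
  also have "\<dots> \<le> (\<integral>\<^sup>+\<omega>. F \<omega> + ennreal (q ^ m * 4 * U \<omega>) \<partial>iid_columns m n)"
  proof (rule nn_integral_mono_AE, use key in eventually_elim)
    case (elim \<omega>)
    have "1 - 4 * U \<omega> \<le> (\<Prod>i\<in>{1..m}. 1 + u \<omega> i)"
      unfolding U_def using elim by (intro prod_one_plus_ge) auto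
    then have "q ^ m * (1 - 4 * U \<omega>) \<le> q ^ m * (\<Prod>i\<in>{1..m}. 1 + u \<omega> i)"
      using q by (intro mult_left_mono) auto
    then have "q ^ m \<le> q ^ m * (\<Prod>i\<in>{1..m}. 1 + u \<omega> i) + q ^ m * 4 * U \<omega>" by (simp add: algebra_simps)
    moreover have "0 \<le> (\<Prod>i\<in>{1..m}. 1 + u \<omega> i)" using elim
      by (intro prod_nonneg) (use add_mono[of 1 1 "- 1"] in force)
    ultimately show ?case using elim q U0[of \<omega>]
      by (auto simp: ennreal_plus[symmetric] simp del: ennreal_plus intro!: ennreal_leI)
  qed
  also have "\<dots> = ennreal W + (\<integral>\<^sup>+\<omega>. ennreal (q ^ m * 4 * U \<omega>) \<partial>iid_columns m n)"
    unfolding eW[symmetric] eF using U_int by (intro nn_integral_add Fm) auto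
  also have "(\<integral>\<^sup>+\<omega>. ennreal (q ^ m * 4 * U \<omega>) \<partial>iid_columns m n) = ennreal (\<integral>\<omega>. q ^ m * 4 * U \<omega> \<partial>iid_columns m n)"
    using U_int U0 q by (intro nn_integral_eq_integral) auto
  also have "(\<integral>\<omega>. q ^ m * 4 * U \<omega> \<partial>iid_columns m n) = q ^ m * 4 * (real m / (((real m)\<^sup>2 - 1) * real n))"
    by (simp add: U_val)
  also have "ennreal W + ennreal (q ^ m * 4 * (real m / (((real m)\<^sup>2 - 1) * real n))) =
      ennreal (W + q ^ m * 4 * (real m / (((real m)\<^sup>2 - 1) * real n)))"
    using W0 q assms by (intro ennreal_plus[symmetric]) (auto intro!: mult_nonneg_nonneg)
  finally have "q ^ m \<le> W + q ^ m * 4 * (real m / (((real m)\<^sup>2 - 1) * real n))"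
    using W0 q assms by (subst (asm) ennreal_le_iff) (auto intro!: add_nonneg_nonneg mult_nonneg_nonneg)
  then show "(1 - 1 / real m) ^ m * (1 - 4 * real m / (((real m)\<^sup>2 - 1) * real n)) \<le> fact (m - 1) ^ n * V_Q m n"
    unfolding W_def[symmetric] q_def[symmetric] by (simp only: right_diff_distrib times_divide_eq_right mult_1_right mult.assoc)
qed

section \<open>Asymptotics\<close>

text \<open>An error depending on m + n alone is what makes the limit independent of how the pairs
  grow.\<close>

lemma asymp_mnI:
  assumes "\<And>m n. 2 \<le> m \<Longrightarrow> 1 \<le> n \<Longrightarrow> 1 - C / real (m + n) \<le> a m n / b m n"
    and "\<And>m n. 2 \<le> m \<Longrightarrow> 1 \<le> n \<Longrightarrow> a m n / b m n \<le> 1"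
  shows "asymp_mn a b"
  unfolding asymp_mn_def
proof (intro allI impI)
  fix \<mu> \<nu> :: "nat \<Rightarrow> nat"
  assume mn: "\<forall>k. 2 \<le> \<mu> k \<and> 1 \<le> \<nu> k" and lim: "filterlim (\<lambda>k. \<mu> k + \<nu> k) at_top sequentially"
  have "(\<lambda>k. C / real (\<mu> k + \<nu> k)) \<longlonglongrightarrow> 0"
    using filterlim_compose[OF filterlim_real_sequentially lim]
    by (intro real_tendsto_divide_at_top[OF tendsto_const])
  then have "(\<lambda>k. 1 - C / real (\<mu> k + \<nu> k)) \<longlonglongrightarrow> 1 - 0"
    by (intro tendsto_diff tendsto_const)
  then have lower: "(\<lambda>k. 1 - C / real (\<mu> k + \<nu> k)) \<longlonglongrightarrow> 1" by simp
  show "(\<lambda>k. a (\<mu> k) (\<nu> k) / b (\<mu> k) (\<nu> k)) \<longlonglongrightarrow> 1"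
    by (rule tendsto_sandwich[OF _ _ lower tendsto_const]) (use mn assms in \<open>auto intro!: always_eventually\<close>)
qed

text \<open>The constant 6 requires 4 m^2 <= 6 (m^2 - 1), that is, m^2 >= 3.\<close>

lemma weak_error_le:
  assumes "2 \<le> m" "1 \<le> n"
  shows "4 * real m / (((real m)\<^sup>2 - 1) * real n) \<le> 6 / (real m * real n)"
proof -
  have "2 * 2 \<le> real m * real m" using assms by (intro mult_mono) auto
  then have "4 * real m * real m \<le> 6 * ((real m)\<^sup>2 - 1)" "0 < (real m)\<^sup>2 - 1"
    by (auto simp: power2_eq_square)
  then have "4 * real m / ((real m)\<^sup>2 - 1) \<le> 6 / real m"
    using assms by (simp add: divide_simps mult_ac)
  then have "4 * real m / ((real m)\<^sup>2 - 1) / real n \<le> 6 / real m / real n"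
    by (intro divide_right_mono) auto
  then show ?thesis by simp
qed

lemma asymp_V_Q: "asymp_mn V_Q (\<lambda>m n. 1 / fact (m - 1) ^ n * (1 - 1 / real m) ^ m)"
proof (rule asymp_mnI[where C = 12])
  fix m n :: nat assume mn: "2 \<le> m" "1 \<le> n"
  let ?q = "(1 - 1 / real m) ^ m"
  have q: "0 < ?q" using mn by simp
  have eq: "V_Q m n / (1 / fact (m - 1) ^ n * ?q) = fact (m - 1) ^ n * V_Q m n / ?q" by simp
  \<comment> \<open>From (m-1)(n-1) >= 0 and mn >= 1; this doubles 6 to the constant 12.\<close>
  have "real (m + n) \<le> 2 * (real m * real n)"
  proof -
    have "0 \<le> (real m - 1) * (real n - 1)" using mn by (intro mult_nonneg_nonneg) auto
    moreover have "1 * 1 \<le> real m * real n" using mn by (intro mult_mono) auto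
    ultimately show ?thesis by (simp add: algebra_simps)
  qed
  then have "6 / (real m * real n) \<le> 12 / real (m + n)" using mn by (simp add: divide_simps)
  then have "1 - 12 / real (m + n) \<le> 1 - 4 * real m / (((real m)\<^sup>2 - 1) * real n)"
    using weak_error_le[OF mn] by linarith
  also have "\<dots> \<le> V_Q m n / (1 / fact (m - 1) ^ n * ?q)"
    unfolding eq using V_Q_bounds(2)[OF mn] q by (simp add: le_divide_eq mult.commute)
  finally show "1 - 12 / real (m + n) \<le> V_Q m n / (1 / fact (m - 1) ^ n * ?q)" .
  show "V_Q m n / (1 / fact (m - 1) ^ n * ?q) \<le> 1"
    unfolding eq using V_Q_bounds(1)[OF mn] q by (simp add: divide_le_eq)
qed

lemma asymp_V_P: "asymp_mn V_P (\<lambda>m n. 1 / fact (m - 1) ^ n * psi n m ^ m)"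
proof (rule asymp_mnI[where C = 24])
  fix m n :: nat assume mn: "2 \<le> m" "1 \<le> n"
  let ?q = "psi n m ^ m"
  have q: "0 < ?q" using psi_pos[OF mn(1)] by simp
  have eq: "V_P m n / (1 / fact (m - 1) ^ n * ?q) = fact (m - 1) ^ n * V_P m n / ?q" by simp
  \<comment> \<open>For n <= m the Jensen bound applies, as 4/m <= 8/(m+n). For m < n the union
    bound does, as m + n <= 2(n+1), and this case fixes the constant 24.\<close>
  have "(1 - 24 / real (m + n)) * ?q \<le> fact (m - 1) ^ n * V_P m n"
  proof (cases "n \<le> m")
    case True
    have "4 / real m \<le> 24 / real (m + n)" using True mn by (simp add: divide_simps)
    then have "(1 - 24 / real (m + n)) * ?q \<le> (1 - 4 / real m) * ?q"
      using q by (intro mult_right_mono) auto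
    also have "\<dots> \<le> fact (m - 1) ^ n * V_P m n"
      using psi_power_le_exp_harm[OF mn] V_P_ge_exp[OF mn] by (simp only: mult.commute)
    finally show ?thesis .
  next
    case False
    have "12 / (real n + 1) \<le> 24 / real (m + n)" using False mn by (simp add: divide_simps)
    then have "(1 - 24 / real (m + n)) * ?q \<le> (1 - 12 / (real n + 1)) * ?q"
      using q by (intro mult_right_mono) auto
    also have "\<dots> \<le> fact (m - 1) ^ n * V_P m n" by (rule V_P_ge[OF mn])
    finally show ?thesis .
  qed
  then show "1 - 24 / real (m + n) \<le> V_P m n / (1 / fact (m - 1) ^ n * ?q)"
    unfolding eq using q by (simp add: le_divide_eq)
  show "V_P m n / (1 / fact (m - 1) ^ n * ?q) \<le> 1"
    unfolding eq using V_P_le[OF mn] q by (simp add: divide_le_eq)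
qed

text \<open>The j = 1 factor of 1/psi is m/(m-1), the inverse of 1 - 1/m. Removing it turns the
  quotient of the two leading terms into the product from j = 2.\<close>

lemma prod_eq_psi:
  assumes "2 \<le> m" "1 \<le> n"
  shows "(\<Prod>j\<in>{2..n}. (1 + 1 / ((real m - 1) * real j)) ^ m) = (1 - 1 / real m) ^ m / psi n m ^ m"
proof -
  have I: "{1..n} = insert 1 {2..n}" using assms by auto
  have "inverse (psi n m) = (\<Prod>j\<in>{1..n}. 1 + 1 / ((real m - 1) * real j))"
    unfolding psi_eq_prod[OF assms(1)] by (simp add: prod_inversef[unfolded o_def])
  also have "\<dots> = (1 + 1 / (real m - 1)) * (\<Prod>j\<in>{2..n}. 1 + 1 / ((real m - 1) * real j))"
    unfolding I by (subst prod.insert) auto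
  also have "1 + 1 / (real m - 1) = inverse (1 - 1 / real m)" using assms by (simp add: divide_simps)
  finally have "(\<Prod>j\<in>{2..n}. 1 + 1 / ((real m - 1) * real j)) = (1 - 1 / real m) / psi n m"
    using assms psi_pos[OF assms(1), of n] by (simp add: divide_simps mult_ac)
  then show ?thesis by (simp add: prod_power_distrib[symmetric] power_divide)
qed

lemma asymp_vol_ratio: "asymp_mn vol_ratio (\<lambda>m n. \<Prod>j\<in>{2..n}. (1 + 1 / ((real m - 1) * real j)) ^ m)"
  unfolding asymp_mn_def
proof (intro allI impI)
  fix \<mu> \<nu> :: "nat \<Rightarrow> nat"
  assume mn: "\<forall>k. 2 \<le> \<mu> k \<and> 1 \<le> \<nu> k" and lim: "filterlim (\<lambda>k. \<mu> k + \<nu> k) at_top sequentially"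
  define Q where "Q m n = V_Q m n / (1 / fact (m - 1) ^ n * (1 - 1 / real m) ^ m)" for m n
  define P where "P m n = V_P m n / (1 / fact (m - 1) ^ n * psi n m ^ m)" for m n
  have "(\<lambda>k. Q (\<mu> k) (\<nu> k)) \<longlonglongrightarrow> 1" "(\<lambda>k. P (\<mu> k) (\<nu> k)) \<longlonglongrightarrow> 1"
    using asymp_V_Q asymp_V_P mn lim unfolding asymp_mn_def Q_def P_def by blast+
  then have "(\<lambda>k. Q (\<mu> k) (\<nu> k) / P (\<mu> k) (\<nu> k)) \<longlonglongrightarrow> 1 / 1" by (intro tendsto_divide) auto
  moreover have "Q m n / P m n = vol_ratio m n / (\<Prod>j\<in>{2..n}. (1 + 1 / ((real m - 1) * real j)) ^ m)"
    if "2 \<le> m" "1 \<le> n" for m n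
    unfolding prod_eq_psi[OF that] Q_def P_def vol_ratio_def by simp
  ultimately show "(\<lambda>k. vol_ratio (\<mu> k) (\<nu> k) /
      (\<Prod>j\<in>{2..\<nu> k}. (1 + 1 / ((real (\<mu> k) - 1) * real j)) ^ \<mu> k)) \<longlonglongrightarrow> 1"
    using mn by simp
qed

text \<open>The upper bound is (1-1/m)^m <= 1/e. The lower one loses x <= 2/m in replacing (1-1/m)^m
  by 1/e and at most 6/m from the variance, together less than 10/m; for m <= 10 its left side is
  nonpositive.\<close>

lemma V_Q_exp_bounds:
  assumes "2 \<le> m" "1 \<le> n"
  shows "fact (m - 1) ^ n * V_Q m n \<le> exp (- 1)" "(1 - 10 / real m) * exp (- 1) \<le> fact (m - 1) ^ n * V_Q m n"
proof -
  have "(1 - 1 / real m) ^ m \<le> exp (- (1 / real m)) ^ m"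
    using assms exp_ge_add_one_self[of "- (1 / real m)"] by (intro power_mono) auto
  also have "\<dots> = exp (- 1)" using assms by (simp add: exp_of_nat_mult[symmetric])
  finally show "fact (m - 1) ^ n * V_Q m n \<le> exp (- 1)" using V_Q_bounds(1)[OF assms] by linarith
  show "(1 - 10 / real m) * exp (- 1) \<le> fact (m - 1) ^ n * V_Q m n"
  proof (cases "m \<le> 10")
    case True
    have "(1 - 10 / real m) * exp (- 1) \<le> 0"
      using True assms by (intro mult_nonpos_nonneg) (auto simp: divide_simps)
    also have "0 \<le> fact (m - 1) ^ n * V_Q m n" by (simp add: V_Q_def Vol_def)
    finally show ?thesis .
  next
    case False
    \<comment> \<open>1 - 1/m = 1/(1+x) and 1 + x <= exp x, so (1-1/m)^m >= exp(-m x), where m x = 1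
      + x.\<close>
    define x where "x = 1 / (real m - 1)"
    define e where "e = 4 * real m / (((real m)\<^sup>2 - 1) * real n)"
    have x: "0 \<le> x" "x \<le> 2 / real m" using False by (auto simp: x_def divide_simps)
    have "e \<le> 6 / (real m * real n)" unfolding e_def by (rule weak_error_le[OF assms])
    also have "\<dots> \<le> 6 / (real m * 1)" using assms by (intro divide_left_mono mult_left_mono) auto
    finally have e: "e \<le> 6 / real m" by simp
    have e0: "0 \<le> e" using assms by (auto simp: e_def intro!: divide_nonneg_nonneg mult_nonneg_nonneg)
    have small: "6 / real m \<le> 1" using False by simp
    have "1 - 1 / real m = inverse (1 + x)" using assms by (simp add: x_def divide_simps)
    also have "\<dots> \<ge> exp (- x)"
      unfolding exp_minus using x exp_ge_add_one_self[of x] by (intro le_imp_inverse_le) auto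
    finally have "exp (- x) ^ m \<le> (1 - 1 / real m) ^ m" by (intro power_mono) auto
    moreover have "exp (- x) ^ m = exp (- 1) * exp (- x)"
    proof -
      have "real m * x = 1 + x" using assms by (simp add: x_def divide_simps)
      then show ?thesis by (simp add: exp_of_nat_mult[symmetric] exp_add[symmetric])
    qed
    moreover have "exp (- 1) * (1 - x) \<le> exp (- 1) * exp (- x)"
      using exp_ge_add_one_self[of "- x"] by (intro mult_left_mono) auto
    ultimately have "exp (- 1) * (1 - x) \<le> (1 - 1 / real m) ^ m" by linarith
    then have "exp (- 1) * (1 - x) * (1 - e) \<le> (1 - 1 / real m) ^ m * (1 - e)"
      using e small by (intro mult_right_mono) auto
    also have "\<dots> \<le> fact (m - 1) ^ n * V_Q m n" unfolding e_def by (rule V_Q_bounds(2)[OF assms])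
    finally have 1: "exp (- 1) * ((1 - x) * (1 - e)) \<le> fact (m - 1) ^ n * V_Q m n" by (simp only: mult.assoc)
    have "1 - 10 / real m \<le> 1 - x - e" using x e by (simp add: field_simps)
    also have "\<dots> \<le> (1 - x) * (1 - e)" using x e0 by (simp add: algebra_simps)
    finally have "exp (- 1) * (1 - 10 / real m) \<le> exp (- 1) * ((1 - x) * (1 - e))"
      by (intro mult_left_mono) auto
    with 1 show ?thesis by (simp only: mult.commute)
  qed
qed

theorem theorem4:
  "asymp_mn V_Q (\<lambda>m n. 1 / fact (m - 1) ^ n * (1 - 1 / real m) ^ m) \<and>
   asymp_mn V_P (\<lambda>m n. 1 / fact (m - 1) ^ n * psi n m ^ m) \<and>
   asymp_mn vol_ratio (\<lambda>m n. \<Prod>j\<in>{2..n}. (1 + 1 / ((real m - 1) * real j)) ^ m) \<and>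
   (\<forall>m n :: nat. 2 \<le> m \<longrightarrow> 1 \<le> n \<longrightarrow>
      psi n m = Gamma (1 + 1 / (real m - 1)) * Gamma (real n + 1)
                  / Gamma (real n + 1 + 1 / (real m - 1)) \<and>
      (1 - 12 / (real n + 1)) * psi n m ^ m \<le> fact (m - 1) ^ n * V_P m n \<and>
      fact (m - 1) ^ n * V_P m n \<le> psi n m ^ m \<and>
      (1 - 10 / real m) * exp (- 1) \<le> fact (m - 1) ^ n * V_Q m n \<and>
      fact (m - 1) ^ n * V_Q m n \<le> exp (- 1) \<and>
      (\<exists>\<theta>::real. 0 \<le> \<theta> \<and> \<theta> \<le> 1 / (real m - 1) \<and>
         ln (\<Prod>j\<in>{2..n}. (1 + 1 / ((real m - 1) * real j)) ^ m)
           = real m / (real m - 1) * (harm n - 1) - \<theta>))"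
  using asymp_V_Q asymp_V_P asymp_vol_ratio psi_Gamma V_P_ge V_P_le V_Q_exp_bounds ln_prod_eq_harm
  by (intro conjI allI impI)

end
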